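(* Let $\mathbf r\in\mathcal N^1_1$ be a nonspecial collection of residues and let $\alpha$ be a nonspecial collection of parabolic weights for degree $1$. Put $\epsilon_i=(\alpha_i^+-\alpha_i^-)/2$ and suppose that $\alpha$ is in the (a)-unstable zone, i.e. $\epsilon_1+\epsilon_2+\epsilon_3+\epsilon_4<1/2$. Then there is a set-theoretical isomorphism (constructibly algebraic, but not a morphism of stacks) from the points of $\mathcal P$ to the fixed point set of $\mathbb G_m$ acting on the moduli space of $\alpha$-stable strictly parabolic Higgs bundles, $$\mathbf V_\alpha:\mathcal P\xrightarrow{\ \cong\ }\big(\mathcal M^{1,\alpha}_0(0)\big)^{\mathbb G_m},$$ such that for every $(E,\nabla,P_\bullet)\in\mathcal M^{1,\alpha}_1(\mathbf r)$ one has $$\lim_{u\to0}(E,u\nabla,P_\bullet)=\mathbf V_\alpha\big(\Upsilon(E,\nabla,P_\bullet)\big),$$ where the limit is taken in the $\alpha$-stable Hodge moduli stack $\mathcal M^{1,\alpha}(\lambda\mathbf r)\to\mathbb A^1$.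
   Context: Work over $\mathbb C$; $X=\mathbb P^1$, $D=\{t_1,t_2,t_3,t_4\}$ four distinct points, $U=X-D$. A (rank 2) quasiparabolic bundle $(E,P_\bullet)$ is a rank 2 vector bundle $E$ on $X$ with lines $P_i\subset E_{t_i}$, $i=1,\dots,4$. For $\lambda\in\mathbb C$, a quasiparabolic logarithmic $\lambda$-connection $(E,\nabla,P_\bullet)$ has in addition a map $\nabla:E\to E\otimes\Omega^1_X(\log D)$ with $\nabla(ae)=a\nabla(e)+\lambda\,e\,da$ whose residues $\mathrm{res}(\nabla,t_i)$ preserve $P_i$. For $\lambda=1$ it is a logarithmic connection, for $\lambda=0$ a parabolic Higgs bundle (then write $\theta$ for $\nabla$). Residues: $\mathcal N^d_1=\{(r_i^{\pm})_{1\le i\le4}\in\mathbb C^8:\ \sum_i(r_i^++r_i^-)+d=0\}$. $\mathbf r\in\mathcal N^d_1$ is nonspecial if $r_1^{\sigma_1}+r_2^{\sigma_2}+r_3^{\sigma_3}+r_4^{\sigma_4}\notin\mathbb Z$ for all signs $\sigma_i\in\{+,-\}$ (Kostov-generic) and $r_i^+-r_i^-\notin\mathbb Z$ for all $i$ (nonresonant). $\mathcal M^d(\lambda\mathbf r)\to\mathbb A^1$ is the moduli stack of $(\lambda,E,\nabla,P_\bullet)$ with $\deg E=d$ such that $\mathrm{res}(\nabla,t_i)$ acts by $\lambda r_i^-$ on $P_i$ and by $\lambda r_i^+$ on $E_{t_i}/P_i$; its fibers over $\lambda=1,0$ are $\mathcal M^d_1(\mathbf r)$ and $\mathcal M^d_0(0)$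 (strictly parabolic Higgs bundles). $\mathbb G_m$ acts by $u\cdot(\lambda,E,\nabla,P_\bullet)=(u\lambda,E,u\nabla,P_\bullet)$. Weights: $\alpha=(\alpha_i^\pm)_{1\le i\le 4}$ real with $\alpha_i^-\le\alpha_i^+\le\alpha_i^-+1$; nonspecial for degree $d$ if $\alpha_i^-<\alpha_i^+<\alpha_i^-+1$ for all $i$ and $\sum_i\alpha_i^{\sigma_i}+\frac{d-\sum_i(\alpha_i^++\alpha_i^-)}2\notin\mathbb Z$ for all signs $\sigma_i$. Put $\deg^{\rm par}(E)=\deg E-\sum_i(\alpha_i^++\alpha_i^-)$, and for a line subbundle $F\subset E$, $\deg^{\rm par}(F)=\deg F-\sum_i\alpha_i^{\sigma(i,F)}$ with $\sigma(i,F)=-$ if $F_{t_i}=P_i$ and $+$ otherwise. $(E,\nabla,P_\bullet)$ is $\alpha$-semistable (resp. $\alpha$-stable) if $\deg^{\rm par}(F)\le$ (resp. $<$) $\deg^{\rm par}(E)/2$ for every $\nabla$-invariant line subbundle $F$. For nonspecial $\alpha$ the two notions agree. $\mathcal M^{d,\alpha}(\lambda\mathbf r)$, $\mathcal M_1^{d,\alpha}(\mathbf r)$, $\mathcal M_0^{d,\alpha}(0)$ denote the open substacks of $\alpha$-semistable objects. Limit: $\lim_{u\to0}(E,u\nabla,P_\bullet)$ is the value at $u=0$ of an extension to $\mathbb A^1$ of $\mathbb G_m\to\mathcal M^{d,\alpha}(\lambda\mathbf r)$, $u\mapsto(E,u\nabla,P_\bullet)$; it exists and is unique up to isomorphism.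 $\mathcal P$ is the non-separated scheme obtained by glueing two copies $\mathcal P^+,\mathcal P^-$ of $\mathbb P^1$ by the identity along $U$. The map $\Upsilon:\mathcal M^1_1(\mathbf r)\to\mathcal P$ (apparent singularity): for nonspecial $\mathbf r$, each $(E,\nabla,P_\bullet)\in\mathcal M^1_1(\mathbf r)$ is irreducible, $E\cong\mathcal O\oplus\mathcal O(1)$, and $E$ has a unique line subbundle $L$ of degree $1$. The connection induces a nonzero $\mathcal O_X$-linear map $\varphi:L\to(E/L)\otimes\Omega^1_X(\log D)$ which has exactly one zero; $\Upsilon$ is the position of this zero, and if it is $t_i$, the point is taken in $\mathcal P^-$ if $L_{t_i}=P_i$ and in $\mathcal P^+$ otherwise. *)

theory Defs
  imports
    "HOL-Analysis.Analysis"
    "HOL-Computational_Algebra.Polynomial"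
    "HOL-Library.Disjoint_Sets"
begin

section \<open>The projective line and its double\<close>

datatype p1 = Fin complex | Infty

text \<open>The two standard affine charts, with coordinate \<open>z\<close> on \<open>Chart0\<close> and \<open>w = 1/z\<close> on \<open>ChartInf\<close>.\<close>

datatype chart = Chart0 | ChartInf

fun pt :: "chart \<Rightarrow> complex \<Rightarrow> p1" where
  "pt Chart0 z = Fin z"
| "pt ChartInf w = (if w = 0 then Infty else Fin (1 / w))"

text \<open>The divisor \<open>D\<close> is given by \<open>t :: 4 \<Rightarrow> p1\<close>, assumed injective in the theorem.\<close>

definition div_in :: "(4 \<Rightarrow> p1) \<Rightarrow> chart \<Rightarrow> complex set" where
  "div_in t c = {x. pt c x \<in> range t}"

text \<open>On a chart with coordinate \<open>x\<close> the line bundle of logarithmic differentials is freely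
  generated by \<open>dx / h\<close>, where \<open>h = log_den t c\<close>.\<close>

definition log_den :: "(4 \<Rightarrow> p1) \<Rightarrow> chart \<Rightarrow> complex \<Rightarrow> complex" where
  "log_den t c x = (\<Prod>a\<in>div_in t c. x - a)"

text \<open>A chart around \<open>t i\<close>, with the coordinate of \<open>t i\<close> in it.\<close>

definition loc :: "(4 \<Rightarrow> p1) \<Rightarrow> 4 \<Rightarrow> chart \<times> complex" where
  "loc t i = (case t i of Fin a \<Rightarrow> (Chart0, a) | Infty \<Rightarrow> (ChartInf, 0))"

datatype psign = Plus | Minus

text \<open>The points of \<open>\<P>\<close>: two copies of the projective line, identified away from \<open>D\<close>.\<close>

definition glue :: "(4 \<Rightarrow> p1) \<Rightarrow> ((p1 \<times> psign) \<times> (p1 \<times> psign)) set" where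
  "glue t = {((x, \<sigma>), (y, \<tau>)). x = y \<and> (\<sigma> = \<tau> \<or> x \<notin> range t)}"

type_synonym dpoint = "(p1 \<times> psign) set"

definition dpoints :: "(4 \<Rightarrow> p1) \<Rightarrow> dpoint set" where
  "dpoints t = UNIV // glue t"

definition dpt :: "(4 \<Rightarrow> p1) \<Rightarrow> psign \<Rightarrow> p1 \<Rightarrow> dpoint" where
  "dpt t \<sigma> x = glue t `` {(x, \<sigma>)}"

text \<open>The four affine lines \<open>dchart t (\<sigma>, c)\<close> form an open cover of \<open>\<P>\<close>.\<close>

fun dchart :: "(4 \<Rightarrow> p1) \<Rightarrow> psign \<times> chart \<Rightarrow> complex \<Rightarrow> dpoint" where
  "dchart t (\<sigma>, c) x = dpt t \<sigma> (pt c x)"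

section \<open>Quasiparabolic logarithmic \<open>\<lambda>\<close>-connections of rank 2\<close>

definition poly_fun :: "(complex \<Rightarrow> complex) \<Rightarrow> bool" where
  "poly_fun f \<longleftrightarrow> (\<exists>p. \<forall>x. f x = poly p x)"

definition laurent_fun :: "(complex \<Rightarrow> complex) \<Rightarrow> bool" where
  "laurent_fun f \<longleftrightarrow> (\<exists>p n. \<forall>x. x \<noteq> 0 \<longrightarrow> f x = poly p x / x ^ n)"

definition cscale :: "complex \<Rightarrow> complex^2^2 \<Rightarrow> complex^2^2" where
  "cscale a M = (\<chi> i j. a * M $ i $ j)"

definition vderiv :: "(complex \<Rightarrow> complex^2) \<Rightarrow> complex \<Rightarrow> complex^2" where
  "vderiv f x = (\<chi> i. deriv (\<lambda>y. f y $ i) x)"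

definition mderiv :: "(complex \<Rightarrow> complex^2^2) \<Rightarrow> complex \<Rightarrow> complex^2^2" where
  "mderiv M x = (\<chi> i j. deriv (\<lambda>y. M y $ i $ j) x)"

text \<open>Every vector bundle on an affine line is free, so a rank 2 bundle \<open>E\<close> on the projective line
  is given by frames on the two charts and a transition matrix \<open>trans\<close> over the Laurent
  polynomials: if \<open>v0\<close> and \<open>v1\<close> are the coordinates of a section in \<open>Chart0\<close> and \<open>ChartInf\<close>, then
  \<open>v1 (1/z) = trans z *v v0 z\<close> for \<open>z \<noteq> 0\<close> (the value of \<open>trans\<close> at 0 is irrelevant).
  In the frame on the chart \<open>c\<close> with coordinate \<open>x\<close>, the \<open>\<lambda>\<close>-connection is
  \<open>v \<mapsto> \<lambda> dv + B v dx / h\<close> with \<open>\<lambda> = lam\<close>, \<open>B = conn c\<close> and \<open>h = log_den t c\<close>.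
  The line \<open>par i\<close> in the fibre at \<open>t i\<close> is given in the frame on the chart \<open>fst (loc t i)\<close>.\<close>

record lconn =
  lam :: complex
  trans :: "complex \<Rightarrow> complex^2^2"
  conn :: "chart \<Rightarrow> complex \<Rightarrow> complex^2^2"
  par :: "4 \<Rightarrow> (complex^2) set"

text \<open>The coefficient of \<open>dx / h\<close> in \<open>\<nabla> f\<close>.\<close>

definition nabla :: "(4 \<Rightarrow> p1) \<Rightarrow> lconn \<Rightarrow> chart \<Rightarrow> (complex \<Rightarrow> complex^2) \<Rightarrow> complex \<Rightarrow> complex^2" where
  "nabla t X c f x = (lam X * log_den t c x) *s vderiv f x + conn X c x *v f x"

definition residue_at :: "(4 \<Rightarrow> p1) \<Rightarrow> lconn \<Rightarrow> 4 \<Rightarrow> complex^2^2" where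
  "residue_at t X i = (case loc t i of (c, a) \<Rightarrow>
     cscale (1 / (\<Prod>b\<in>div_in t c - {a}. a - b)) (conn X c a))"

text \<open>The last clause of \<open>rank2_bundle\<close> is \<open>deg E = d\<close>: the bundle \<open>\<O>(n)\<close> has transition
  function \<open>z powi (- n)\<close>.\<close>

definition rank2_bundle :: "int \<Rightarrow> lconn \<Rightarrow> bool" where
  "rank2_bundle d X \<longleftrightarrow>
     (\<forall>i j. laurent_fun (\<lambda>z. trans X z $ i $ j)) \<and>
     (\<exists>k. k \<noteq> 0 \<and> (\<forall>z. z \<noteq> 0 \<longrightarrow> det (trans X z) = k * z powi (- d)))"

text \<open>The gluing condition is the gauge transformation formula between the connection matrices
  \<open>B0 dz / h0\<close> and \<open>B1 dw / h1\<close>, using \<open>dw = - dz / z\<^sup>2\<close>.\<close>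

definition connection :: "(4 \<Rightarrow> p1) \<Rightarrow> lconn \<Rightarrow> bool" where
  "connection t X \<longleftrightarrow>
     (\<forall>c i j. poly_fun (\<lambda>x. conn X c x $ i $ j)) \<and>
     (\<forall>z. z \<noteq> 0 \<and> Fin z \<notin> range t \<longrightarrow>
        trans X z ** cscale (1 / log_den t Chart0 z) (conn X Chart0 z) =
        cscale (lam X) (mderiv (trans X) z) +
        cscale (- 1 / (z\<^sup>2 * log_den t ChartInf (1 / z))) (conn X ChartInf (1 / z)) ** trans X z)"

definition parabolic :: "(4 \<Rightarrow> p1) \<Rightarrow> lconn \<Rightarrow> bool" where
  "parabolic t X \<longleftrightarrow>
     (\<forall>i. vec.subspace (par X i) \<and> vec.dim (par X i) = 1 \<and>
          (\<forall>v\<in>par X i. residue_at t X i *v v \<in> par X i))"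

definition qp_connection :: "(4 \<Rightarrow> p1) \<Rightarrow> int \<Rightarrow> lconn \<Rightarrow> bool" where
  "qp_connection t d X \<longleftrightarrow> rank2_bundle d X \<and> connection t X \<and> parabolic t X"

text \<open>\<open>\<rho> i Minus\<close> and \<open>\<rho> i Plus\<close> are the eigenvalues on \<open>P\<^sub>i\<close> and on the quotient by \<open>P\<^sub>i\<close>.\<close>

definition has_residues :: "(4 \<Rightarrow> p1) \<Rightarrow> (4 \<Rightarrow> psign \<Rightarrow> complex) \<Rightarrow> lconn \<Rightarrow> bool" where
  "has_residues t \<rho> X \<longleftrightarrow>
     (\<forall>i. (\<forall>v\<in>par X i. residue_at t X i *v v = \<rho> i Minus *s v) \<and>
          (\<forall>v. residue_at t X i *v v - \<rho> i Plus *s v \<in> par X i))"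

definition isomorphism :: "(4 \<Rightarrow> p1) \<Rightarrow> lconn \<Rightarrow> lconn \<Rightarrow> (chart \<Rightarrow> complex \<Rightarrow> complex^2^2) \<Rightarrow> bool" where
  "isomorphism t X Y \<phi> \<longleftrightarrow>
     lam X = lam Y \<and>
     (\<forall>c i j. poly_fun (\<lambda>x. \<phi> c x $ i $ j)) \<and>
     (\<forall>c x. det (\<phi> c x) \<noteq> 0) \<and>
     (\<forall>z. z \<noteq> 0 \<longrightarrow> trans Y z ** \<phi> Chart0 z = \<phi> ChartInf (1 / z) ** trans X z) \<and>
     (\<forall>c x. cscale (lam X * log_den t c x) (mderiv (\<phi> c) x) + conn Y c x ** \<phi> c x =
            \<phi> c x ** conn X c x) \<and>
     (\<forall>i. (case loc t i of (c, a) \<Rightarrow> (\<lambda>v. \<phi> c a *v v) ` par X i) = par Y i)"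

definition isomorphic :: "(4 \<Rightarrow> p1) \<Rightarrow> lconn \<Rightarrow> lconn \<Rightarrow> bool" where
  "isomorphic t X Y \<longleftrightarrow> (\<exists>\<phi>. isomorphism t X Y \<phi>)"

text \<open>The action of \<open>u\<close> in the multiplicative group.\<close>

definition act :: "complex \<Rightarrow> lconn \<Rightarrow> lconn" where
  "act u X = X\<lparr>lam := u * lam X, conn := (\<lambda>c x. cscale u (conn X c x))\<rparr>"

section \<open>Line subbundles and stability\<close>

text \<open>A line subbundle is given by a nowhere vanishing generator on each chart, which is unique up to
  a nonzero constant; \<open>n\<close> is its degree.\<close>

definition line_subbundle :: "lconn \<Rightarrow> (chart \<Rightarrow> complex \<Rightarrow> complex^2) \<Rightarrow> int \<Rightarrow> bool" where
  "line_subbundle X f n \<longleftrightarrow>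
     (\<forall>c j. poly_fun (\<lambda>x. f c x $ j)) \<and>
     (\<forall>c x. f c x \<noteq> 0) \<and>
     (\<exists>k. k \<noteq> 0 \<and> (\<forall>z. z \<noteq> 0 \<longrightarrow>
        trans X z *v f Chart0 z = (k * z powi (- n)) *s f ChartInf (1 / z)))"

definition fibre_at :: "(4 \<Rightarrow> p1) \<Rightarrow> (chart \<Rightarrow> complex \<Rightarrow> complex^2) \<Rightarrow> 4 \<Rightarrow> (complex^2) set" where
  "fibre_at t f i = (case loc t i of (c, a) \<Rightarrow> vec.span {f c a})"

definition invariant :: "(4 \<Rightarrow> p1) \<Rightarrow> lconn \<Rightarrow> (chart \<Rightarrow> complex \<Rightarrow> complex^2) \<Rightarrow> bool" where
  "invariant t X f \<longleftrightarrow> (\<forall>c x. nabla t X c (f c) x \<in> vec.span {f c x})"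

definition weights :: "(4 \<Rightarrow> psign \<Rightarrow> real) \<Rightarrow> bool" where
  "weights \<alpha> \<longleftrightarrow> (\<forall>i. \<alpha> i Minus \<le> \<alpha> i Plus \<and> \<alpha> i Plus \<le> \<alpha> i Minus + 1)"

definition nonspecial_weights :: "int \<Rightarrow> (4 \<Rightarrow> psign \<Rightarrow> real) \<Rightarrow> bool" where
  "nonspecial_weights d \<alpha> \<longleftrightarrow>
     (\<forall>i. \<alpha> i Minus < \<alpha> i Plus \<and> \<alpha> i Plus < \<alpha> i Minus + 1) \<and>
     (\<forall>\<sigma> :: 4 \<Rightarrow> psign.
        (\<Sum>i\<in>UNIV. \<alpha> i (\<sigma> i)) + (of_int d - (\<Sum>i\<in>UNIV. \<alpha> i Plus + \<alpha> i Minus)) / 2 \<notin> \<int>)"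

definition pardeg :: "(4 \<Rightarrow> psign \<Rightarrow> real) \<Rightarrow> int \<Rightarrow> real" where
  "pardeg \<alpha> d = of_int d - (\<Sum>i\<in>UNIV. \<alpha> i Plus + \<alpha> i Minus)"

definition pardeg_sub ::
    "(4 \<Rightarrow> p1) \<Rightarrow> (4 \<Rightarrow> psign \<Rightarrow> real) \<Rightarrow> lconn \<Rightarrow> (chart \<Rightarrow> complex \<Rightarrow> complex^2) \<Rightarrow> int \<Rightarrow> real" where
  "pardeg_sub t \<alpha> X f n =
     of_int n - (\<Sum>i\<in>UNIV. \<alpha> i (if fibre_at t f i = par X i then Minus else Plus))"

definition semistable :: "(4 \<Rightarrow> p1) \<Rightarrow> int \<Rightarrow> (4 \<Rightarrow> psign \<Rightarrow> real) \<Rightarrow> lconn \<Rightarrow> bool" where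
  "semistable t d \<alpha> X \<longleftrightarrow>
     (\<forall>f n. line_subbundle X f n \<and> invariant t X f \<longrightarrow> pardeg_sub t \<alpha> X f n \<le> pardeg \<alpha> d / 2)"

section \<open>Moduli\<close>

definition residue_data :: "int \<Rightarrow> (4 \<Rightarrow> psign \<Rightarrow> complex) set" where
  "residue_data d = {r. (\<Sum>i\<in>UNIV. r i Plus + r i Minus) + of_int d = 0}"

definition nonspecial_residues :: "(4 \<Rightarrow> psign \<Rightarrow> complex) \<Rightarrow> bool" where
  "nonspecial_residues r \<longleftrightarrow>
     (\<forall>\<sigma> :: 4 \<Rightarrow> psign. (\<Sum>i\<in>UNIV. r i (\<sigma> i)) \<notin> \<int>) \<and>
     (\<forall>i. r i Plus - r i Minus \<notin> \<int>)"

text \<open>The \<open>\<alpha>\<close>-semistable \<open>l\<close>-connections of degree \<open>d\<close> with residue eigenvalues \<open>\<rho>\<close>.\<close>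

definition objects ::
    "(4 \<Rightarrow> p1) \<Rightarrow> int \<Rightarrow> (4 \<Rightarrow> psign \<Rightarrow> real) \<Rightarrow> complex \<Rightarrow> (4 \<Rightarrow> psign \<Rightarrow> complex) \<Rightarrow> lconn set" where
  "objects t d \<alpha> l \<rho> =
     {X. qp_connection t d X \<and> lam X = l \<and> has_residues t \<rho> X \<and> semistable t d \<alpha> X}"

definition connections ::
    "(4 \<Rightarrow> p1) \<Rightarrow> int \<Rightarrow> (4 \<Rightarrow> psign \<Rightarrow> real) \<Rightarrow> (4 \<Rightarrow> psign \<Rightarrow> complex) \<Rightarrow> lconn set" where
  "connections t d \<alpha> r = objects t d \<alpha> 1 r"

definition higgs_bundles ::
    "(4 \<Rightarrow> p1) \<Rightarrow> int \<Rightarrow> (4 \<Rightarrow> psign \<Rightarrow> real) \<Rightarrow> lconn set" where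
  "higgs_bundles t d \<alpha> = objects t d \<alpha> 0 (\<lambda>_ _. 0)"

text \<open>The fibre over \<open>l\<close> of the Hodge moduli stack.\<close>

definition hodge_fibre ::
    "(4 \<Rightarrow> p1) \<Rightarrow> int \<Rightarrow> (4 \<Rightarrow> psign \<Rightarrow> real) \<Rightarrow> (4 \<Rightarrow> psign \<Rightarrow> complex) \<Rightarrow> complex \<Rightarrow> lconn set" where
  "hodge_fibre t d \<alpha> r l = objects t d \<alpha> l (\<lambda>i \<sigma>. l * r i \<sigma>)"

text \<open>Points of the moduli space of Higgs bundles are isomorphism classes of objects.\<close>

definition higgs_points :: "(4 \<Rightarrow> p1) \<Rightarrow> int \<Rightarrow> (4 \<Rightarrow> psign \<Rightarrow> real) \<Rightarrow> lconn set set" where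
  "higgs_points t d \<alpha> =
     higgs_bundles t d \<alpha> //
       {(X, Y). X \<in> higgs_bundles t d \<alpha> \<and> Y \<in> higgs_bundles t d \<alpha> \<and> isomorphic t X Y}"

definition fixed_points :: "(4 \<Rightarrow> p1) \<Rightarrow> int \<Rightarrow> (4 \<Rightarrow> psign \<Rightarrow> real) \<Rightarrow> lconn set set" where
  "fixed_points t d \<alpha> =
     {C \<in> higgs_points t d \<alpha>. \<forall>X\<in>C. \<forall>u. u \<noteq> 0 \<longrightarrow> act u X \<in> C}"

section \<open>Algebraic families\<close>

text \<open>The bases are (reduced) locally closed subsets \<open>S\<close> of the affine line, i.e. finite or cofinite
  sets; the regular functions on such \<open>S\<close> are the fractions \<open>p / q\<close> with \<open>q\<close> nonvanishing on \<open>S\<close>.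
  The predicates below describe the regular functions on \<open>S\<close>, on \<open>S\<close> times the affine line, and
  on \<open>S\<close> times the punctured line. Over such bases, vector bundles on \<open>S\<close> times a chart and line
  subbundles of a free bundle on \<open>S\<close> are free (projective modules over a principal ideal domain
  \<open>R\<close> and over \<open>R[x]\<close> are free), so matrix data describe all families.\<close>

definition loc_closed :: "complex set \<Rightarrow> bool" where
  "loc_closed S \<longleftrightarrow> finite S \<or> finite (- S)"

definition regular_base :: "complex set \<Rightarrow> (complex \<Rightarrow> complex) \<Rightarrow> bool" where
  "regular_base S f \<longleftrightarrow>
     (\<exists>p q. (\<forall>s\<in>S. poly q s \<noteq> 0 \<and> f s = poly p s / poly q s))"

definition regular_line :: "complex set \<Rightarrow> (complex \<Rightarrow> complex \<Rightarrow> complex) \<Rightarrow> bool" where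
  "regular_line S f \<longleftrightarrow>
     (\<exists>p q. (\<forall>s\<in>S. poly q s \<noteq> 0 \<and> (\<forall>x. f s x = poly (poly p [:x:]) s / poly q s)))"

definition regular_punctured :: "complex set \<Rightarrow> (complex \<Rightarrow> complex \<Rightarrow> complex) \<Rightarrow> bool" where
  "regular_punctured S f \<longleftrightarrow>
     (\<exists>p q n. (\<forall>s\<in>S. poly q s \<noteq> 0 \<and>
        (\<forall>z. z \<noteq> 0 \<longrightarrow> f s z = poly (poly p [:z:]) s / (poly q s * z ^ n))))"

definition algebraic_family :: "complex set \<Rightarrow> (complex \<Rightarrow> lconn) \<Rightarrow> bool" where
  "algebraic_family S F \<longleftrightarrow>
     regular_base S (\<lambda>s. lam (F s)) \<and>
     (\<forall>i j. regular_punctured S (\<lambda>s z. trans (F s) z $ i $ j)) \<and>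
     (\<forall>c i j. regular_line S (\<lambda>s x. conn (F s) c x $ i $ j)) \<and>
     (\<forall>i. \<exists>v. (\<forall>j. regular_base S (\<lambda>s. v s $ j)) \<and>
        (\<forall>s\<in>S. v s \<noteq> 0 \<and> par (F s) i = vec.span {v s}))"

definition family_iso ::
    "(4 \<Rightarrow> p1) \<Rightarrow> complex set \<Rightarrow> (complex \<Rightarrow> lconn) \<Rightarrow> (complex \<Rightarrow> lconn) \<Rightarrow>
     (complex \<Rightarrow> chart \<Rightarrow> complex \<Rightarrow> complex^2^2) \<Rightarrow> bool" where
  "family_iso t S F G \<phi> \<longleftrightarrow>
     (\<forall>c i j. regular_line S (\<lambda>s x. \<phi> s c x $ i $ j)) \<and>
     (\<forall>s\<in>S. isomorphism t (F s) (G s) (\<phi> s))"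

section \<open>The limit\<close>

text \<open>An extension to the affine line, as a section of the Hodge moduli stack, of the orbit of \<open>X\<close>.\<close>

definition orbit_extension ::
    "(4 \<Rightarrow> p1) \<Rightarrow> int \<Rightarrow> (4 \<Rightarrow> psign \<Rightarrow> real) \<Rightarrow> (4 \<Rightarrow> psign \<Rightarrow> complex) \<Rightarrow> lconn \<Rightarrow> (complex \<Rightarrow> lconn) \<Rightarrow> bool" where
  "orbit_extension t d \<alpha> r X F \<longleftrightarrow>
     algebraic_family UNIV F \<and>
     (\<forall>s. F s \<in> hodge_fibre t d \<alpha> r s) \<and>
     (\<exists>\<phi>. family_iso t (- {0}) F (\<lambda>u. act u X) \<phi>)"

text \<open>The set of all Higgs bundles which are limits of \<open>u \<cdot> X\<close>. That it equals a given
  isomorphism class says that the limit exists, is unique up to isomorphism, and is that class.\<close>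

definition limit_class ::
    "(4 \<Rightarrow> p1) \<Rightarrow> int \<Rightarrow> (4 \<Rightarrow> psign \<Rightarrow> real) \<Rightarrow> (4 \<Rightarrow> psign \<Rightarrow> complex) \<Rightarrow> lconn \<Rightarrow> lconn set" where
  "limit_class t d \<alpha> r X =
     {H \<in> higgs_bundles t d \<alpha>. \<exists>F. orbit_extension t d \<alpha> r X F \<and> isomorphic t (F 0) H}"

section \<open>The apparent singularity\<close>

text \<open>The point \<open>p\<close> is a zero of the map from the line subbundle to the quotient twisted by
  logarithmic differentials.\<close>

definition apparent_zero :: "(4 \<Rightarrow> p1) \<Rightarrow> lconn \<Rightarrow> (chart \<Rightarrow> complex \<Rightarrow> complex^2) \<Rightarrow> p1 \<Rightarrow> bool" where
  "apparent_zero t X f p \<longleftrightarrow>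
     (\<exists>c x. pt c x = p \<and> nabla t X c (f c) x \<in> vec.span {f c x})"

definition Upsilon :: "(4 \<Rightarrow> p1) \<Rightarrow> lconn \<Rightarrow> dpoint" where
  "Upsilon t X = (THE q. \<exists>f p \<sigma>.
     line_subbundle X f 1 \<and> apparent_zero t X f p \<and> q = dpt t \<sigma> p \<and>
     (\<forall>i. t i = p \<longrightarrow> (\<sigma> = Minus \<longleftrightarrow> fibre_at t f i = par X i)))"

section \<open>Algebraicity of maps from \<open>\<P>\<close> to the moduli of Higgs bundles\<close>

text \<open>There is a finite partition of \<open>\<P>\<close> into locally closed pieces, each contained in one of the
  standard charts, on each of which \<open>V\<close> is induced by an algebraic family.\<close>

definition constructibly_algebraic :: "(4 \<Rightarrow> p1) \<Rightarrow> (dpoint \<Rightarrow> lconn set) \<Rightarrow> bool" where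
  "constructibly_algebraic t V \<longleftrightarrow>
     (\<exists>Z :: ((psign \<times> chart) \<times> complex set) set.
        finite Z \<and>
        partition_on (dpoints t) ((\<lambda>(a, S). dchart t a ` S) ` Z) \<and>
        (\<forall>(a, S)\<in>Z. loc_closed S \<and>
           (\<exists>F. algebraic_family S F \<and> (\<forall>s\<in>S. F s \<in> V (dchart t a s)))))"

definition overlap :: "(4 \<Rightarrow> p1) \<Rightarrow> psign \<times> chart \<Rightarrow> psign \<times> chart \<Rightarrow> complex set" where
  "overlap t a b = {s. dchart t a s \<in> range (dchart t b)}"

definition coord_change :: "psign \<times> chart \<Rightarrow> psign \<times> chart \<Rightarrow> complex \<Rightarrow> complex" where
  "coord_change a b s = (if snd a = snd b then s else 1 / s)"

text \<open>A morphism from \<open>\<P>\<close> to the stack is a family on each of the four affine lines covering \<open>\<P>\<close>,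
  with isomorphisms on the overlaps satisfying the cocycle condition; \<open>V\<close> is the induced map from
  points to isomorphism classes.\<close>

definition stack_morphism :: "(4 \<Rightarrow> p1) \<Rightarrow> (dpoint \<Rightarrow> lconn set) \<Rightarrow> bool" where
  "stack_morphism t V \<longleftrightarrow>
     (\<exists>F \<phi>.
        (\<forall>a. algebraic_family UNIV (F a) \<and> (\<forall>s. F a s \<in> V (dchart t a s))) \<and>
        (\<forall>a b. family_iso t (overlap t a b) (F a) (\<lambda>s. F b (coord_change a b s)) (\<phi> a b)) \<and>
        (\<forall>a b e. \<forall>s\<in>overlap t a b \<inter> overlap t a e. \<forall>c x.
           \<phi> b e (coord_change a b s) c x ** \<phi> a b s c x = \<phi> a e s c x))"

end

theory Submission
  imports Defs "HOL-Computational_Algebra.Fundamental_Theorem_Algebra"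
    "HOL-Computational_Algebra.Field_as_Ring" "HOL-Computational_Algebra.Polynomial_Factorial"
begin

text \<open>In the (a)-unstable zone the parabolic structure does not affect stability: an object of degree 1 is
  semistable iff it has no invariant line subbundle of positive degree. Hence \<open>E = \<O>(1) \<oplus> \<O>\<close>, and the map
  \<open>L \<rightarrow> (E/L) \<otimes> \<Omega>(log D)\<close> is a nonzero section of \<open>\<O>(1)\<close>, with one zero. A Higgs bundle fixed by the
  multiplicative group is a direct sum \<open>L \<oplus> M\<close> whose Higgs field is such a section, and whose parabolic lines
  are \<open>M\<close> except possibly at the zero; it is determined by a point of \<open>\<P>\<close>. Conjugating \<open>u \<nabla>\<close> by
  \<open>diag(1, u)\<close> keeps this section and kills everything else as \<open>u\<close> tends to 0, which gives the limit; it is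
  unique because a morphism between stable Higgs bundles is zero or an isomorphism.\<close>

section \<open>Polynomial functions\<close>

text \<open>\<open>Upsilon\<close> makes sense for Higgs bundles too, and this drives the argument:
  it is an isomorphism invariant, it recovers the point of \<P> from its model (hence injectivity),
  and the degeneration does not change it, because passing to the limit preserves the set of indices
  with P_i = L as well as the section. This set has at most one element: P_i = L forces the residue
  to preserve L, so t_i is the zero of the section. Thus the limit remembers one bit of the
  parabolic lines, and only at an apparent singularity lying on D; this is the origin of the doubled
  points of \<P>. The same bit obstructs algebraicity: along the copy with sign
  \<open>Minus\<close>, the line at t_i is M for all s other than t_i and jumps to L at s = t_i.
  Since a bundle is given only by a Laurent transition matrix, splittings, sections of O(k) and
  closedness of incidence conditions are all reduced to degrees and continuity of
  polynomials.\<close>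

lemma poly_fun_poly: "poly_fun (\<lambda>x. poly p x)"
  unfolding poly_fun_def by auto

lemma poly_fun_const: "poly_fun (\<lambda>x. c)"
  unfolding poly_fun_def by (rule exI[of _ "[:c:]"]) simp

lemma poly_fun_id: "poly_fun (\<lambda>x. x)"
  unfolding poly_fun_def by (rule exI[of _ "[:0, 1:]"]) simp

lemma poly_fun_add:
  assumes "poly_fun f" "poly_fun g" shows "poly_fun (\<lambda>x. f x + g x)"
  using assms unfolding poly_fun_def by (metis poly_add)

lemma poly_fun_mult:
  assumes "poly_fun f" "poly_fun g" shows "poly_fun (\<lambda>x. f x * g x)"
  using assms unfolding poly_fun_def by (metis poly_mult)

lemma poly_fun_diff:
  assumes "poly_fun f" "poly_fun g" shows "poly_fun (\<lambda>x. f x - g x)"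
  using assms unfolding poly_fun_def by (metis poly_diff)

lemma poly_fun_minus:
  assumes "poly_fun f" shows "poly_fun (\<lambda>x. - f x)"
  using assms unfolding poly_fun_def by (metis poly_minus)

lemma poly_fun_divide_const:
  assumes "poly_fun f" shows "poly_fun (\<lambda>x. f x / k)"
  using poly_fun_mult[OF assms poly_fun_const[of "1/k"]] by simp

lemma poly_fun_power: "poly_fun (\<lambda>x. x ^ n)"
  unfolding poly_fun_def by (rule exI[of _ "monom 1 n"]) (simp add: poly_monom)

lemma poly_fun_prod:
  assumes "\<And>a. a \<in> A \<Longrightarrow> poly_fun (f a)" shows "poly_fun (\<lambda>x. \<Prod>a\<in>A. f a x)"
  using assms
proof (induction A rule: infinite_finite_induct)
  case (insert a A)
  then show ?case by (auto intro!: poly_fun_mult)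
qed (auto intro: poly_fun_const)

lemmas poly_fun_intros = poly_fun_const poly_fun_id poly_fun_add poly_fun_mult poly_fun_diff
  poly_fun_minus poly_fun_divide_const poly_fun_prod poly_fun_poly

lemma poly_fun_differentiable: "poly_fun f \<Longrightarrow> f field_differentiable (at x)"
proof -
  assume "poly_fun f"
  then obtain p where "f = poly p" unfolding poly_fun_def by auto
  then show ?thesis unfolding field_differentiable_def using poly_DERIV by blast
qed

lemma poly_fun_deriv: "poly_fun f \<Longrightarrow> poly_fun (deriv f)"
proof -
  assume "poly_fun f"
  then obtain p where p: "f = poly p" unfolding poly_fun_def by auto
  have "deriv f = poly (pderiv p)" using p poly_DERIV DERIV_imp_deriv by blast
  then show ?thesis by (simp add: poly_fun_poly)
qed

lemma poly_fun_nonvanishing_const: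
  assumes "poly_fun f" "\<And>x. f x \<noteq> 0"
  obtains k where "k \<noteq> 0" "f = (\<lambda>_. k)"
proof -
  obtain p where p: "f = poly p" using assms(1) unfolding poly_fun_def by auto
  have "degree p = 0"
  proof (rule ccontr)
    assume "degree p \<noteq> 0"
    then have "\<not> constant (poly p)" by (simp add: constant_degree)
    then show False using fundamental_theorem_of_algebra p assms(2) by blast
  qed
  then obtain k where "p = [:k:]" using degree_eq_zeroE by blast
  then have "f = (\<lambda>_. k)" "k \<noteq> 0" using p assms(2)[of 0] by auto
  then show ?thesis using that by blast
qed

lemma poly_eqI_cofinite:
  fixes p q :: "complex poly"
  assumes "finite S" "\<And>x. x \<notin> S \<Longrightarrow> poly p x = poly q x"
  shows "p = q"
proof (rule ccontr)
  assume "p \<noteq> q"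
  then have "finite {x. poly (p - q) x = 0}" using poly_roots_finite[of "p - q"] by simp
  moreover have "UNIV \<subseteq> S \<union> {x. poly (p - q) x = 0}" using assms(2) by auto
  ultimately have "finite (UNIV :: complex set)" using assms(1) by (meson finite_UnI finite_subset)
  then show False using infinite_UNIV_char_0 by blast
qed

lemma poly_fun_eqI_cofinite:
  assumes "poly_fun f" "poly_fun g" "finite S" "\<And>x. x \<notin> S \<Longrightarrow> f x = g x"
  shows "f = g"
  using assms poly_eqI_cofinite[OF assms(3)] unfolding poly_fun_def
  by (metis (full_types) ext)

text \<open>A section of O(n - m) is a polynomial of degree at most n - m, and is zero if n < m.
  Multiplication by z ^ degree q turns q(1/z) into the reflected polynomial, and degrees can be
  compared.\<close>

lemma poly_reciprocal_degree:
  fixes p q :: "complex poly"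
  assumes "finite S" and eq: "\<And>z. z \<notin> S \<Longrightarrow> z \<noteq> 0 \<Longrightarrow> poly p z * z ^ m = z ^ n * poly q (1 / z)"
  shows "p = 0 \<or> degree p + m \<le> n"
proof -
  have "p * monom 1 (m + degree q) = monom 1 n * reflect_poly q"
  proof (rule poly_eqI_cofinite[of "insert 0 S"])
    show "finite (insert 0 S)" using assms by simp
    fix z assume "z \<notin> insert 0 S"
    then have "z \<noteq> 0" "poly p z * z ^ m = z ^ n * poly q (1 / z)" using eq by auto
    then show "poly (p * monom 1 (m + degree q)) z = poly (monom 1 n * reflect_poly q) z"
      by (simp add: poly_monom poly_reflect_poly_nz power_add divide_inverse)
  qed
  moreover have "degree (monom 1 n * reflect_poly q) \<le> n + degree q"
    by (metis add_mono degree_monom_le degree_mult_le degree_reflect_poly_le order_trans)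
  moreover have "p \<noteq> 0 \<Longrightarrow> degree (p * monom 1 (m + degree q)) = degree p + (m + degree q)"
    by (simp add: degree_mult_eq degree_monom_eq)
  ultimately show ?thesis by (metis add.assoc add_le_cancel_right)
qed

lemma poly_degree_le_1:
  assumes "degree (p :: complex poly) \<le> 1"
  shows "poly p x = coeff p 0 + coeff p 1 * x"
proof -
  have "p = [:coeff p 0, coeff p 1:]"
    using assms by (intro poly_eqI) (auto simp: coeff_pCons coeff_eq_0 split: nat.split)
  then show ?thesis by (metis poly_pCons poly_0 mult.commute mult_zero_right add.right_neutral)
qed

section \<open>Laurent polynomials, the functions on the overlap of the two charts\<close>

lemma laurent_poly: "poly_fun f \<Longrightarrow> laurent_fun f"
  unfolding poly_fun_def laurent_fun_def by (metis div_by_1 power_0)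

lemma laurent_fun_cong:
  "laurent_fun f \<Longrightarrow> (\<And>z. z \<noteq> 0 \<Longrightarrow> f z = g z) \<Longrightarrow> laurent_fun g"
  unfolding laurent_fun_def by metis

lemma laurent_fun_add:
  assumes "laurent_fun f" "laurent_fun g" shows "laurent_fun (\<lambda>z. f z + g z)"
proof -
  obtain p n q m where "\<forall>x. x \<noteq> 0 \<longrightarrow> f x = poly p x / x ^ n" "\<forall>x. x \<noteq> 0 \<longrightarrow> g x = poly q x / x ^ m"
    using assms unfolding laurent_fun_def by blast
  then have "\<forall>x. x \<noteq> 0 \<longrightarrow> f x + g x = poly (p * monom 1 m + q * monom 1 n) x / x ^ (n + m)"
    by (simp add: poly_monom power_add field_simps)
  then show ?thesis unfolding laurent_fun_def by blast
qed

lemma laurent_fun_mult: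
  assumes "laurent_fun f" "laurent_fun g" shows "laurent_fun (\<lambda>z. f z * g z)"
proof -
  obtain p n q m where "\<forall>x. x \<noteq> 0 \<longrightarrow> f x = poly p x / x ^ n" "\<forall>x. x \<noteq> 0 \<longrightarrow> g x = poly q x / x ^ m"
    using assms unfolding laurent_fun_def by blast
  then have "\<forall>x. x \<noteq> 0 \<longrightarrow> f x * g x = poly (p * q) x / x ^ (n + m)"
    by (simp add: power_add)
  then show ?thesis unfolding laurent_fun_def by blast
qed

lemma laurent_fun_reciprocal:
  assumes "poly_fun f" shows "laurent_fun (\<lambda>z. f (1 / z))"
proof -
  obtain p where p: "f = poly p" using assms unfolding poly_fun_def by auto
  have "\<forall>x. x \<noteq> 0 \<longrightarrow> f (1 / x) = poly (reflect_poly p) x / x ^ degree p"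
    unfolding p by (simp add: poly_reflect_poly_nz divide_inverse)
  then show ?thesis unfolding laurent_fun_def by blast
qed

lemma laurent_fun_differentiable:
  assumes "laurent_fun f" "x \<noteq> 0" shows "f field_differentiable (at x)"
proof -
  obtain p n where p: "\<forall>x. x \<noteq> 0 \<longrightarrow> f x = poly p x / x ^ n"
    using assms unfolding laurent_fun_def by blast
  have "(\<lambda>x. poly p x / x ^ n) field_differentiable (at x)"
    using assms(2) by (intro field_differentiable_divide field_differentiable_power
      field_differentiable_ident poly_fun_differentiable poly_fun_poly) auto
  moreover have "eventually (\<lambda>y. y \<noteq> 0) (nhds x)"
    using assms(2) t1_space_nhds by blast
  ultimately show ?thesis
    unfolding field_differentiable_def
    by (smt (verit, ccfv_threshold) DERIV_cong_ev eventually_mono p)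
qed

text \<open>This is the vanishing of the first cohomology of O(-1): a Laurent polynomial is a part
  regular at 0 plus a part vanishing at infinity. It serves to remove an extension class.\<close>

lemma laurent_fun_split:
  assumes "laurent_fun f"
  obtains p q where "\<And>z. z \<noteq> 0 \<Longrightarrow> f z = poly p z + poly q (1 / z) / z"
proof -
  obtain g n where g: "\<forall>x. x \<noteq> 0 \<longrightarrow> f x = poly g x / x ^ n"
    using assms unfolding laurent_fun_def by blast
  have "\<exists>p q. \<forall>z. z \<noteq> 0 \<longrightarrow> poly g z / z ^ n = poly p z + poly q (1 / z) / z" for g :: "complex poly"
  proof (induction n)
    case 0
    show ?case by (rule exI[of _ g], rule exI[of _ 0]) simp
  next
    case (Suc n)
    then obtain p q where pq: "\<forall>z. z \<noteq> 0 \<longrightarrow> poly g z / z ^ n = poly p z + poly q (1 / z) / z"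
      by blast
    \<comment> \<open>One more division by z moves the constant coefficient \<open>a\<close> of the
      polynomial part to the front of the polar part.\<close>
    obtain a p' where p': "p = pCons a p'" by (cases p)
    show ?case
    proof (intro exI allI impI)
      fix z :: complex assume z: "z \<noteq> 0"
      have "poly g z / z ^ Suc n = (poly p z + poly q (1 / z) / z) / z"
        using pq[rule_format, OF z] by (simp add: mult.commute[of z] flip: divide_divide_eq_left)
      also have "\<dots> = poly p' z + poly (pCons a q) (1 / z) / z"
        using z p' by (simp add: add_divide_distrib)
      finally show "poly g z / z ^ Suc n = poly p' z + poly (pCons a q) (1 / z) / z" .
    qed
  qed
  from this[of g] obtain p q where "\<And>z. z \<noteq> 0 \<Longrightarrow> poly g z / z ^ n = poly p z + poly q (1 / z) / z"
    by blast
  then show ?thesis using that[of p q] g by simp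
qed

section \<open>Matrices of size 2\<close>

definition adj2 :: "complex^2^2 \<Rightarrow> complex^2^2" where
  "adj2 A = (\<chi> i j. if i = j then (if i = 1 then A $ 2 $ 2 else A $ 1 $ 1) else - A $ i $ j)"

definition inv2 :: "complex^2^2 \<Rightarrow> complex^2^2" where
  "inv2 A = cscale (1 / det A) (adj2 A)"

definition mat2 :: "complex \<Rightarrow> complex \<Rightarrow> complex \<Rightarrow> complex \<Rightarrow> complex^2^2" where
  "mat2 a b c d = (\<chi> i j. if i = 1 then (if j = 1 then a else b) else (if j = 1 then c else d))"

definition vec2 :: "complex \<Rightarrow> complex \<Rightarrow> complex^2" where
  "vec2 a b = (\<chi> i. if i = 1 then a else b)"

lemma mat2_nth [simp]: "mat2 a b c d $ 1 $ 1 = a" "mat2 a b c d $ 1 $ 2 = b"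
  "mat2 a b c d $ 2 $ 1 = c" "mat2 a b c d $ 2 $ 2 = d"
  by (simp_all add: mat2_def)

lemma vec2_nth [simp]: "vec2 a b $ 1 = a" "vec2 a b $ 2 = b"
  by (simp_all add: vec2_def)

lemma cscale_nth [simp]: "cscale a A $ i $ j = a * A $ i $ j"
  by (simp add: cscale_def)

lemma mat2_eqI:
  fixes A B :: "complex^2^2"
  shows "A $ 1 $ 1 = B $ 1 $ 1 \<Longrightarrow> A $ 1 $ 2 = B $ 1 $ 2 \<Longrightarrow> A $ 2 $ 1 = B $ 2 $ 1 \<Longrightarrow> A $ 2 $ 2 = B $ 2 $ 2
    \<Longrightarrow> A = B"
  by (simp add: vec_eq_iff forall_2)

lemma vec2_eqI: "(v :: complex^2) $ 1 = w $ 1 \<Longrightarrow> v $ 2 = w $ 2 \<Longrightarrow> v = w"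
  by (simp add: vec_eq_iff forall_2)

lemma matrix_mult_nth: "((A :: complex^2^2) ** B) $ i $ j = A $ i $ 1 * B $ 1 $ j + A $ i $ 2 * B $ 2 $ j"
  by (simp add: matrix_matrix_mult_def sum_2)

lemma matrix_vec_nth: "((A :: complex^2^2) *v v) $ i = A $ i $ 1 * v $ 1 + A $ i $ 2 * v $ 2"
  by (simp add: matrix_vector_mult_def sum_2)

lemma mat_1_nth [simp]: "(mat 1 :: complex^2^2) $ 1 $ 1 = 1" "(mat 1 :: complex^2^2) $ 1 $ 2 = 0"
  "(mat 1 :: complex^2^2) $ 2 $ 1 = 0" "(mat 1 :: complex^2^2) $ 2 $ 2 = 1"
  by (simp_all add: mat_def)

lemma adj2_nth [simp]: "adj2 A $ 1 $ 1 = A $ 2 $ 2" "adj2 A $ 1 $ 2 = - A $ 1 $ 2"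
  "adj2 A $ 2 $ 1 = - A $ 2 $ 1" "adj2 A $ 2 $ 2 = A $ 1 $ 1"
  by (simp_all add: adj2_def)

lemma det_mat2: "det (A :: complex^2^2) = A $ 1 $ 1 * A $ 2 $ 2 - A $ 1 $ 2 * A $ 2 $ 1"
  by (simp add: det_2)

lemma inv2_right: "det A \<noteq> 0 \<Longrightarrow> A ** inv2 A = mat 1"
  by (rule mat2_eqI) (simp_all add: inv2_def matrix_mult_nth field_simps,
      simp_all add: det_mat2 algebra_simps)

lemma inv2_left: "det A \<noteq> 0 \<Longrightarrow> inv2 A ** A = mat 1"
  by (rule mat2_eqI) (simp_all add: inv2_def matrix_mult_nth field_simps,
      simp_all add: det_mat2 algebra_simps)

lemma det_inv2: "det A \<noteq> 0 \<Longrightarrow> det (inv2 A) = 1 / det A"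
  by (metis det_I det_mul inv2_right nonzero_mult_div_cancel_left)

lemma cscale_mult_left: "cscale a A ** B = cscale a (A ** B)"
  and cscale_mult_right: "A ** cscale a B = cscale a (A ** B)"
  and cscale_cscale: "cscale a (cscale b A) = cscale (a * b) A"
  and cscale_add: "cscale a (A + B) = cscale a A + cscale a B"
  and cscale_diff: "cscale a (A - B) = cscale a A - cscale a B"
  and cscale_0: "cscale 0 A = 0"
  by (rule mat2_eqI; simp add: matrix_mult_nth algebra_simps)+

lemma cscale_vec: "cscale a A *v v = a *s (A *v v)"
  by (rule vec2_eqI; simp add: matrix_vec_nth algebra_simps)

lemma mat2_vscale: "(A :: complex^2^2) *v (a *s v) = a *s (A *v v)"
  by (rule vec2_eqI; simp add: matrix_vec_nth algebra_simps)

lemma mat2_diff_rdistrib: "((A :: complex^2^2) - B) ** C = A ** C - B ** C"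
  and mat2_diff_ldistrib: "C ** (A - B) = C ** A - (C :: complex^2^2) ** B"
  and mat2_add_rdistrib: "(A + B) ** C = A ** C + B ** C"
  and mat2_add_ldistrib: "C ** (A + B) = C ** A + C ** B"
  by (rule mat2_eqI; simp add: matrix_mult_nth algebra_simps)+

lemma mat2_cancel_right:
  "det (C :: complex^2^2) \<noteq> 0 \<Longrightarrow> A ** C = B ** C \<Longrightarrow> A = B"
  by (metis inv2_right matrix_mul_assoc matrix_mul_rid)

lemma mat2_cancel_left:
  "det (C :: complex^2^2) \<noteq> 0 \<Longrightarrow> C ** A = C ** B \<Longrightarrow> A = B"
  by (metis inv2_left matrix_mul_assoc matrix_mul_lid)

lemma mat2_vec_eq_0: "det (A :: complex^2^2) \<noteq> 0 \<Longrightarrow> A *v v = 0 \<Longrightarrow> v = 0"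
  by (metis inv2_left matrix_vector_mul_assoc matrix_vector_mul_lid matrix_vector_mult_0_right)

text \<open>Membership in a line becomes the vanishing of a determinant, an equation that passes to
  limits by continuity.\<close>

lemma span_singleton_iff:
  assumes "w \<noteq> (0 :: complex^2)"
  shows "v \<in> vec.span {w} \<longleftrightarrow> v $ 1 * w $ 2 = v $ 2 * w $ 1"
proof
  assume "v \<in> vec.span {w}"
  then show "v $ 1 * w $ 2 = v $ 2 * w $ 1" by (auto simp: vec.span_singleton)
next
  assume eq: "v $ 1 * w $ 2 = v $ 2 * w $ 1"
  consider "w $ 1 \<noteq> 0" | "w $ 2 \<noteq> 0" using assms vec2_eqI[of w 0] by auto
  then have "\<exists>k. v = k *s w"
  proof cases
    case 1
    then have "v = (v $ 1 / w $ 1) *s w" using eq by (intro vec2_eqI) (auto simp: field_simps)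
    then show ?thesis by blast
  next
    case 2
    then have "v = (v $ 2 / w $ 2) *s w" using eq by (intro vec2_eqI) (auto simp: field_simps)
    then show ?thesis by blast
  qed
  then show "v \<in> vec.span {w}" by (auto simp: vec.span_singleton)
qed

lemma span_image: "(\<lambda>v. (A :: complex^2^2) *v v) ` vec.span {w} = vec.span {A *v w}"
  by (auto simp: vec.span_singleton mat2_vscale image_iff)

lemma span_singleton_eq:
  assumes "v \<in> vec.span {w}" "v \<noteq> (0 :: complex^2)"
  shows "vec.span {v} = vec.span {w}"
proof -
  obtain k where k: "v = k *s w" using assms(1) by (auto simp: vec.span_singleton)
  then have "k \<noteq> 0" using assms(2) by auto
  then have "w = (1/k) *s v" using k by (simp add: vector_smult_assoc)
  then have "w \<in> vec.span {v}" by (auto simp: vec.span_singleton)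
  then show ?thesis using assms(1) by (simp add: vec.span_eq)
qed

lemma line_exists:
  assumes "vec.subspace P" "vec.dim (P :: (complex^2) set) = 1"
  obtains v where "v \<noteq> 0" "P = vec.span {v}"
proof -
  obtain B where B: "B \<subseteq> P" "vec.independent B" "P \<subseteq> vec.span B" "card B = vec.dim P"
    using vec.basis_exists by blast
  then obtain v where "B = {v}" using assms(2) by (metis card_1_singletonE)
  then have "v \<noteq> 0" "P = vec.span {v}"
    using B assms(1) vec.dependent_zero by (auto simp: vec.span_minimal subset_antisym)
  then show ?thesis using that by blast
qed

lemma line_span: "v \<noteq> 0 \<Longrightarrow> vec.subspace (vec.span {v :: complex^2}) \<and> vec.dim (vec.span {v}) = 1"
  by simp

lemma line_image_eq:
  assumes "vec.subspace P" "vec.dim P = 1" "vec.subspace Q" "vec.dim Q = 1" "det (A :: complex^2^2) \<noteq> 0"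
    "(\<lambda>v. A *v v) ` P \<subseteq> Q"
  shows "(\<lambda>v. A *v v) ` P = Q"
proof -
  obtain v where v: "v \<noteq> 0" "P = vec.span {v}" using line_exists assms(1,2) by blast
  obtain w where w: "w \<noteq> 0" "Q = vec.span {w}" using line_exists assms(3,4) by blast
  have "A *v v \<noteq> 0" using assms(5) v(1) mat2_vec_eq_0 by blast
  moreover have "A *v v \<in> vec.span {w}"
    using assms(6) v(2) w(2) vec.span_base[of v "{v}"] by auto
  ultimately show ?thesis using v w span_image span_singleton_eq by metis
qed

section \<open>Matrices of polynomials\<close>

definition poly_mat :: "(complex \<Rightarrow> complex^2^2) \<Rightarrow> bool" where
  "poly_mat M \<longleftrightarrow> (\<forall>i j. poly_fun (\<lambda>x. M x $ i $ j))"

definition diff_mat :: "(complex \<Rightarrow> complex^2^2) \<Rightarrow> complex \<Rightarrow> bool" where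
  "diff_mat M x \<longleftrightarrow> (\<forall>i j. (\<lambda>y. M y $ i $ j) field_differentiable (at x))"

lemma poly_matI:
  "poly_fun (\<lambda>x. M x $ 1 $ 1) \<Longrightarrow> poly_fun (\<lambda>x. M x $ 1 $ 2) \<Longrightarrow> poly_fun (\<lambda>x. M x $ 2 $ 1) \<Longrightarrow>
   poly_fun (\<lambda>x. M x $ 2 $ 2) \<Longrightarrow> poly_mat M"
  unfolding poly_mat_def forall_2 by blast

lemma poly_mat_nth: "poly_mat M \<Longrightarrow> poly_fun (\<lambda>x. M x $ i $ j)"
  unfolding poly_mat_def by blast

lemma poly_mat_mult: "poly_mat A \<Longrightarrow> poly_mat B \<Longrightarrow> poly_mat (\<lambda>x. A x ** B x)"
  unfolding poly_mat_def matrix_mult_nth by (intro allI poly_fun_intros; blast)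

lemma poly_mat_diff: "poly_mat A \<Longrightarrow> poly_mat B \<Longrightarrow> poly_mat (\<lambda>x. A x - B x)"
  unfolding poly_mat_def vector_minus_component by (intro allI poly_fun_intros; blast)

lemma poly_mat_cscale: "poly_fun f \<Longrightarrow> poly_mat B \<Longrightarrow> poly_mat (\<lambda>x. cscale (f x) (B x))"
  unfolding poly_mat_def cscale_nth by (intro allI poly_fun_intros; blast)

lemma poly_fun_det: "poly_mat A \<Longrightarrow> poly_fun (\<lambda>x. det (A x))"
  unfolding poly_mat_def det_mat2 by (intro allI poly_fun_intros; blast)

lemma poly_mat_mderiv: "poly_mat A \<Longrightarrow> poly_mat (mderiv A)"
  unfolding poly_mat_def mderiv_def by (simp add: poly_fun_deriv)

lemma poly_mat_det_const:
  assumes "poly_mat A" "\<And>x. det (A x) \<noteq> 0"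
  obtains k where "k \<noteq> 0" "\<And>x. det (A x) = k"
  using poly_fun_nonvanishing_const[OF poly_fun_det] assms by metis

text \<open>The determinant is a nowhere vanishing polynomial, hence constant by the fundamental
  theorem of algebra, so Cramer's formula has no poles.\<close>

lemma poly_mat_inv2:
  assumes "poly_mat A" "\<And>x. det (A x) \<noteq> 0"
  shows "poly_mat (\<lambda>x. inv2 (A x))"
proof -
  obtain k where "k \<noteq> 0" "\<And>x. det (A x) = k" using poly_mat_det_const assms by blast
  then show ?thesis unfolding inv2_def
    by (intro poly_mat_cscale poly_matI)
      (auto intro!: poly_fun_intros poly_mat_nth assms)
qed

lemma poly_mat_diff_mat: "poly_mat A \<Longrightarrow> diff_mat A x"
  unfolding poly_mat_def diff_mat_def using poly_fun_differentiable by blast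

lemma mderiv_mult:
  assumes "diff_mat A x" "diff_mat B x"
  shows "mderiv (\<lambda>x. A x ** B x) x = mderiv A x ** B x + A x ** mderiv B x"
proof -
  have "deriv (\<lambda>y. A y $ i $ 1 * B y $ 1 $ j + A y $ i $ 2 * B y $ 2 $ j) x =
    deriv (\<lambda>y. A y $ i $ 1) x * B x $ 1 $ j + A x $ i $ 1 * deriv (\<lambda>y. B y $ 1 $ j) x +
    (deriv (\<lambda>y. A y $ i $ 2) x * B x $ 2 $ j + A x $ i $ 2 * deriv (\<lambda>y. B y $ 2 $ j) x)" for i j
    using assms unfolding diff_mat_def
    by (subst deriv_add) (auto intro!: field_differentiable_mult)
  note * = this
  show ?thesis
    by (intro mat2_eqI) (simp_all add: mderiv_def matrix_mult_nth *)
qed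

lemma vderiv_mult:
  assumes "diff_mat A x" "\<And>i. (\<lambda>y. v y $ i) field_differentiable (at x)"
  shows "vderiv (\<lambda>x. A x *v v x) x = mderiv A x *v v x + A x *v vderiv v x"
proof -
  have "deriv (\<lambda>y. A y $ i $ 1 * v y $ 1 + A y $ i $ 2 * v y $ 2) x =
    deriv (\<lambda>y. A y $ i $ 1) x * v x $ 1 + A x $ i $ 1 * deriv (\<lambda>y. v y $ 1) x +
    (deriv (\<lambda>y. A y $ i $ 2) x * v x $ 2 + A x $ i $ 2 * deriv (\<lambda>y. v y $ 2) x)" for i
    using assms unfolding diff_mat_def
    by (subst deriv_add) (auto intro!: field_differentiable_mult)
  note * = this
  show ?thesis
    by (intro vec2_eqI) (simp_all add: mderiv_def vderiv_def matrix_vec_nth *)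
qed

lemma mderiv_reciprocal:
  assumes "poly_mat A" "z \<noteq> 0"
  shows "mderiv (\<lambda>z. A (1 / z)) z = cscale (- 1 / z\<^sup>2) (mderiv A (1 / z))"
    and "diff_mat (\<lambda>z. A (1 / z)) z"
proof -
  have *: "((\<lambda>z. A (1 / z) $ i $ j) has_field_derivative - 1 / z\<^sup>2 * deriv (\<lambda>y. A y $ i $ j) (1 / z)) (at z)"
    for i j
  proof -
    have 1: "((\<lambda>y. A y $ i $ j) has_field_derivative deriv (\<lambda>y. A y $ i $ j) (1 / z)) (at (1 / z))"
      using poly_mat_diff_mat[OF assms(1)] unfolding diff_mat_def
      using DERIV_deriv_iff_field_differentiable by blast
    have 2: "((\<lambda>z. 1 / z) has_field_derivative - 1 / z\<^sup>2) (at z)"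
      using assms(2) by (auto intro!: derivative_eq_intros simp: power2_eq_square)
    show ?thesis using DERIV_chain2[OF 1 2] by (simp add: mult.commute)
  qed
  then show "diff_mat (\<lambda>z. A (1 / z)) z" unfolding diff_mat_def field_differentiable_def by blast
  show "mderiv (\<lambda>z. A (1 / z)) z = cscale (- 1 / z\<^sup>2) (mderiv A (1 / z))"
    by (rule mat2_eqI) (simp_all add: mderiv_def DERIV_imp_deriv[OF *])
qed

text \<open>Transition matrices are meaningful only away from 0, and the derivative at z sees only a
  neighbourhood of z.\<close>

lemma mderiv_cong_punctured:
  assumes "z \<noteq> 0" "\<And>z. z \<noteq> 0 \<Longrightarrow> A z = B z"
  shows "mderiv A z = mderiv B z"
proof -
  have "eventually (\<lambda>y. y \<noteq> 0) (nhds z)" using assms(1) t1_space_nhds by blast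
  then have "eventually (\<lambda>y. A y $ i $ j = B y $ i $ j) (nhds z)" for i j
    by eventually_elim (simp add: assms(2))
  then have "deriv (\<lambda>y. A y $ i $ j) z = deriv (\<lambda>y. B y $ i $ j) z" for i j
    by (rule deriv_cong_ev) simp
  then show ?thesis unfolding mderiv_def by simp
qed

lemma mderiv_const [simp]: "mderiv (\<lambda>x. A) x = 0"
  by (rule mat2_eqI) (simp_all add: mderiv_def)

section \<open>Morphisms of \<open>\<lambda>\<close>-connections\<close>

lemma inj_pt: "inj (pt c)"
  by (cases c) (auto simp: inj_def split: if_splits)

lemma finite_div_in: "finite (div_in t c)"
proof -
  have "div_in t c = pt c -` range t" by (auto simp: div_in_def)
  then show ?thesis using finite_vimageI[OF _ inj_pt] by simp
qed

lemma pt_loc: "loc t i = (c, a) \<Longrightarrow> pt c a = t i"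
  by (auto simp: loc_def split: p1.splits)

lemma loc_in_div: "loc t i = (c, a) \<Longrightarrow> a \<in> div_in t c"
  using pt_loc by (simp add: div_in_def)

lemma log_den_loc: "loc t i = (c, a) \<Longrightarrow> log_den t c a = 0"
  unfolding log_den_def using loc_in_div finite_div_in by (meson prod_zero right_minus_eq)

lemma poly_fun_log_den: "poly_fun (log_den t c)"
  unfolding log_den_def by (intro poly_fun_intros)

lemma log_den_eq_0_iff: "log_den t c x = 0 \<longleftrightarrow> pt c x \<in> range t"
  unfolding log_den_def using finite_div_in by (simp add: div_in_def)

abbreviation at_point :: "(4 \<Rightarrow> p1) \<Rightarrow> 4 \<Rightarrow> (chart \<Rightarrow> complex \<Rightarrow> 'a) \<Rightarrow> 'a" where
  "at_point t i F \<equiv> F (fst (loc t i)) (snd (loc t i))"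

text \<open>The factor between residue and connection matrix depends on \<open>t\<close> and
  \<open>i\<close> but not on \<open>X\<close>, so eigenlines, zeros and conjugacy can be read off
  \<open>conn\<close> at \<open>t i\<close>.\<close>

lemma residue_at_eq:
  obtains k where "k \<noteq> 0" "\<And>X. residue_at t X i = cscale k (conn X (fst (loc t i)) (snd (loc t i)))"
proof -
  define k where "k = 1 / (\<Prod>b\<in>div_in t (fst (loc t i)) - {snd (loc t i)}. snd (loc t i) - b)"
  have "k \<noteq> 0" unfolding k_def using finite_div_in by auto
  then show ?thesis using that[of k] unfolding residue_at_def k_def by (simp add: case_prod_beta)
qed

definition quasiparabolic :: "lconn \<Rightarrow> bool" where
  "quasiparabolic X \<longleftrightarrow> (\<forall>i. vec.subspace (par X i) \<and> vec.dim (par X i) = 1)"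

lemma parabolic_quasiparabolic: "parabolic t X \<Longrightarrow> quasiparabolic X"
  by (simp add: parabolic_def quasiparabolic_def)

lemma quasiparabolic_line:
  assumes "quasiparabolic X"
  obtains v where "v \<noteq> 0" "par X i = vec.span {v}"
  using assms line_exists unfolding quasiparabolic_def by metis

text \<open>Invertibility is dropped because a limit of isomorphisms may degenerate; for the same
  reason parabolic lines need only be mapped into, not onto, the target lines.\<close>

definition morphism :: "(4 \<Rightarrow> p1) \<Rightarrow> lconn \<Rightarrow> lconn \<Rightarrow> (chart \<Rightarrow> complex \<Rightarrow> complex^2^2) \<Rightarrow> bool" where
  "morphism t X Y \<phi> \<longleftrightarrow>
     lam X = lam Y \<and>
     (\<forall>c. poly_mat (\<phi> c)) \<and>
     (\<forall>z. z \<noteq> 0 \<longrightarrow> trans Y z ** \<phi> Chart0 z = \<phi> ChartInf (1 / z) ** trans X z) \<and>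
     (\<forall>c x. cscale (lam X * log_den t c x) (mderiv (\<phi> c) x) + conn Y c x ** \<phi> c x =
            \<phi> c x ** conn X c x) \<and>
     (\<forall>i. (\<lambda>v. at_point t i \<phi> *v v) ` par X i \<subseteq> par Y i)"

context
  fixes t X Y \<phi>
  assumes iso: "isomorphism t X Y \<phi>"
begin

lemmas isomorphism_conjs = iso[unfolded isomorphism_def case_prod_beta]

lemma isomorphism_lam: "lam Y = lam X"
  using isomorphism_conjs[THEN conjunct1] by (rule sym)

lemma isomorphism_poly: "poly_mat (\<phi> c)"
  using isomorphism_conjs[THEN conjunct2, THEN conjunct1] by (simp add: poly_mat_def)

lemma isomorphism_det: "det (\<phi> c x) \<noteq> 0"
  by (rule isomorphism_conjs[THEN conjunct2, THEN conjunct2, THEN conjunct1, rule_format])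

lemma isomorphism_trans: "z \<noteq> 0 \<Longrightarrow> trans Y z ** \<phi> Chart0 z = \<phi> ChartInf (1 / z) ** trans X z"
  by (rule isomorphism_conjs[THEN conjunct2, THEN conjunct2, THEN conjunct2, THEN conjunct1, rule_format])

lemma isomorphism_conn:
  "cscale (lam X * log_den t c x) (mderiv (\<phi> c) x) + conn Y c x ** \<phi> c x = \<phi> c x ** conn X c x"
  by (rule isomorphism_conjs[THEN conjunct2, THEN conjunct2, THEN conjunct2, THEN conjunct2, THEN conjunct1,
      rule_format])

lemma isomorphism_par: "par Y i = (\<lambda>v. at_point t i \<phi> *v v) ` par X i"
  by (rule isomorphism_conjs[THEN conjunct2, THEN conjunct2, THEN conjunct2, THEN conjunct2, THEN conjunct2,
      THEN spec, THEN sym])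

lemma isomorphism_imp_morphism: "morphism t X Y \<phi>"
  unfolding morphism_def
  by (intro conjI allI impI isomorphism_lam[symmetric] isomorphism_poly isomorphism_trans isomorphism_conn
      isomorphism_par[symmetric, THEN equalityD1])

end

lemma isomorphismI:
  assumes "lam Y = lam X" "\<And>c. poly_mat (\<phi> c)" "\<And>c x. det (\<phi> c x) \<noteq> 0"
    "\<And>z. z \<noteq> 0 \<Longrightarrow> trans Y z ** \<phi> Chart0 z = \<phi> ChartInf (1 / z) ** trans X z"
    "\<And>c x. cscale (lam X * log_den t c x) (mderiv (\<phi> c) x) + conn Y c x ** \<phi> c x = \<phi> c x ** conn X c x"
    "\<And>i. par Y i = (\<lambda>v. at_point t i \<phi> *v v) ` par X i"
  shows "isomorphism t X Y \<phi>"
  unfolding isomorphism_def case_prod_beta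
  by (intro conjI allI impI assms(1)[symmetric] assms(3-5) assms(6)[symmetric] assms(2)[unfolded poly_mat_def, rule_format])

lemma morphismD:
  assumes "morphism t X Y \<phi>"
  shows "lam Y = lam X" "poly_mat (\<phi> c)"
    "z \<noteq> 0 \<Longrightarrow> trans Y z ** \<phi> Chart0 z = \<phi> ChartInf (1 / z) ** trans X z"
    "cscale (lam X * log_den t c x) (mderiv (\<phi> c) x) + conn Y c x ** \<phi> c x = \<phi> c x ** conn X c x"
    "(\<lambda>v. at_point t i \<phi> *v v) ` par X i \<subseteq> par Y i"
proof -
  note d = assms[unfolded morphism_def]
  show "lam Y = lam X" using d by simp
  show "poly_mat (\<phi> c)" using d by simp
  show "z \<noteq> 0 \<Longrightarrow> trans Y z ** \<phi> Chart0 z = \<phi> ChartInf (1 / z) ** trans X z" using d by simp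
  show "cscale (lam X * log_den t c x) (mderiv (\<phi> c) x) + conn Y c x ** \<phi> c x = \<phi> c x ** conn X c x"
    by (rule d[THEN conjunct2, THEN conjunct2, THEN conjunct2, THEN conjunct1, rule_format])
  show "(\<lambda>v. at_point t i \<phi> *v v) ` par X i \<subseteq> par Y i" using d by simp
qed

lemma morphism_imp_isomorphism:
  assumes "morphism t X Y \<phi>" "\<And>c x. det (\<phi> c x) \<noteq> 0" "quasiparabolic X" "quasiparabolic Y"
  shows "isomorphism t X Y \<phi>"
proof -
  have "(\<lambda>v. at_point t i \<phi> *v v) ` par X i = par Y i" for i
    using assms by (intro line_image_eq) (auto simp: morphism_def quasiparabolic_def)
  note * = this[symmetric]
  show ?thesis
    by (intro isomorphismI morphismD[OF assms(1)] assms(2) *)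
qed

lemmas mat_algebra = mat2_add_ldistrib mat2_add_rdistrib mat2_diff_ldistrib mat2_diff_rdistrib
  cscale_mult_left cscale_mult_right cscale_add cscale_diff cscale_cscale matrix_mul_assoc

lemma morphism_comp:
  assumes "morphism t X Y \<phi>" "morphism t Y Z \<psi>"
  shows "morphism t X Z (\<lambda>c x. \<psi> c x ** \<phi> c x)"
proof -
  note a = morphismD[OF assms(1)] and b = morphismD[OF assms(2)]
  have d: "mderiv (\<lambda>x. \<psi> c x ** \<phi> c x) x = mderiv (\<psi> c) x ** \<phi> c x + \<psi> c x ** mderiv (\<phi> c) x" for c x
    by (intro mderiv_mult poly_mat_diff_mat a b)
  have 1: "cscale (lam X * log_den t c x) (mderiv (\<lambda>x. \<psi> c x ** \<phi> c x) x) + conn Z c x ** (\<psi> c x ** \<phi> c x)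
    = (\<psi> c x ** \<phi> c x) ** conn X c x" for c x
  proof -
    have "cscale (lam X * log_den t c x) (mderiv (\<lambda>x. \<psi> c x ** \<phi> c x) x) + conn Z c x ** (\<psi> c x ** \<phi> c x)
      = (cscale (lam Y * log_den t c x) (mderiv (\<psi> c) x) + conn Z c x ** \<psi> c x) ** \<phi> c x
        + \<psi> c x ** cscale (lam X * log_den t c x) (mderiv (\<phi> c) x)"
      by (simp add: d mat_algebra a(1))
    also have "\<dots> = \<psi> c x ** (cscale (lam X * log_den t c x) (mderiv (\<phi> c) x) + conn Y c x ** \<phi> c x)"
      unfolding b(4) by (simp add: mat_algebra)
    also have "\<dots> = (\<psi> c x ** \<phi> c x) ** conn X c x" unfolding a(4) by (simp add: mat_algebra)
    finally show ?thesis .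
  qed
  have 2: "trans Z z ** (\<psi> Chart0 z ** \<phi> Chart0 z) = (\<psi> ChartInf (1 / z) ** \<phi> ChartInf (1 / z)) ** trans X z"
    if "z \<noteq> 0" for z
    using a(3)[OF that] b(3)[OF that] by (metis matrix_mul_assoc)
  have 3: "(\<lambda>v. (at_point t i \<psi> ** at_point t i \<phi>) *v v) ` par X i \<subseteq> par Z i" for i
    using a(5)[of i] b(5)[of i] by (auto simp flip: matrix_vector_mul_assoc)
  have "lam X = lam Z" using a(1) b(1) by simp
  then show ?thesis unfolding morphism_def
    by (intro conjI allI impI 1 2 3 poly_mat_mult a(2) b(2))
qed

lemma isomorphism_comp:
  assumes "isomorphism t X Y \<phi>" "isomorphism t Y Z \<psi>"
  shows "isomorphism t X Z (\<lambda>c x. \<psi> c x ** \<phi> c x)"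
proof -
  have m: "morphism t X Z (\<lambda>c x. \<psi> c x ** \<phi> c x)"
    using assms morphism_comp isomorphism_imp_morphism by blast
  have 1: "par Z i = (\<lambda>v. (at_point t i \<psi> ** at_point t i \<phi>) *v v) ` par X i" for i
    unfolding isomorphism_par[OF assms(2)] isomorphism_par[OF assms(1)]
    by (simp add: image_image matrix_vector_mul_assoc)
  have 2: "det (\<psi> c x ** \<phi> c x) \<noteq> 0" for c x
    using isomorphism_det[OF assms(1)] isomorphism_det[OF assms(2)] by (simp add: det_mul)
  show ?thesis by (intro isomorphismI morphismD[OF m] 1 2)
qed

lemma isomorphism_refl: "isomorphism t X X (\<lambda>c x. mat 1)"
  unfolding isomorphism_def by (auto simp: cscale_def vec_eq_iff intro: poly_fun_const)

lemma isomorphism_sym: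
  assumes "isomorphism t X Y \<phi>"
  shows "isomorphism t Y X (\<lambda>c x. inv2 (\<phi> c x))"
proof -
  note det = isomorphism_det[OF assms] and p = isomorphism_poly[OF assms]
  have q: "poly_mat (\<lambda>x. inv2 (\<phi> c x))" for c using poly_mat_inv2 p det by blast
  note l = isomorphism_lam[OF assms]
  have "inv2 (\<phi> c x) ** \<phi> c x = mat 1" "\<phi> c x ** inv2 (\<phi> c x) = mat 1" for c x
    using det by (auto simp: inv2_left inv2_right)
  note i = this
  have 1: "trans X z ** inv2 (\<phi> Chart0 z) = inv2 (\<phi> ChartInf (1 / z)) ** trans Y z" if "z \<noteq> 0" for z
  proof -
    have "trans Y z ** \<phi> Chart0 z = \<phi> ChartInf (1 / z) ** trans X z"
      using isomorphism_trans[OF assms that] .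
    then have "\<phi> ChartInf (1 / z) ** (trans X z ** inv2 (\<phi> Chart0 z)) =
      \<phi> ChartInf (1 / z) ** (inv2 (\<phi> ChartInf (1 / z)) ** trans Y z)"
      using i by (metis matrix_mul_assoc matrix_mul_lid matrix_mul_rid)
    then show ?thesis using mat2_cancel_left det by blast
  qed
  have 2: "cscale (lam X * log_den t c x) (mderiv (\<lambda>x. inv2 (\<phi> c x)) x) + conn X c x ** inv2 (\<phi> c x) =
    inv2 (\<phi> c x) ** conn Y c x" for c x
  proof -
    let ?h = "lam X * log_den t c x"
    \<comment> \<open>Differentiating the product of \<open>\<phi>\<close> and its inverse expresses
      the derivative of the inverse through that of \<open>\<phi>\<close>.\<close>
    have "mderiv (\<phi> c) x ** inv2 (\<phi> c x) + \<phi> c x ** mderiv (\<lambda>x. inv2 (\<phi> c x)) x = mderiv (\<lambda>x. \<phi> c x ** inv2 (\<phi> c x)) x"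
      by (intro mderiv_mult[symmetric] poly_mat_diff_mat p q)
    then have d: "mderiv (\<phi> c) x ** inv2 (\<phi> c x) + \<phi> c x ** mderiv (\<lambda>x. inv2 (\<phi> c x)) x = 0"
      using i by simp
    have e: "cscale ?h (mderiv (\<phi> c) x) + conn Y c x ** \<phi> c x = \<phi> c x ** conn X c x"
      using assms by (rule isomorphism_conn)
    have "\<phi> c x ** (cscale ?h (mderiv (\<lambda>x. inv2 (\<phi> c x)) x) + conn X c x ** inv2 (\<phi> c x))
      = cscale ?h (\<phi> c x ** mderiv (\<lambda>x. inv2 (\<phi> c x)) x) + (\<phi> c x ** conn X c x) ** inv2 (\<phi> c x)"
      by (simp add: mat_algebra)
    also have "\<dots> = cscale ?h (mderiv (\<phi> c) x ** inv2 (\<phi> c x) + \<phi> c x ** mderiv (\<lambda>x. inv2 (\<phi> c x)) x)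
       + conn Y c x ** (\<phi> c x ** inv2 (\<phi> c x))"
      unfolding e[symmetric] by (simp add: mat_algebra)
    also have "\<dots> = \<phi> c x ** (inv2 (\<phi> c x) ** conn Y c x)"
      unfolding d matrix_mul_assoc i by (simp add: cscale_def vec_eq_iff)
    finally show ?thesis using mat2_cancel_left det by blast
  qed
  have 3: "(\<lambda>v. inv2 (at_point t j \<phi>) *v v) ` par Y j = par X j" for j
  proof -
    show ?thesis unfolding isomorphism_par[OF assms] by (simp add: image_image matrix_vector_mul_assoc i)
  qed
  have 4: "det (inv2 (\<phi> c x)) \<noteq> 0" for c x using det by (simp add: det_inv2)
  show ?thesis
    by (intro isomorphismI 1 4 q l[symmetric] 3[symmetric]) (simp_all add: 2 l)
qed

lemma isomorphic_refl: "isomorphic t X X"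
  and isomorphic_sym: "isomorphic t X Y \<Longrightarrow> isomorphic t Y X"
  and isomorphic_trans: "isomorphic t X Y \<Longrightarrow> isomorphic t Y Z \<Longrightarrow> isomorphic t X Z"
  unfolding isomorphic_def using isomorphism_refl isomorphism_sym isomorphism_comp by blast+

text \<open>The clauses of \<open>isomorphism\<close> solved for the target, so that any invertible
  change of frame is an isomorphism onto the object it defines.\<close>

definition gauge :: "(4 \<Rightarrow> p1) \<Rightarrow> (chart \<Rightarrow> complex \<Rightarrow> complex^2^2) \<Rightarrow> lconn \<Rightarrow> lconn" where
  "gauge t \<phi> X = \<lparr>lam = lam X,
     trans = (\<lambda>z. \<phi> ChartInf (1 / z) ** trans X z ** inv2 (\<phi> Chart0 z)),
     conn = (\<lambda>c x. (\<phi> c x ** conn X c x - cscale (lam X * log_den t c x) (mderiv (\<phi> c) x)) ** inv2 (\<phi> c x)),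
     par = (\<lambda>i. (\<lambda>v. at_point t i \<phi> *v v) ` par X i)\<rparr>"

lemma isomorphism_gauge:
  assumes "\<And>c. poly_mat (\<phi> c)" "\<And>c x. det (\<phi> c x) \<noteq> 0"
  shows "isomorphism t X (gauge t \<phi> X) \<phi>"
proof -
  have i: "inv2 (\<phi> c x) ** \<phi> c x = mat 1" for c x using assms by (simp add: inv2_left)
  have *: "A ** inv2 (\<phi> c x) ** \<phi> c x = A" for A :: "complex^2^2" and c x
    by (simp add: i flip: matrix_mul_assoc)
  then have "(\<phi> c x ** conn X c x - B) ** inv2 (\<phi> c x) ** \<phi> c x = \<phi> c x ** conn X c x - B" for B c x
    by blast
  with * show ?thesis using assms by (intro isomorphismI) (simp_all add: gauge_def)
qed

section \<open>Transport of subbundles, stability, residues and objects along isomorphisms\<close>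

lemma line_subbundle_isomorphism:
  assumes "isomorphism t X Y \<phi>" "line_subbundle X f n"
  shows "line_subbundle Y (\<lambda>c x. \<phi> c x *v f c x) n"
proof -
  obtain k where k: "k \<noteq> 0" "\<And>z. z \<noteq> 0 \<Longrightarrow> trans X z *v f Chart0 z = (k * z powi (- n)) *s f ChartInf (1 / z)"
    using assms(2) by (auto simp: line_subbundle_def)
  have "trans Y z *v (\<phi> Chart0 z *v f Chart0 z) = (k * z powi (- n)) *s (\<phi> ChartInf (1 / z) *v f ChartInf (1 / z))"
    if "z \<noteq> 0" for z
  proof -
    have "trans Y z *v (\<phi> Chart0 z *v f Chart0 z) = \<phi> ChartInf (1 / z) *v (trans X z *v f Chart0 z)"
      using isomorphism_trans[OF assms(1) that] by (simp add: matrix_vector_mul_assoc)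
    then show ?thesis using k(2)[OF that] by (simp add: mat2_vscale)
  qed
  moreover have "poly_fun (\<lambda>x. (\<phi> c x *v f c x) $ j)" for c j
    using assms(2) poly_mat_nth[OF isomorphism_poly[OF assms(1)]] unfolding matrix_vec_nth line_subbundle_def
    by (intro poly_fun_intros) auto
  moreover have "\<phi> c x *v f c x \<noteq> 0" for c x
    using assms(2) mat2_vec_eq_0[OF isomorphism_det[OF assms(1)]] unfolding line_subbundle_def by blast
  ultimately show ?thesis using k(1) unfolding line_subbundle_def by blast
qed

lemma nabla_isomorphism:
  assumes "isomorphism t X Y \<phi>" "\<And>j. poly_fun (\<lambda>x. f x $ j)"
  shows "nabla t Y c (\<lambda>x. \<phi> c x *v f x) x = \<phi> c x *v nabla t X c f x"
proof -
  let ?h = "lam X * log_den t c x"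
  have d: "vderiv (\<lambda>x. \<phi> c x *v f x) x = mderiv (\<phi> c) x *v f x + \<phi> c x *v vderiv f x"
    by (intro vderiv_mult poly_mat_diff_mat poly_fun_differentiable assms(2) isomorphism_poly[OF assms(1)])
  have l: "lam Y = lam X" and e: "cscale ?h (mderiv (\<phi> c) x) + conn Y c x ** \<phi> c x = \<phi> c x ** conn X c x"
    by (rule isomorphism_lam[OF assms(1)], rule isomorphism_conn[OF assms(1)])
  have "nabla t Y c (\<lambda>x. \<phi> c x *v f x) x
    = (cscale ?h (mderiv (\<phi> c) x) + conn Y c x ** \<phi> c x) *v f x + ?h *s (\<phi> c x *v vderiv f x)"
    unfolding nabla_def l d
    by (simp add: matrix_vector_mult_add_rdistrib cscale_vec vec.scale_right_distrib matrix_vector_mul_assoc)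
  also have "\<dots> = \<phi> c x *v nabla t X c f x"
    unfolding e nabla_def by (simp add: matrix_vector_right_distrib mat2_vscale matrix_vector_mul_assoc)
  finally show ?thesis .
qed

lemma span_isomorphism:
  assumes "det (A :: complex^2^2) \<noteq> 0"
  shows "A *v v \<in> vec.span {A *v w} \<longleftrightarrow> v \<in> vec.span {w}"
proof
  assume "A *v v \<in> vec.span {A *v w}"
  then obtain k where "A *v v = k *s (A *v w)" by (auto simp: vec.span_singleton)
  then have "A *v (v - k *s w) = 0" by (simp add: matrix_vector_mult_diff_distrib mat2_vscale)
  then have "v = k *s w" using assms mat2_vec_eq_0 by fastforce
  then show "v \<in> vec.span {w}" by (auto simp: vec.span_singleton)
qed (auto simp: vec.span_singleton mat2_vscale)

lemma nabla_span_isomorphism: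
  assumes "isomorphism t X Y \<phi>" "line_subbundle X f n"
  shows "nabla t Y c (\<lambda>x. \<phi> c x *v f c x) x \<in> vec.span {\<phi> c x *v f c x} \<longleftrightarrow> nabla t X c (f c) x \<in> vec.span {f c x}"
proof -
  have "\<And>j. poly_fun (\<lambda>x. f c x $ j)" using assms(2) by (simp add: line_subbundle_def)
  then show ?thesis
    using nabla_isomorphism[OF assms(1)] span_isomorphism[OF isomorphism_det[OF assms(1)]] by simp
qed

lemma invariant_isomorphism:
  assumes "isomorphism t X Y \<phi>" "line_subbundle X f n"
  shows "invariant t Y (\<lambda>c x. \<phi> c x *v f c x) \<longleftrightarrow> invariant t X f"
  unfolding invariant_def nabla_span_isomorphism[OF assms] by (rule refl)

lemma apparent_zero_isomorphism:
  assumes "isomorphism t X Y \<phi>" "line_subbundle X f n"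
  shows "apparent_zero t Y (\<lambda>c x. \<phi> c x *v f c x) p \<longleftrightarrow> apparent_zero t X f p"
  unfolding apparent_zero_def nabla_span_isomorphism[OF assms] by (rule refl)

lemma fibre_isomorphism:
  assumes "isomorphism t X Y \<phi>"
  shows "fibre_at t (\<lambda>c x. \<phi> c x *v f c x) i = par Y i \<longleftrightarrow> fibre_at t f i = par X i"
proof -
  let ?A = "at_point t i \<phi>"
  have "inj (\<lambda>v. ?A *v v)"
    using isomorphism_det[OF assms] by (simp add: inj_matrix_vector_mult invertible_det_nz)
  moreover have "par Y i = (\<lambda>v. ?A *v v) ` par X i"
    by (rule isomorphism_par[OF assms])
  moreover have "fibre_at t (\<lambda>c x. \<phi> c x *v f c x) i = (\<lambda>v. ?A *v v) ` fibre_at t f i"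
    by (simp add: fibre_at_def case_prod_beta span_image)
  ultimately show ?thesis by (simp add: inj_image_eq_iff)
qed

lemma pardeg_sub_isomorphism:
  assumes "isomorphism t X Y \<phi>"
  shows "pardeg_sub t \<alpha> Y (\<lambda>c x. \<phi> c x *v f c x) n = pardeg_sub t \<alpha> X f n"
  unfolding pardeg_sub_def fibre_isomorphism[OF assms] by (rule refl)

lemma semistable_isomorphism:
  assumes "isomorphism t X Y \<phi>" "semistable t d \<alpha> Y"
  shows "semistable t d \<alpha> X"
  unfolding semistable_def
proof (intro allI impI, elim conjE)
  fix f n assume f: "line_subbundle X f n" "invariant t X f"
  then have "pardeg_sub t \<alpha> Y (\<lambda>c x. \<phi> c x *v f c x) n \<le> pardeg \<alpha> d / 2"
    using assms(2) line_subbundle_isomorphism[OF assms(1)] invariant_isomorphism[OF assms(1)]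
    unfolding semistable_def by blast
  then show "pardeg_sub t \<alpha> X f n \<le> pardeg \<alpha> d / 2" using pardeg_sub_isomorphism[OF assms(1)] by simp
qed

text \<open>An isomorphism carries each witness \<open>f\<close> over with the same zero and the
  same incidence with the parabolic line, so the two definite descriptions have equal predicates and
  agree.\<close>

lemma Upsilon_isomorphic:
  assumes "isomorphic t X Y"
  shows "Upsilon t X = Upsilon t Y"
proof -
  have *: "\<exists>g p \<sigma>. line_subbundle B g 1 \<and> apparent_zero t B g p \<and> q = dpt t \<sigma> p \<and>
      (\<forall>i. t i = p \<longrightarrow> (\<sigma> = Minus \<longleftrightarrow> fibre_at t g i = par B i))"
    if iso: "isomorphic t A B" and
      ex: "\<exists>f p \<sigma>. line_subbundle A f 1 \<and> apparent_zero t A f p \<and> q = dpt t \<sigma> p \<and>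
      (\<forall>i. t i = p \<longrightarrow> (\<sigma> = Minus \<longleftrightarrow> fibre_at t f i = par A i))" for A B q
  proof -
    obtain \<phi> where \<phi>: "isomorphism t A B \<phi>" using iso by (auto simp: isomorphic_def)
    obtain f p \<sigma> where f: "line_subbundle A f 1" "apparent_zero t A f p" "q = dpt t \<sigma> p"
      "\<forall>i. t i = p \<longrightarrow> (\<sigma> = Minus \<longleftrightarrow> fibre_at t f i = par A i)" using ex by blast
    show ?thesis
      using f line_subbundle_isomorphism[OF \<phi> f(1)] apparent_zero_isomorphism[OF \<phi> f(1)]
        fibre_isomorphism[OF \<phi>]
      by (intro exI[of _ "\<lambda>c x. \<phi> c x *v f c x"] exI[of _ p] exI[of _ \<sigma>]) simp
  qed
  show ?thesis unfolding Upsilon_def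
    by (rule arg_cong[where f = The], rule ext, rule iffI)
      (erule *[OF assms], erule *[OF isomorphic_sym[OF assms]])
qed

lemma rank2_bundle_isomorphism:
  assumes "isomorphism t X Y \<phi>" "rank2_bundle d X"
  shows "rank2_bundle d Y"
proof -
  note det = isomorphism_det[OF assms(1)] and p = isomorphism_poly[OF assms(1)]
  have T: "trans Y z = \<phi> ChartInf (1 / z) ** trans X z ** inv2 (\<phi> Chart0 z)" if "z \<noteq> 0" for z
  proof (rule mat2_cancel_right[OF det[of Chart0 z]])
    show "trans Y z ** \<phi> Chart0 z = \<phi> ChartInf (1 / z) ** trans X z ** inv2 (\<phi> Chart0 z) ** \<phi> Chart0 z"
      using isomorphism_trans[OF assms(1) that] det by (simp add: inv2_left flip: matrix_mul_assoc)
  qed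
  have "laurent_fun (\<lambda>z. (\<phi> ChartInf (1 / z) ** trans X z ** inv2 (\<phi> Chart0 z)) $ i $ j)" for i j
    unfolding matrix_mult_nth
    using assms(2) poly_mat_inv2[OF p det] p
    by (intro laurent_fun_add laurent_fun_mult)
      (auto simp: rank2_bundle_def poly_mat_def
        intro: laurent_poly laurent_fun_reciprocal[of "\<lambda>w. \<phi> ChartInf w $ _ $ _"])
  then have "laurent_fun (\<lambda>z. trans Y z $ i $ j)" for i j
    by (rule laurent_fun_cong) (simp add: T)
  moreover obtain k where k: "k \<noteq> 0" "\<And>z. z \<noteq> 0 \<Longrightarrow> det (trans X z) = k * z powi (- d)"
    using assms(2) by (auto simp: rank2_bundle_def)
  moreover obtain k0 where k0: "k0 \<noteq> 0" "\<And>z. det (\<phi> Chart0 z) = k0"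
    using poly_mat_det_const p det by metis
  moreover obtain k1 where k1: "k1 \<noteq> 0" "\<And>z. det (\<phi> ChartInf z) = k1"
    using poly_mat_det_const p det by metis
  ultimately have "det (trans Y z) = (k1 * k / k0) * z powi (- d)" if "z \<noteq> 0" for z
    using that by (simp add: T det_mul det_inv2)
  moreover have "k1 * k / k0 \<noteq> 0" using k k0 k1 by simp
  ultimately show ?thesis unfolding rank2_bundle_def
    using \<open>\<And>j i. laurent_fun (\<lambda>z. trans Y z $ i $ j)\<close> by blast
qed

lemma connection_isomorphism:
  assumes "isomorphism t X Y \<phi>" "rank2_bundle d X" "connection t X"
  shows "connection t Y"
proof -
  note det = isomorphism_det[OF assms(1)] and p = isomorphism_poly[OF assms(1)]
  note l = isomorphism_lam[OF assms(1)] and e = isomorphism_conn[OF assms(1)]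
  have e': "conn Y c x ** \<phi> c x = \<phi> c x ** conn X c x - cscale (lam X * log_den t c x) (mderiv (\<phi> c) x)" for c x
    using e[of c x] by (simp add: algebra_simps)
  have "conn Y c x = (\<phi> c x ** conn X c x - cscale (lam X * log_den t c x) (mderiv (\<phi> c) x)) ** inv2 (\<phi> c x)" for c x
    using e'[of c x] inv2_right[OF det] by (metis matrix_mul_assoc matrix_mul_rid)
  then have C: "conn Y c = (\<lambda>x. (\<phi> c x ** conn X c x - cscale (lam X * log_den t c x) (mderiv (\<phi> c) x)) ** inv2 (\<phi> c x))" for c
    by (rule ext)
  have "poly_mat (conn X c)" for c using assms(3) by (simp add: connection_def poly_mat_def)
  then have "poly_mat (conn Y c)" for c unfolding C
    by (intro poly_mat_mult poly_mat_diff poly_mat_cscale poly_mat_mderiv poly_mat_inv2 poly_fun_intros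
        poly_fun_log_den p det)
  moreover have "trans Y z ** cscale (1 / log_den t Chart0 z) (conn Y Chart0 z) =
        cscale (lam Y) (mderiv (trans Y) z) +
        cscale (- 1 / (z\<^sup>2 * log_den t ChartInf (1 / z))) (conn Y ChartInf (1 / z)) ** trans Y z"
    if z: "z \<noteq> 0" "Fin z \<notin> range t" for z
  proof (rule mat2_cancel_right[OF det[of Chart0 z]])
    note T = isomorphism_trans[OF assms(1)]
    have h0: "log_den t Chart0 z \<noteq> 0" using z by (simp add: log_den_eq_0_iff)
    have h1: "log_den t ChartInf (1 / z) \<noteq> 0" using z by (simp add: log_den_eq_0_iff)
    have dX: "diff_mat (trans X) z" and dY: "diff_mat (trans Y) z"
      using rank2_bundle_isomorphism[OF assms(1,2)] assms(2) z(1) laurent_fun_differentiable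
      unfolding rank2_bundle_def diff_mat_def by blast+
    \<comment> \<open>The gluing relation of \<open>\<phi>\<close> is differentiated on both sides;
      the chain rule for 1/z produces the factor -1/z^2 of dw.\<close>
    have "mderiv (trans Y) z ** \<phi> Chart0 z + trans Y z ** mderiv (\<phi> Chart0) z
      = mderiv (\<lambda>z. \<phi> ChartInf (1 / z) ** trans X z) z"
      using mderiv_mult[OF dY poly_mat_diff_mat[OF p, of Chart0 z]]
        mderiv_cong_punctured[of z "\<lambda>z. trans Y z ** \<phi> Chart0 z" "\<lambda>z. \<phi> ChartInf (1 / z) ** trans X z", OF z(1) T]
      by simp
    also have "\<dots> = cscale (- 1 / z\<^sup>2) (mderiv (\<phi> ChartInf) (1 / z)) ** trans X z
        + \<phi> ChartInf (1 / z) ** mderiv (trans X) z"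
      using mderiv_mult[OF mderiv_reciprocal(2)[OF p z(1)] dX] mderiv_reciprocal(1)[OF p z(1)] by simp
    finally have D: "mderiv (trans Y) z ** \<phi> Chart0 z =
       cscale (- 1 / z\<^sup>2) (mderiv (\<phi> ChartInf) (1 / z)) ** trans X z
        + \<phi> ChartInf (1 / z) ** mderiv (trans X) z - trans Y z ** mderiv (\<phi> Chart0) z"
      by (simp add: algebra_simps)
    let ?h0 = "log_den t Chart0 z" and ?h1 = "log_den t ChartInf (1 / z)"
    have G: "trans X z ** cscale (1 / ?h0) (conn X Chart0 z) =
        cscale (lam X) (mderiv (trans X) z) +
        cscale (- 1 / (z\<^sup>2 * ?h1)) (conn X ChartInf (1 / z)) ** trans X z"
      using assms(3) z by (simp add: connection_def)
    have "trans Y z ** cscale (1 / ?h0) (conn Y Chart0 z) ** \<phi> Chart0 z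
      = cscale (1 / ?h0) (trans Y z ** (conn Y Chart0 z ** \<phi> Chart0 z))"
      by (simp add: mat_algebra)
    also have "\<dots> = (trans Y z ** \<phi> Chart0 z) ** cscale (1 / ?h0) (conn X Chart0 z) - cscale (lam X) (trans Y z ** mderiv (\<phi> Chart0) z)"
      unfolding e' using h0 by (simp add: mat_algebra)
    also have "\<dots> = \<phi> ChartInf (1 / z) ** (trans X z ** cscale (1 / ?h0) (conn X Chart0 z)) - cscale (lam X) (trans Y z ** mderiv (\<phi> Chart0) z)"
      unfolding T[OF z(1)] matrix_mul_assoc ..
    also have "\<dots> = cscale (lam X) (\<phi> ChartInf (1 / z) ** mderiv (trans X) z) +
        cscale (- 1 / (z\<^sup>2 * ?h1)) ((\<phi> ChartInf (1 / z) ** conn X ChartInf (1 / z)) ** trans X z)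
        - cscale (lam X) (trans Y z ** mderiv (\<phi> Chart0) z)"
      unfolding G by (simp add: mat_algebra)
    also have "\<dots> = cscale (lam X) (mderiv (trans Y) z ** \<phi> Chart0 z) +
        cscale (- 1 / (z\<^sup>2 * ?h1)) (conn Y ChartInf (1 / z) ** \<phi> ChartInf (1 / z) ** trans X z)"
      unfolding e[symmetric] D using h1 z(1) by (simp add: mat_algebra)
    also have "\<dots> = (cscale (lam Y) (mderiv (trans Y) z) +
        cscale (- 1 / (z\<^sup>2 * ?h1)) (conn Y ChartInf (1 / z)) ** trans Y z) ** \<phi> Chart0 z"
      using T[OF z(1)] by (simp add: mat_algebra l flip: matrix_mul_assoc)
    finally show "trans Y z ** cscale (1 / ?h0) (conn Y Chart0 z) ** \<phi> Chart0 z = \<dots>" .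
  qed
  ultimately show ?thesis unfolding connection_def poly_mat_def by blast
qed

text \<open>At \<open>t i\<close> the factor \<open>log_den\<close> vanishes and with it the
  derivative term, so residues are conjugate for every value of \<open>lam\<close>.\<close>

lemma residue_isomorphism:
  assumes "isomorphism t X Y \<phi>"
  shows "residue_at t Y i ** at_point t i \<phi> = at_point t i \<phi> ** residue_at t X i"
proof -
  obtain k where k: "\<And>X. residue_at t X i = cscale k (at_point t i (conn X))"
    using residue_at_eq by metis
  have "log_den t (fst (loc t i)) (snd (loc t i)) = 0" using log_den_loc by (metis prod.collapse)
  then have "at_point t i (conn Y) ** at_point t i \<phi>
     = at_point t i \<phi> ** at_point t i (conn X)"
    using isomorphism_conn[OF assms] by (metis add_0 cscale_0 mult_zero_right)
  then show ?thesis by (simp add: k mat_algebra)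
qed

lemma quasiparabolic_isomorphism:
  assumes "isomorphism t X Y \<phi>" "quasiparabolic X"
  shows "quasiparabolic Y"
  unfolding quasiparabolic_def
proof
  fix i
  obtain v where v: "v \<noteq> 0" "par X i = vec.span {v}" using quasiparabolic_line assms(2) by blast
  have "par Y i = vec.span {at_point t i \<phi> *v v}"
    using isomorphism_par[OF assms(1)] v(2) by (simp flip: span_image)
  moreover have "at_point t i \<phi> *v v \<noteq> 0"
    using v(1) isomorphism_det[OF assms(1)] mat2_vec_eq_0 by blast
  ultimately show "vec.subspace (par Y i) \<and> vec.dim (par Y i) = 1" using line_span by simp
qed

lemma objects_isomorphism:
  assumes "isomorphism t X Y \<phi>" "X \<in> objects t d \<alpha> l \<rho>"
  shows "Y \<in> objects t d \<alpha> l \<rho>"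
proof -
  have X: "rank2_bundle d X" "connection t X" "parabolic t X" "lam X = l" "has_residues t \<rho> X" "semistable t d \<alpha> X"
    using assms(2) by (auto simp: objects_def qp_connection_def)
  note Y = rank2_bundle_isomorphism[OF assms(1) X(1)] connection_isomorphism[OF assms(1) X(1,2)]
    semistable_isomorphism[OF isomorphism_sym[OF assms(1)] X(6)]
  let ?A = "\<lambda>i. at_point t i \<phi>"
  note P = isomorphism_par[OF assms(1)]
  have R: "residue_at t Y i *v (?A i *v v) = ?A i *v (residue_at t X i *v v)" for i v
    using residue_isomorphism[OF assms(1)] by (simp add: matrix_vector_mul_assoc)
  have "residue_at t Y i *v v \<in> par Y i" if "v \<in> par Y i" for i v
    using that X(3) R unfolding P parabolic_def by auto
  then have par: "parabolic t Y"
    using quasiparabolic_isomorphism[OF assms(1) parabolic_quasiparabolic[OF X(3)]]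
    unfolding parabolic_def quasiparabolic_def by blast
  have 1: "residue_at t Y i *v v = \<rho> i Minus *s v" if "v \<in> par Y i" for i v
    using that X(5) R unfolding P has_residues_def by (auto simp: mat2_vscale)
  have 2: "residue_at t Y i *v v - \<rho> i Plus *s v \<in> par Y i" for i v
  proof -
    have det: "det (?A i) \<noteq> 0" using isomorphism_det[OF assms(1)] .
    define u where "u = inv2 (?A i) *v v"
    have v: "v = ?A i *v u" unfolding u_def by (simp add: matrix_vector_mul_assoc inv2_right det)
    have "residue_at t Y i *v v - \<rho> i Plus *s v = ?A i *v (residue_at t X i *v u - \<rho> i Plus *s u)"
      unfolding v R by (simp add: matrix_vector_mult_diff_distrib mat2_vscale)
    then show ?thesis unfolding P using X(5) by (auto simp: has_residues_def)
  qed
  have "lam Y = l" using isomorphism_lam[OF assms(1)] X(4) by simp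
  then show ?thesis using Y par 1 2 by (auto simp: objects_def qp_connection_def has_residues_def)
qed

section \<open>Splitting of bundles of degree 1\<close>

text \<open>Polynomials without common zero have a constant gcd; the Bezout coefficients divided by
  it complete the column (f, g) to a matrix of determinant 1, i.e. to a frame.\<close>

lemma unimodular_completion:
  fixes f g :: "complex poly"
  assumes "\<And>x. poly f x = 0 \<Longrightarrow> poly g x \<noteq> 0"
  obtains a b where "\<And>x. poly f x * poly a x - poly b x * poly g x = 1"
proof -
  have "gcd f g \<noteq> 0" using assms[of 0] by auto
  have "degree (gcd f g) = 0"
  proof (rule ccontr)
    assume "degree (gcd f g) \<noteq> 0"
    then obtain x where "poly (gcd f g) x = 0"
      using fundamental_theorem_of_algebra constant_degree by metis
    then have "poly f x = 0" "poly g x = 0"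
      using poly_eq_0_iff_dvd dvd_trans gcd_dvd1 gcd_dvd2 by metis+
    then show False using assms by blast
  qed
  then obtain k where k: "gcd f g = [:k:]" using degree_eq_zeroE by blast
  then have "k \<noteq> 0" using \<open>gcd f g \<noteq> 0\<close> by auto
  obtain u v where uv: "u * f + v * g = [:k:]"
    using bezout_coefficients_fst_snd[of f g] k by metis
  have "poly f x * poly (smult (1/k) u) x - poly (smult (- 1/k) v) x * poly g x = 1" for x
  proof -
    have "poly u x * poly f x + poly v x * poly g x = k"
      using arg_cong[OF uv, of "\<lambda>p. poly p x"] by simp
    then have "(poly u x * poly f x + poly v x * poly g x) / k = 1" using \<open>k \<noteq> 0\<close> by simp
    then show ?thesis by (simp add: add_divide_distrib mult.commute)
  qed
  then show ?thesis using that by blast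
qed

text \<open>A section of O(D) rewritten in the chart at infinity: its value there is the coefficient
  of z ^ D, which is 0 when the degree is smaller.\<close>

lemma reverse_poly:
  fixes p :: "complex poly"
  assumes "degree p \<le> D"
  obtains f where "\<And>z. z \<noteq> 0 \<Longrightarrow> poly f (1 / z) = poly p z / z ^ D" "poly f 0 = coeff p D"
proof
  let ?f = "monom 1 (D - degree p) * reflect_poly p"
  show "poly ?f (1 / z) = poly p z / z ^ D" if "z \<noteq> 0" for z
  proof -
    have "z ^ D = z ^ (D - degree p) * z ^ degree p" using assms by (simp flip: power_add)
    then show ?thesis using that
      by (simp add: poly_monom poly_reflect_poly_nz divide_inverse power_inverse)
  qed
  show "poly ?f 0 = coeff p D"
  proof (cases "degree p = D")
    case True
    then show ?thesis by (simp add: poly_monom)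
  next
    case False
    then show ?thesis using assms by (simp add: poly_monom coeff_eq_0)
  qed
qed

text \<open>A section \<open>v\<close> over \<open>Chart0\<close> whose pole order at infinity is minimal generates a line subbundle of
  maximal degree; minimality bounds this degree from below, and then the extension splits.\<close>

lemma bundle_splitting:
  assumes "rank2_bundle 1 X"
  obtains G0 G1 n where "poly_mat G0" "poly_mat G1" "\<And>x. det (G0 x) \<noteq> 0" "\<And>x. det (G1 x) \<noteq> 0" "n \<ge> (1::nat)"
    "\<And>z. z \<noteq> 0 \<Longrightarrow> trans X z ** G0 z = G1 (1 / z) ** mat2 (1 / z ^ n) 0 0 (z ^ (n - 1))"
proof -
  have "\<forall>ij. \<exists>pn. \<forall>z. z \<noteq> 0 \<longrightarrow> trans X z $ fst ij $ snd ij = poly (fst pn) z / z ^ snd pn"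
    using assms by (simp add: rank2_bundle_def laurent_fun_def)
  from choice[OF this] obtain f
    where f: "\<forall>ij z. z \<noteq> 0 \<longrightarrow> trans X z $ fst ij $ snd ij = poly (fst (f ij)) z / z ^ snd (f ij)"
    by blast
  define p where "p i j = fst (f (i, j))" for i j
  define m where "m i j = snd (f (i, j))" for i j
  have pm: "trans X z $ i $ j = poly (p i j) z / z ^ m i j" if "z \<noteq> 0" for i j z
    using f[rule_format, OF that, of "(i, j)"] by (simp add: p_def m_def)
  define N where "N = m 1 1 + m 1 2 + m 2 1 + m 2 2"
  define P where "P i j = p i j * monom 1 (N - m i j)" for i j
  have mN: "m i j \<le> N" for i j
  proof -
    have "\<forall>i j. m i j \<le> N" unfolding forall_2 N_def by simp
    then show ?thesis by blast
  qed
  have T: "trans X z $ i $ j = poly (P i j) z / z ^ N" if "z \<noteq> 0" for i j z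
  proof -
    have "z ^ N = z ^ (N - m i j) * z ^ m i j" using mN by (simp flip: power_add)
    then show ?thesis using pm[OF that] that by (simp add: P_def poly_monom)
  qed
  obtain k where k: "k \<noteq> 0" "\<And>z. z \<noteq> 0 \<Longrightarrow> det (trans X z) = k / z"
    using assms by (auto simp: rank2_bundle_def power_int_minus divide_inverse)
  \<comment> \<open>\<open>U i v\<close> is z ^ N times a coordinate of the section \<open>v\<close>
    in the frame at infinity, so D v - N is the pole order of \<open>v\<close> there, and a
    minimiser generates a subbundle of degree N - D v.\<close>
  define U where "U i v = P i 1 * fst v + P i 2 * snd v" for i and v :: "complex poly \<times> complex poly"
  define D where "D v = max (degree (U 1 v)) (degree (U 2 v))" for v
  have TU: "(trans X z *v vec2 (poly (fst v) z) (poly (snd v) z)) $ i = poly (U i v) z / z ^ N"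
    if "z \<noteq> 0" for z v i
    using T[OF that] by (simp add: matrix_vec_nth U_def add_divide_distrib)
  have U0: "U 1 v \<noteq> 0 \<or> U 2 v \<noteq> 0" if "v \<noteq> (0, 0)" for v
  proof (rule ccontr)
    assume "\<not> (U 1 v \<noteq> 0 \<or> U 2 v \<noteq> 0)"
    then have U: "U 1 v = 0" "U 2 v = 0" by auto
    have "vec2 (poly (fst v) z) (poly (snd v) z) = 0" if "z \<noteq> 0" for z
    proof (rule mat2_vec_eq_0)
      show "det (trans X z) \<noteq> 0" using k(1) k(2)[OF that] that by simp
      show "trans X z *v vec2 (poly (fst v) z) (poly (snd v) z) = 0"
        by (rule vec2_eqI) (simp_all add: TU[OF that] U)
    qed
    then have "poly (fst v) z = 0" "poly (snd v) z = 0" if "z \<noteq> 0" for z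
      using that by (simp_all add: vec_eq_iff forall_2)
    note vz = this
    have "fst v = 0" "snd v = 0" by (rule poly_eqI_cofinite[of "{0}"]; simp add: vz)+
    then show False using \<open>v \<noteq> (0, 0)\<close> by (simp add: prod_eq_iff)
  qed
  obtain v where v0: "v \<noteq> (0, 0)" and vmin: "\<And>w. w \<noteq> (0, 0) \<Longrightarrow> D v \<le> D w"
    using ex_has_least_nat[of "\<lambda>v. v \<noteq> (0, 0)" "(1, 0)" D] by auto
  define d where "d = D v"
  have lt: "D w < d" if "U 1 w \<noteq> 0 \<or> U 2 w \<noteq> 0" "\<And>i. U i w = 0 \<or> degree (U i w) < d" for w
    using that(1) that(2)[of 1] that(2)[of 2] unfolding D_def by auto
  \<comment> \<open>A common zero could be divided out, which would lower the pole order; by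
    minimality \<open>v\<close> vanishes nowhere on \<open>Chart0\<close>.\<close>
  have nocommon: "poly (snd v) a \<noteq> 0" if fa: "poly (fst v) a = 0" for a
  proof
    assume "poly (snd v) a = 0"
    then obtain w1 w2 where w: "fst v = [:- a, 1:] * w1" "snd v = [:- a, 1:] * w2"
      using fa unfolding poly_eq_0_iff_dvd dvd_def by blast
    define w where "w = (w1, w2)"
    have "w \<noteq> (0, 0)" using v0 w by (auto simp: w_def prod_eq_iff)
    have UU: "U i v = [:- a, 1:] * U i w" for i unfolding U_def w w_def by (simp add: algebra_simps)
    have "U i w = 0 \<or> degree (U i w) < d" for i
    proof (cases "U i w = 0")
      case False
      then have "degree (U i v) = Suc (degree (U i w))" unfolding UU by (subst degree_mult_eq) auto
      moreover have "\<forall>i. degree (U i v) \<le> d" unfolding forall_2 d_def D_def by auto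
      ultimately show ?thesis by (metis Suc_le_lessD)
    qed auto
    then have "D w < d" using lt U0[OF \<open>w \<noteq> (0, 0)\<close>] by blast
    then show False using vmin[OF \<open>w \<noteq> (0, 0)\<close>] by (simp add: d_def)
  qed
  obtain a0 b0 where ab0: "\<And>x. poly (fst v) x * poly a0 x - poly b0 x * poly (snd v) x = 1"
    using unimodular_completion[of "fst v" "snd v"] nocommon by blast
  obtain f1 where f1: "\<And>z. z \<noteq> 0 \<Longrightarrow> poly f1 (1 / z) = poly (U 1 v) z / z ^ d" "poly f1 0 = coeff (U 1 v) d"
    using reverse_poly[of "U 1 v" d] unfolding d_def D_def by auto
  obtain f2 where f2: "\<And>z. z \<noteq> 0 \<Longrightarrow> poly f2 (1 / z) = poly (U 2 v) z / z ^ d" "poly f2 0 = coeff (U 2 v) d"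
    using reverse_poly[of "U 2 v" d] unfolding d_def D_def by auto
  \<comment> \<open>The generator at infinity is nowhere zero either: at w = 0 because
    \<open>d\<close> is attained as a degree, elsewhere because the transition matrix is
    invertible.\<close>
  have "poly f2 w \<noteq> 0" if f0: "poly f1 w = 0" for w
  proof (cases "w = 0")
    case True
    show ?thesis
    proof
      assume "poly f2 w = 0"
      then have c: "coeff (U 1 v) d = 0" "coeff (U 2 v) d = 0" using f0 f1 f2 True by auto
      have "d = degree (U 1 v) \<or> d = degree (U 2 v)" unfolding d_def D_def by auto
      then have "d = 0 \<and> (U 1 v = 0 \<or> U 2 v = 0)" using c by auto
      then have "degree (U 1 v) = 0" "degree (U 2 v) = 0" "d = 0" unfolding d_def D_def by auto
      then have "U 1 v = 0" "U 2 v = 0"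
        using c by (auto intro: leading_coeff_0_iff[THEN iffD1])
      then show False using U0[OF v0] by simp
    qed
  next
    case False
    show ?thesis
    proof
      assume f20: "poly f2 w = 0"
      have z: "1 / w \<noteq> 0" using False by simp
      have U: "poly (U 1 v) (1 / w) = 0" "poly (U 2 v) (1 / w) = 0"
        using f1(1)[OF z] f2(1)[OF z] f0 f20 False by auto
      have "vec2 (poly (fst v) (1/w)) (poly (snd v) (1/w)) = 0"
      proof (rule mat2_vec_eq_0)
        show "det (trans X (1/w)) \<noteq> 0" using k(1) k(2)[OF z] False by simp
        show "trans X (1/w) *v vec2 (poly (fst v) (1/w)) (poly (snd v) (1/w)) = 0"
          by (rule vec2_eqI) (simp_all add: TU[OF z] U)
      qed
      then show False using nocommon by (auto simp: vec_eq_iff forall_2)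
    qed
  qed
  then obtain a1 b1 where ab1: "\<And>x. poly f1 x * poly a1 x - poly b1 x * poly f2 x = 1"
    using unimodular_completion[of f1 f2] by blast
  define G0 where "G0 x = mat2 (poly (fst v) x) (poly b0 x) (poly (snd v) x) (poly a0 x)" for x
  define G1 where "G1 x = mat2 (poly f1 x) (poly b1 x) (poly f2 x) (poly a1 x)" for x
  have det0: "det (G0 x) = 1" and det1: "det (G1 x) = 1" for x
    using ab0 ab1 by (simp_all add: G0_def G1_def det_mat2)
  have pG: "poly_mat G0" "poly_mat G1"
    by (auto intro!: poly_matI poly_fun_poly simp: G0_def G1_def)
  define M where "M z = inv2 (G1 (1 / z)) ** trans X z ** G0 z" for z
  have GM: "G1 (1 / z) ** M z = trans X z ** G0 z" for z
  proof -
    have "G1 (1 / z) ** M z = (G1 (1 / z) ** inv2 (G1 (1 / z))) ** trans X z ** G0 z"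
      unfolding M_def by (simp add: matrix_mul_assoc)
    then show ?thesis by (simp add: inv2_right det1)
  qed
  \<comment> \<open>In the completed frames the transition matrix is upper triangular: the diagonal
    gives the subbundle and the quotient, and the upper right entry is the extension class.\<close>
  have M1: "M z $ 1 $ 1 = z ^ d / z ^ N" "M z $ 2 $ 1 = 0" if "z \<noteq> 0" for z
  proof -
    have "G0 z *v vec2 1 0 = vec2 (poly (fst v) z) (poly (snd v) z)"
      by (rule vec2_eqI) (simp_all add: matrix_vec_nth G0_def)
    then have "G1 (1 / z) *v (M z *v vec2 1 0) = trans X z *v vec2 (poly (fst v) z) (poly (snd v) z)"
      unfolding matrix_vector_mul_assoc GM by (simp flip: matrix_vector_mul_assoc)
    also have "\<dots> = G1 (1 / z) *v vec2 (z ^ d / z ^ N) 0"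
      using that by (intro vec2_eqI) (simp_all add: TU, simp_all add: matrix_vec_nth G1_def f1 f2)
    finally have "M z *v vec2 1 0 = vec2 (z ^ d / z ^ N) 0"
      using det1 by (metis inv2_left matrix_vector_mul_assoc matrix_vector_mul_lid zero_neq_one)
    then show "M z $ 1 $ 1 = z ^ d / z ^ N" "M z $ 2 $ 1 = 0"
      by (simp_all add: vec_eq_iff forall_2 matrix_vec_nth)
  qed
  have M2: "M z $ 2 $ 2 = k * z ^ N / (z * z ^ d)" if "z \<noteq> 0" for z
  proof -
    have "det (M z) = k / z"
      unfolding M_def by (simp add: det_mul det_inv2 det0 det1 k that)
    then have "z ^ d / z ^ N * M z $ 2 $ 2 = k / z" using M1[OF that] by (simp add: det_mat2)
    then have "(z ^ d / z ^ N * M z $ 2 $ 2) * (z ^ N / z ^ d) = k / z * (z ^ N / z ^ d)" by simp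
    then show ?thesis using that by simp
  qed
  have "laurent_fun (\<lambda>z. (inv2 (G1 (1 / z)) ** trans X z ** G0 z) $ i $ j)" for i j
    unfolding matrix_mult_nth
    using poly_mat_inv2[OF pG(2)] pG(1) det1 assms
    by (intro laurent_fun_add laurent_fun_mult)
      (auto simp: rank2_bundle_def poly_mat_def
        intro: laurent_poly laurent_fun_reciprocal[of "\<lambda>w. inv2 (G1 w) $ _ $ _"])
  then have "laurent_fun (\<lambda>z. M z $ 1 $ 2)" unfolding M_def .
  moreover have "laurent_fun (\<lambda>z. z ^ N / z ^ d)"
    unfolding laurent_fun_def by (intro exI[of _ "monom 1 N"] exI[of _ d]) (simp add: poly_monom)
  ultimately have "laurent_fun (\<lambda>z. M z $ 1 $ 2 * (z ^ N / z ^ d))" by (rule laurent_fun_mult)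
  then obtain g q where gq: "\<And>z. z \<noteq> 0 \<Longrightarrow> M z $ 1 $ 2 * (z ^ N / z ^ d) = poly g z + poly q (1 / z) / z"
    using laurent_fun_split by blast
  \<comment> \<open>The part \<open>g\<close> of the rescaled extension class that is regular at 0
    is absorbed by replacing the second frame vector on \<open>Chart0\<close>, leaving only negative
    powers of z.\<close>
  define w where "w = (b0 - g * fst v, a0 - g * snd v)"
  define H0 where "H0 x = G0 x ** mat2 1 (- poly g x) 0 1" for x
  have H0: "H0 x = mat2 (poly (fst v) x) (poly (fst w) x) (poly (snd v) x) (poly (snd w) x)" for x
    unfolding H0_def G0_def w_def by (rule mat2_eqI) (simp_all add: matrix_mult_nth mult.commute)
  have detH0: "det (H0 x) = 1" for x
    unfolding H0_def det_mul det0 by (simp add: det_mat2)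
  have w0: "w \<noteq> (0, 0)"
  proof
    assume "w = (0, 0)"
    then have "det (H0 0) = 0" unfolding H0 by (simp add: det_mat2)
    then show False using detH0 by simp
  qed
  have TH: "trans X z ** H0 z = G1 (1 / z) ** mat2 (z ^ d / z ^ N) (z ^ d / z ^ N * poly q (1 / z) / z) 0 (k * z ^ N / (z * z ^ d))"
    if "z \<noteq> 0" for z
  proof -
    have "z ^ d / z ^ N * (M z $ 1 $ 2 * (z ^ N / z ^ d)) = z ^ d / z ^ N * (poly g z + poly q (1 / z) / z)"
      by (simp only: gq[OF that])
    then have m12: "M z $ 1 $ 2 = z ^ d / z ^ N * poly g z + z ^ d / z ^ N * poly q (1 / z) / z"
      using that by (simp add: distrib_left)
    have "trans X z ** H0 z = G1 (1 / z) ** (M z ** mat2 1 (- poly g z) 0 1)"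
      unfolding H0_def by (simp add: matrix_mul_assoc GM)
    also have "M z ** mat2 1 (- poly g z) 0 1 = mat2 (z ^ d / z ^ N) (z ^ d / z ^ N * poly q (1 / z) / z) 0 (k * z ^ N / (z * z ^ d))"
      using M1[OF that] M2[OF that] m12 by (intro mat2_eqI) (simp_all add: matrix_mult_nth)
    finally show ?thesis .
  qed
  \<comment> \<open>The subbundle has degree N - d, and this must be positive. If N <= d, the second
    frame vector \<open>w\<close> would satisfy z * U i w = z ^ d * h(1/z) with \<open>h\<close> a
    polynomial, so its pole order would be smaller than that of \<open>v\<close>.\<close>
  have "d < N"
  proof (rule ccontr)
    assume "\<not> d < N"
    then have Nd: "N \<le> d" by simp
    have "U i w = 0 \<or> degree (U i w) < d" for i
    proof -
      obtain x1 where x1: "\<And>z. G1 z $ i $ 1 = poly x1 z"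
        using poly_mat_nth[OF pG(2)] unfolding poly_fun_def by blast
      obtain x2 where x2: "\<And>z. G1 z $ i $ 2 = poly x2 z"
        using poly_mat_nth[OF pG(2)] unfolding poly_fun_def by blast
      note x = x1 x2
      define h where "h = x1 * q + smult k (x2 * monom 1 (2 * (d - N)))"
      have "poly (U i w) z * z ^ 1 = z ^ d * poly h (1 / z)" if "z \<noteq> 0" for z
      proof -
        have "poly (U i w) z / z ^ N = (trans X z *v vec2 (poly (fst w) z) (poly (snd w) z)) $ i"
          using TU[OF that] by simp
        also have "vec2 (poly (fst w) z) (poly (snd w) z) = H0 z *v vec2 0 1"
          unfolding H0 by (rule vec2_eqI) (simp_all add: matrix_vec_nth)
        also have "trans X z *v (H0 z *v vec2 0 1) = G1 (1 / z) *v vec2 (z ^ d / z ^ N * poly q (1 / z) / z) (k * z ^ N / (z * z ^ d))"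
          unfolding matrix_vector_mul_assoc TH[OF that]
          by (simp flip: matrix_vector_mul_assoc)
            (rule arg_cong[where f = "\<lambda>v. G1 (1 / z) *v v"], rule vec2_eqI; simp add: matrix_vec_nth)
        also have "\<dots> $ i = poly x1 (1 / z) * (z ^ d / z ^ N * poly q (1 / z) / z) + poly x2 (1 / z) * (k * z ^ N / (z * z ^ d))"
          by (simp add: matrix_vec_nth x)
        finally have e: "poly (U i w) z / z ^ N = \<dots>" .
        have "z ^ d = z ^ N * z ^ (d - N)" using Nd by (simp flip: power_add)
        then have e2: "z ^ N * z ^ N * (z ^ (d - N))\<^sup>2 = z ^ d * z ^ d" by (simp add: power2_eq_square)
        have "poly (U i w) z * z = z ^ N * z * (poly (U i w) z / z ^ N)" using that by simp
        also have "\<dots> = z ^ d * (poly x1 (1 / z) * poly q (1 / z)) + poly x2 (1 / z) * k * (z ^ N * z ^ N / z ^ d)"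
          unfolding e using that by (simp add: distrib_left mult.assoc mult.left_commute)
        also have "z ^ N * z ^ N / z ^ d = z ^ d * (1 / z) ^ (2 * (d - N))"
          using e2 that by (simp add: field_simps power_mult)
        finally show ?thesis by (simp add: h_def poly_monom algebra_simps)
      qed
      then have "U i w = 0 \<or> degree (U i w) + 1 \<le> d"
        by (intro poly_reciprocal_degree[of "{}" _ 1 d h]) auto
      then show ?thesis by auto
    qed
    then have "D w < d" using lt U0[OF w0] by blast
    then show False using vmin[OF w0] by (simp add: d_def)
  qed
  define n where "n = N - d"
  \<comment> \<open>The remaining upper right entry z ^ (- n - 1) * q(1/z) equals z ^ (n - 1) times
    (1/z) ^ (2 n) * q(1/z). The last factor is regular at infinity, so a change of frame there
    removes the entry.\<close>
  define H1 where "H1 x = G1 x ** mat2 1 (x ^ (2 * n) * poly q x) 0 k" for x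
  have n: "n \<ge> 1" using \<open>d < N\<close> by (simp add: n_def)
  have "trans X z ** H0 z = H1 (1 / z) ** mat2 (1 / z ^ n) 0 0 (z ^ (n - 1))" if "z \<noteq> 0" for z
  proof -
    have zn: "z ^ N = z ^ d * z ^ n" using \<open>d < N\<close> by (simp add: n_def flip: power_add)
    have zn': "z ^ n = z * z ^ (n - 1)" using n by (simp add: power_eq_if[of z n])
    have z2: "z ^ (n * 2) = z * (z * (z ^ (n - 1) * z ^ (n - 1)))"
      unfolding power_mult power2_eq_square zn' by (simp add: mult.commute mult.left_commute)
    have "mat2 (z ^ d / z ^ N) (z ^ d / z ^ N * poly q (1 / z) / z) 0 (k * z ^ N / (z * z ^ d))
      = mat2 1 ((1 / z) ^ (2 * n) * poly q (1 / z)) 0 k ** mat2 (1 / z ^ n) 0 0 (z ^ (n - 1))"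
      using that by (intro mat2_eqI)
        (simp_all add: matrix_mult_nth zn zn' field_simps z2)
    then show ?thesis unfolding TH[OF that] H1_def by (simp add: matrix_mul_assoc)
  qed
  moreover have "poly_mat H0" "poly_mat H1"
    unfolding H0_def H1_def
    by (intro poly_mat_mult pG poly_matI; simp; intro poly_fun_intros poly_fun_power)+
  moreover have "det (H1 x) \<noteq> 0" for x
    unfolding H1_def det_mul det1 using k by (simp add: det_mat2)
  ultimately show ?thesis using that[of H0 H1 n] n detH0 by simp
qed

text \<open>Gauging by the inverses of the two frames gives E = O(n) + O(1 - n) with n >= 1, so the
  first summand is the candidate for a destabilising line.\<close>

lemma split_form:
  assumes "rank2_bundle 1 X"
  obtains Y \<phi> n where "isomorphism t X Y \<phi>" "n \<ge> (1::nat)"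
    "\<And>z. z \<noteq> 0 \<Longrightarrow> trans Y z = mat2 (1 / z ^ n) 0 0 (z ^ (n - 1))"
proof -
  obtain G0 G1 n where G: "poly_mat G0" "poly_mat G1" "\<And>x. det (G0 x) \<noteq> 0" "\<And>x. det (G1 x) \<noteq> 0" "n \<ge> (1::nat)"
    "\<And>z. z \<noteq> 0 \<Longrightarrow> trans X z ** G0 z = G1 (1 / z) ** mat2 (1 / z ^ n) 0 0 (z ^ (n - 1))"
    using bundle_splitting[OF assms] by blast
  define \<phi> where "\<phi> c x = inv2 (case c of Chart0 \<Rightarrow> G0 x | ChartInf \<Rightarrow> G1 x)" for c x
  have p: "poly_mat (\<phi> c)" for c
    unfolding \<phi>_def using poly_mat_inv2[OF G(1,3)] poly_mat_inv2[OF G(2,4)] by (cases c) auto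
  have det: "det (\<phi> c x) \<noteq> 0" for c x
    unfolding \<phi>_def using G(3,4) by (cases c) (auto simp: det_inv2)
  have i0: "inv2 (inv2 (G0 z)) = G0 z" for z
  proof (rule mat2_cancel_right)
    show "det (inv2 (G0 z)) \<noteq> 0" using G(3) by (simp add: det_inv2)
    then show "inv2 (inv2 (G0 z)) ** inv2 (G0 z) = G0 z ** inv2 (G0 z)"
      using G(3) by (simp add: inv2_left inv2_right)
  qed
  have "trans (gauge t \<phi> X) z = mat2 (1 / z ^ n) 0 0 (z ^ (n - 1))" if "z \<noteq> 0" for z
  proof -
    have "trans (gauge t \<phi> X) z = inv2 (G1 (1 / z)) ** (trans X z ** G0 z)"
      by (simp add: gauge_def \<phi>_def i0 matrix_mul_assoc)
    also have "\<dots> = (inv2 (G1 (1 / z)) ** G1 (1 / z)) ** mat2 (1 / z ^ n) 0 0 (z ^ (n - 1))"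
      unfolding G(6)[OF that] by (simp add: matrix_mul_assoc)
    finally show ?thesis using G(4) by (simp add: inv2_left)
  qed
  note * = this
  show ?thesis by (rule that[OF isomorphism_gauge[OF p det] G(5) *])
qed

text \<open>The inequality of parabolic degrees reads n <= 1/2 + e, where the weights contribute |e|
  < 1/2. The right side lies strictly between 0 and 1, so an integer n satisfies it exactly when n
  <= 0.\<close>

lemma semistable_iff:
  fixes \<alpha> :: "4 \<Rightarrow> psign \<Rightarrow> real"
  assumes "weights \<alpha>" "(\<Sum>i\<in>UNIV. (\<alpha> i Plus - \<alpha> i Minus) / 2) < 1 / 2"
  shows "semistable t 1 \<alpha> X \<longleftrightarrow> (\<forall>f n. line_subbundle X f n \<and> invariant t X f \<longrightarrow> n \<le> 0)"
proof -
  have "pardeg_sub t \<alpha> X f n \<le> pardeg \<alpha> 1 / 2 \<longleftrightarrow> n \<le> 0" for f n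
  proof -
    define s where "s i = (if fibre_at t f i = par X i then Minus else Plus)" for i
    \<comment> \<open>The deviation from the mean weight, equal to epsilon_i or its negative
      according to the sign \<open>s i\<close>.\<close>
    define e where "e i = \<alpha> i (s i) - (\<alpha> i Plus + \<alpha> i Minus) / 2" for i
    have ei: "\<bar>e i\<bar> \<le> (\<alpha> i Plus - \<alpha> i Minus) / 2" for i
      using assms(1) unfolding e_def weights_def
      by (cases "s i") (auto simp: abs_if field_simps)
    have "\<bar>\<Sum>i\<in>UNIV. e i\<bar> \<le> (\<Sum>i\<in>UNIV. \<bar>e i\<bar>)" by (rule sum_abs)
    also have "\<dots> \<le> (\<Sum>i\<in>UNIV. (\<alpha> i Plus - \<alpha> i Minus) / 2)" by (intro sum_mono ei)
    finally have e: "\<bar>\<Sum>i\<in>UNIV. e i\<bar> < 1 / 2" using assms(2) by linarith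
    have "(\<Sum>i\<in>UNIV. e i) = (\<Sum>i\<in>UNIV. \<alpha> i (s i)) - (\<Sum>i\<in>UNIV. \<alpha> i Plus + \<alpha> i Minus) / 2"
      by (simp add: e_def sum_subtractf sum_divide_distrib)
    then have "pardeg_sub t \<alpha> X f n \<le> pardeg \<alpha> 1 / 2 \<longleftrightarrow> of_int n \<le> 1 / 2 + (\<Sum>i\<in>UNIV. e i)"
      unfolding pardeg_sub_def pardeg_def s_def by (auto simp: diff_divide_distrib)
    also have "\<dots> \<longleftrightarrow> n \<le> 0"
    proof
      assume "of_int n \<le> 1 / 2 + (\<Sum>i\<in>UNIV. e i)"
      then have "(of_int n :: real) < 1" using e by linarith
      then show "n \<le> 0" by linarith
    next
      assume "n \<le> 0"
      then have "(of_int n :: real) \<le> 0" by simp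
      then show "of_int n \<le> 1 / 2 + (\<Sum>i\<in>UNIV. e i)" using e by linarith
    qed
    finally show ?thesis .
  qed
  then show ?thesis unfolding semistable_def by simp
qed

section \<open>Logarithmic differentials in the two charts\<close>

text \<open>The constant comparing the two monic denominators: z - a = (- a) * z * (1/z - 1/a) for a
  nonzero, while the points 0 and infinity, each seen in only one chart, contribute 1.\<close>

definition log_ratio :: "(4 \<Rightarrow> p1) \<Rightarrow> complex" where
  "log_ratio t = (\<Prod>i\<in>UNIV. case t i of Infty \<Rightarrow> 1 | Fin a \<Rightarrow> if a = 0 then 1 else - a)"

lemma log_ratio_nonzero: "log_ratio t \<noteq> 0"
  unfolding log_ratio_def by (auto split: p1.splits)

text \<open>Indexing by the four points instead of by coordinates in a chart lets the two
  denominators be compared factor by factor.\<close>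

lemma log_den_prod:
  assumes "inj t"
  shows "log_den t c x = (\<Prod>i\<in>UNIV. if t i \<in> range (pt c) then x - inv (pt c) (t i) else 1)"
proof -
  let ?I = "{i. t i \<in> range (pt c)}" and ?f = "\<lambda>i. inv (pt c) (t i)"
  have "div_in t c = ?f ` ?I"
  proof (intro set_eqI iffI)
    fix a assume "a \<in> div_in t c"
    then obtain i where i: "pt c a = t i" by (auto simp: div_in_def)
    then have "t i \<in> range (pt c)" by (metis rangeI)
    moreover have "?f i = a" by (metis i inj_pt inv_f_f)
    ultimately show "a \<in> ?f ` ?I" by force
  next
    fix a assume "a \<in> ?f ` ?I"
    then obtain i where "t i \<in> range (pt c)" "a = ?f i" by blast
    then have "pt c a = t i" by (simp add: f_inv_into_f)
    then show "a \<in> div_in t c" by (simp add: div_in_def)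
  qed
  moreover have "inj_on ?f ?I"
  proof (rule inj_onI)
    fix i j assume "i \<in> ?I" "j \<in> ?I" "?f i = ?f j"
    then have "t i = t j" by (metis (no_types, lifting) f_inv_into_f mem_Collect_eq)
    then show "i = j" using assms by (simp add: inj_eq)
  qed
  ultimately have "log_den t c x = (\<Prod>i\<in>?I. x - ?f i)"
    unfolding log_den_def by (simp add: prod.reindex)
  also have "\<dots> = (\<Prod>i\<in>UNIV. if i \<in> ?I then x - ?f i else 1)"
    by (subst prod.inter_filter[symmetric]) simp_all
  finally show ?thesis by simp
qed

lemma log_den_charts:
  assumes "inj t" "z \<noteq> 0"
  shows "log_den t ChartInf (1 / z) * (log_ratio t * z ^ 4) = log_den t Chart0 z"
proof -
  have r0: "Fin a \<in> range (pt Chart0)" "inv (pt Chart0) (Fin a) = a" "Infty \<notin> range (pt Chart0)" for a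
    by (auto intro!: inv_f_eq inj_pt)
  have r1: "Fin a \<in> range (pt ChartInf)" "inv (pt ChartInf) (Fin a) = 1 / a" if "a \<noteq> 0" for a
    using that by (auto intro!: inv_f_eq inj_pt image_eqI[of _ _ "1/a"])
  have r2: "Infty \<in> range (pt ChartInf)" "inv (pt ChartInf) Infty = 0" "Fin 0 \<notin> range (pt ChartInf)"
    by (auto intro!: inv_f_eq inj_pt image_eqI[of _ _ 0] split: if_splits)
  have z4: "z ^ 4 = (\<Prod>i\<in>(UNIV :: 4 set). z)" by simp
  have "(if t i \<in> range (pt ChartInf) then 1 / z - inv (pt ChartInf) (t i) else 1) *
      ((case t i of Infty \<Rightarrow> 1 | Fin a \<Rightarrow> if a = 0 then 1 else - a) * z)
     = (if t i \<in> range (pt Chart0) then z - inv (pt Chart0) (t i) else 1)" for i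
  proof (cases "t i")
    case (Fin a)
    then show ?thesis using assms(2) r0 r1[of a] r2 by (cases "a = 0") (simp_all add: field_simps)
  next
    case Infty
    then show ?thesis using assms(2) r0 r2 by simp
  qed
  note * = this
  show ?thesis
    unfolding log_den_prod[OF assms(1)] log_ratio_def z4 by (simp only: prod.distrib[symmetric] *)
qed

section \<open>Standard form\<close>

text \<open>The trivialised bundle \<open>\<O>(1) \<oplus> \<O>\<close>; the first coordinate spans \<open>L = \<O>(1)\<close>.\<close>

definition standard :: "lconn \<Rightarrow> bool" where
  "standard X \<longleftrightarrow> (\<forall>z. z \<noteq> 0 \<longrightarrow> trans X z = mat2 (1 / z) 0 0 1)"

text \<open>The map \<open>L \<rightarrow> (E/L) \<otimes> \<Omega>(log D)\<close>, a section of \<open>\<O>(1)\<close>, is \<open>a + b z\<close>.\<close>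

definition off_diagonal :: "(4 \<Rightarrow> p1) \<Rightarrow> lconn \<Rightarrow> complex \<Rightarrow> complex \<Rightarrow> bool" where
  "off_diagonal t X a b \<longleftrightarrow> (\<forall>z. conn X Chart0 z $ 2 $ 1 = a + b * z) \<and>
     (\<forall>w. conn X ChartInf w $ 2 $ 1 = - (a * w + b) / log_ratio t)"

text \<open>The transition matrix is diagonal, so its derivative does not enter the lower left entry
  of the gluing condition. The exponents describe a section of O(3 - 2n), in accordance with
  Hom(O(n), O(1 - n)) twisted by O(2).\<close>

lemma split_gluing:
  assumes "inj t" "connection t X" "z \<noteq> 0" "Fin z \<notin> range t"
    "\<And>z. z \<noteq> 0 \<Longrightarrow> trans X z = mat2 (1 / z ^ n) 0 0 (z ^ (n - 1))" "n \<ge> 1"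
  shows "conn X Chart0 z $ 2 $ 1 * z ^ (2 * n) = z ^ 3 * (- log_ratio t * conn X ChartInf (1 / z) $ 2 $ 1)"
proof -
  have h0: "log_den t Chart0 z \<noteq> 0" using assms(4) by (simp add: log_den_eq_0_iff)
  have h1: "log_den t ChartInf (1 / z) \<noteq> 0" using assms(3,4) by (simp add: log_den_eq_0_iff)
  have "mderiv (trans X) z $ 2 $ 1 = mderiv (\<lambda>z. mat2 (1 / z ^ n) 0 0 (z ^ (n - 1))) z $ 2 $ 1"
    using mderiv_cong_punctured[OF assms(3,5)] by simp
  also have "\<dots> = 0" by (simp add: mderiv_def)
  finally have d: "mderiv (trans X) z $ 2 $ 1 = 0" .
  have "(trans X z ** cscale (1 / log_den t Chart0 z) (conn X Chart0 z)) $ 2 $ 1 =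
    (cscale (lam X) (mderiv (trans X) z) +
        cscale (- 1 / (z\<^sup>2 * log_den t ChartInf (1 / z))) (conn X ChartInf (1 / z)) ** trans X z) $ 2 $ 1"
    using assms(2-4) unfolding connection_def by simp
  then have "z ^ (n - 1) * (conn X Chart0 z $ 2 $ 1 / log_den t Chart0 z) =
    - (conn X ChartInf (1 / z) $ 2 $ 1 / (z\<^sup>2 * log_den t ChartInf (1 / z))) / z ^ n"
    using d by (simp add: matrix_mult_nth assms(5)[OF assms(3)])
  then have "z ^ (n - 1) * (conn X Chart0 z $ 2 $ 1 / log_den t Chart0 z) * (log_den t Chart0 z * z ^ n * z) =
    - (conn X ChartInf (1 / z) $ 2 $ 1 / (z\<^sup>2 * log_den t ChartInf (1 / z))) / z ^ n
    * (log_den t ChartInf (1 / z) * (log_ratio t * z ^ 4) * z ^ n * z)"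
    unfolding log_den_charts[OF assms(1,3)] by simp
  then have "z * z ^ (n - 1) * z ^ n * conn X Chart0 z $ 2 $ 1 =
    - (conn X ChartInf (1 / z) $ 2 $ 1) * log_ratio t * z ^ 3"
    using h0 h1 assms(3) by (simp add: field_simps power2_eq_square power3_eq_cube power4_eq_xxxx)
  moreover have "z * z ^ (n - 1) = z ^ n" using assms(6) by (simp flip: power_Suc)
  then have "z ^ (2 * n) = z * z ^ (n - 1) * z ^ n" by (simp only: mult_2 power_add)
  ultimately show ?thesis by (simp add: mult.commute mult.left_commute)
qed

lemma finite_bad_points: "finite {z. z = 0 \<or> Fin z \<in> range (t :: 4 \<Rightarrow> p1)}"
proof -
  have "{z. z = 0 \<or> Fin z \<in> range t} = insert 0 (div_in t Chart0)" by (auto simp: div_in_def)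
  then show ?thesis using finite_div_in by simp
qed

text \<open>For n >= 2 the degree 3 - 2n is negative and the section vanishes; for n = 1 it is
  linear, with the roles of the two coefficients exchanged in the chart at infinity.\<close>

lemma split_off_diagonal:
  assumes "inj t" "connection t X"
    "\<And>z. z \<noteq> 0 \<Longrightarrow> trans X z = mat2 (1 / z ^ n) 0 0 (z ^ (n - 1))" "n \<ge> 1"
  shows "(\<forall>c x. conn X c x $ 2 $ 1 = 0) \<or> n = 1"
    and "n = 1 \<Longrightarrow> \<exists>a b. off_diagonal t X a b"
proof -
  have "poly_fun (\<lambda>x. conn X c x $ 2 $ 1)" for c using assms(2) by (simp add: connection_def)
  then have "\<forall>c. \<exists>p. \<forall>x. conn X c x $ 2 $ 1 = poly p x" unfolding poly_fun_def by blast
  then obtain p where p: "\<And>c x. conn X c x $ 2 $ 1 = poly (p c) x" by metis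
  let ?S = "{z. z = 0 \<or> Fin z \<in> range t}"
  have eq: "poly (p Chart0) z * z ^ (2 * n) = z ^ 3 * poly (smult (- log_ratio t) (p ChartInf)) (1 / z)"
    if "z \<notin> ?S" for z
    using split_gluing[OF assms(1,2) _ _ assms(3,4), of z] that by (simp add: p)
  have deg: "p Chart0 = 0 \<or> degree (p Chart0) + 2 * n \<le> 3"
    using poly_reciprocal_degree[OF finite_bad_points[of t]] eq by blast
  have inf: "p ChartInf = r" if "\<And>z. z \<notin> ?S \<Longrightarrow> poly (p ChartInf) (1 / z) = poly r (1 / z)" for r
  proof (rule poly_eqI_cofinite)
    show "finite ((\<lambda>z. 1 / z) ` ?S)" using finite_bad_points by simp
    fix w assume "w \<notin> (\<lambda>z. 1 / z) ` ?S"
    then have "1 / w \<notin> ?S" by (metis (no_types, lifting) div_by_1 divide_divide_eq_right image_eqI mult_1)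
    then show "poly (p ChartInf) w = poly r w" using that[of "1 / w"] by simp
  qed
  show "(\<forall>c x. conn X c x $ 2 $ 1 = 0) \<or> n = 1"
  proof (cases "p Chart0 = 0")
    case True
    have "p ChartInf = 0" using eq True log_ratio_nonzero by (intro inf) auto
    then have "p c = 0" for c using True by (cases c) auto
    then show ?thesis using p by simp
  next
    case False
    then show ?thesis using deg assms(4) by auto
  qed
  show "\<exists>a b. off_diagonal t X a b" if "n = 1"
  proof -
    have "degree (p Chart0) \<le> 1" using deg that by auto
    then have c0: "poly (p Chart0) z = coeff (p Chart0) 0 + coeff (p Chart0) 1 * z" for z
      by (rule poly_degree_le_1)
    let ?a = "coeff (p Chart0) 0" and ?b = "coeff (p Chart0) 1"
    have "p ChartInf = [:- ?b / log_ratio t, - ?a / log_ratio t:]"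
    proof (rule inf)
      fix z assume z: "z \<notin> ?S"
      have "(?a + ?b * z) * z ^ 2 = z ^ 3 * (- log_ratio t * poly (p ChartInf) (1 / z))"
        using eq[OF z] c0 that by simp
      then have "z ^ 2 * (?a + ?b * z) = z ^ 2 * (- z * log_ratio t * poly (p ChartInf) (1 / z))"
        by (simp add: power2_eq_square power3_eq_cube algebra_simps)
      then have e: "?a + ?b * z = - z * log_ratio t * poly (p ChartInf) (1 / z)"
        by (rule mult_left_cancel[THEN iffD1, rotated]) (use z in simp)
      have "poly [:- ?b / log_ratio t, - ?a / log_ratio t:] (1 / z) = - (?a + ?b * z) / (z * log_ratio t)"
        using z log_ratio_nonzero[of t] by (simp add: field_simps)
      also have "\<dots> = poly (p ChartInf) (1 / z)"
        unfolding e using z log_ratio_nonzero[of t] by simp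
      finally show "poly (p ChartInf) (1 / z) = poly [:- ?b / log_ratio t, - ?a / log_ratio t:] (1 / z)" ..
    qed
    then have "off_diagonal t X ?a ?b"
      unfolding off_diagonal_def p using c0 by (simp add: diff_divide_distrib mult.commute)
    then show ?thesis by blast
  qed
qed

lemma standard_off_diagonal:
  assumes "inj t" "connection t X" "standard X"
  obtains a b where "off_diagonal t X a b"
  using split_off_diagonal(2)[OF assms(1,2), of 1] assms(3) by (auto simp: standard_def)

lemma vec2_nonzero: "k \<noteq> 0 \<Longrightarrow> vec2 k l \<noteq> 0" "l \<noteq> 0 \<Longrightarrow> vec2 k l \<noteq> 0"
  by (auto simp: vec_eq_iff forall_2)

lemma constant_subbundle:
  assumes "\<And>z. z \<noteq> 0 \<Longrightarrow> trans X z = mat2 (1 / z ^ n) 0 0 (z ^ (n - 1))"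
  shows "line_subbundle X (\<lambda>c x. vec2 1 0) (int n)"
  unfolding line_subbundle_def
proof (intro conjI allI exI[of _ "1 :: complex"] impI)
  show "vec2 1 0 \<noteq> 0" by (simp add: vec2_nonzero)
  fix z :: complex assume "z \<noteq> 0"
  then show "trans X z *v vec2 1 0 = (1 * z powi (- int n)) *s vec2 1 0"
    by (intro vec2_eqI) (simp_all add: assms matrix_vec_nth power_int_minus divide_inverse)
qed (auto intro: poly_fun_const)

lemma vderiv_const [simp]: "vderiv (\<lambda>x. v) x = 0"
  by (rule vec2_eqI) (simp_all add: vderiv_def)

text \<open>The generator of L is constant in a split frame, so the derivative drops out and only
  the lower left entry moves it out of L.\<close>

lemma nabla_constant:
  assumes "k \<noteq> 0"
  shows "nabla t X c (\<lambda>x. vec2 k 0) x \<in> vec.span {vec2 k 0} \<longleftrightarrow> conn X c x $ 2 $ 1 = 0"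
  using assms by (simp add: span_singleton_iff vec2_nonzero nabla_def matrix_vec_nth)

text \<open>Since \<open>\<Omega>(log D) = \<O>(2)\<close>, the section \<open>L \<rightarrow> (E/L) \<otimes> \<Omega>(log D)\<close> of \<open>\<O>(3 - 2n)\<close> can only be
  nonzero for \<open>n = 1\<close>.\<close>

lemma standard_form:
  assumes "inj t" "rank2_bundle 1 X" "connection t X"
    "\<And>f n. line_subbundle X f n \<Longrightarrow> invariant t X f \<Longrightarrow> n \<le> 0"
  obtains Y \<phi> a b where "isomorphism t X Y \<phi>" "standard Y" "off_diagonal t Y a b" "(a, b) \<noteq> (0, 0)"
proof -
  obtain Y \<phi> n where Y: "isomorphism t X Y \<phi>" "n \<ge> (1::nat)"
    "\<And>z. z \<noteq> 0 \<Longrightarrow> trans Y z = mat2 (1 / z ^ n) 0 0 (z ^ (n - 1))"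
    using split_form[OF assms(2), of t] by blast
  have conn: "connection t Y" using connection_isomorphism[OF Y(1) assms(2,3)] .
  \<comment> \<open>Otherwise the first summand would be an invariant subbundle of degree n >= 1,
    and so would its preimage in \<open>X\<close>.\<close>
  have ni: "\<not> (\<forall>c x. conn Y c x $ 2 $ 1 = 0)"
  proof
    assume "\<forall>c x. conn Y c x $ 2 $ 1 = 0"
    then have "invariant t Y (\<lambda>c x. vec2 1 0)" unfolding invariant_def by (simp add: nabla_constant)
    moreover note iso = isomorphism_sym[OF Y(1)] and sub = constant_subbundle[OF Y(3), simplified]
    ultimately have "invariant t X (\<lambda>c x. inv2 (\<phi> c x) *v vec2 1 0)"
      using invariant_isomorphism[OF iso sub] by simp
    moreover have "line_subbundle X (\<lambda>c x. inv2 (\<phi> c x) *v vec2 1 0) n"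
      using line_subbundle_isomorphism[OF iso sub] by simp
    ultimately show False using assms(4) Y(2) by force
  qed
  then have n: "n = 1" using split_off_diagonal(1)[OF assms(1) conn Y(3,2)] by blast
  then obtain a b where ab: "off_diagonal t Y a b" using split_off_diagonal(2)[OF assms(1) conn Y(3,2)] by blast
  have "conn Y c x $ 2 $ 1 = 0" if "(a, b) = (0, 0)" for c x
    using ab that unfolding off_diagonal_def by (cases c) auto
  then have "(a, b) \<noteq> (0, 0)" using ni by blast
  moreover have "standard Y" using Y(3) n by (simp add: standard_def)
  ultimately show ?thesis using that Y(1) ab by blast
qed

text \<open>In a standard frame \<open>line1\<close> is the fibre of L = O(1) and
  \<open>line2\<close> that of the complementary summand M = O.\<close>

abbreviation line1 :: "(complex^2) set" where "line1 \<equiv> vec.span {vec2 1 0}"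
abbreviation line2 :: "(complex^2) set" where "line2 \<equiv> vec.span {vec2 0 1}"

lemma line1_iff: "v \<in> line1 \<longleftrightarrow> v $ 2 = 0"
  and line2_iff: "v \<in> line2 \<longleftrightarrow> v $ 1 = 0"
  by (auto simp: span_singleton_iff vec2_nonzero)

lemma line1_neq_line2: "line1 \<noteq> line2"
proof
  assume "line1 = line2"
  then have "vec2 1 0 \<in> line2" using line1_iff[of "vec2 1 0"] by simp
  then show False by (simp add: line2_iff)
qed

lemma span_vec2_1: "k \<noteq> 0 \<Longrightarrow> vec.span {vec2 k 0} = line1"
  and span_vec2_2: "k \<noteq> 0 \<Longrightarrow> vec.span {vec2 0 k} = line2"
  by (auto intro!: span_singleton_eq simp: line1_iff line2_iff vec2_nonzero)

lemma diag_image_line1: "k \<noteq> 0 \<Longrightarrow> (\<lambda>v. mat2 k 0 0 l *v v) ` line1 = line1"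
  and diag_image_line2: "l \<noteq> 0 \<Longrightarrow> (\<lambda>v. mat2 k 0 0 l *v v) ` line2 = line2"
proof -
  have "mat2 k 0 0 l *v vec2 1 0 = vec2 k 0" "mat2 k 0 0 l *v vec2 0 1 = vec2 0 l"
    by (rule vec2_eqI; simp add: matrix_vec_nth)+
  then show "k \<noteq> 0 \<Longrightarrow> (\<lambda>v. mat2 k 0 0 l *v v) ` line1 = line1"
    "l \<noteq> 0 \<Longrightarrow> (\<lambda>v. mat2 k 0 0 l *v v) ` line2 = line2"
    using span_vec2_1[of k] span_vec2_2[of l] by (simp_all add: span_image)
qed

section \<open>The destabilising line and its apparent singularity\<close>

text \<open>The components of a generator are sections of O(1 - n) and O(- n). For n >= 1 the second
  vanishes; the first must then be nonzero, hence n = 1 and it is constant. So L is the only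
  subbundle of positive degree.\<close>

lemma standard_subbundle:
  assumes "standard X" "line_subbundle X f n" "n \<ge> 1"
  shows "n = 1" "\<exists>k. (\<forall>c. k c \<noteq> 0) \<and> f = (\<lambda>c x. vec2 (k c) 0)"
proof -
  obtain l where l: "l \<noteq> 0"
    "\<And>z. z \<noteq> 0 \<Longrightarrow> trans X z *v f Chart0 z = (l * z powi (- n)) *s f ChartInf (1 / z)"
    using assms(2) by (auto simp: line_subbundle_def)
  obtain m where m: "n = int m" using assms(3) by (metis nonneg_eq_int order_trans zero_le_one)
  have eq1: "f Chart0 z $ 1 * z ^ m = z * (l * f ChartInf (1 / z) $ 1)"
    and eq2: "f Chart0 z $ 2 * z ^ m = l * f ChartInf (1 / z) $ 2" if "z \<noteq> 0" for z
  proof -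
    have T: "trans X z = mat2 (1 / z) 0 0 1" using assms(1) that by (simp add: standard_def)
    have "(trans X z *v f Chart0 z) $ i = l * z powi (- n) * f ChartInf (1 / z) $ i" for i
      using l(2)[OF that] by simp
    from this[of 1] this[of 2]
    show "f Chart0 z $ 1 * z ^ m = z * (l * f ChartInf (1 / z) $ 1)"
      "f Chart0 z $ 2 * z ^ m = l * f ChartInf (1 / z) $ 2"
      unfolding T m using that by (simp_all add: matrix_vec_nth power_int_minus field_simps)
  qed
  have pf: "poly_fun (\<lambda>x. f c x $ j)" for c j using assms(2) by (simp add: line_subbundle_def)
  obtain p1 where p1: "\<And>x. f Chart0 x $ 1 = poly p1 x" using pf unfolding poly_fun_def by blast
  obtain p2 where p2: "\<And>x. f Chart0 x $ 2 = poly p2 x" using pf unfolding poly_fun_def by blast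
  obtain q1 where q1: "\<And>x. f ChartInf x $ 1 = poly q1 x" using pf unfolding poly_fun_def by blast
  obtain q2 where q2: "\<And>x. f ChartInf x $ 2 = poly q2 x" using pf unfolding poly_fun_def by blast
  have d1: "p1 = 0 \<or> degree p1 + m \<le> 1"
    by (rule poly_reciprocal_degree[of "{}" _ _ _ "smult l q1"]) (use eq1 p1 q1 in auto)
  have "p2 = 0 \<or> degree p2 + m \<le> 0"
    by (rule poly_reciprocal_degree[of "{}" _ _ _ "smult l q2"]) (use eq2 p2 q2 in auto)
  then have p20: "p2 = 0" using assms(3) m by auto
  have "p1 \<noteq> 0"
  proof
    assume "p1 = 0"
    then have "f Chart0 0 = 0" using p1 p2 p20 by (intro vec2_eqI) auto
    then show False using assms(2) by (simp add: line_subbundle_def)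
  qed
  then have m1: "m = 1" "degree p1 = 0" using d1 assms(3) m by auto
  then obtain k0 where k0: "p1 = [:k0:]" using degree_eq_zeroE by blast
  have k00: "k0 \<noteq> 0" using \<open>p1 \<noteq> 0\<close> k0 by auto
  have "q1 = [:k0 / l:]" "q2 = 0"
    by (rule poly_eqI_cofinite[of "{0}"], simp,
        use eq1[of "1 / x" for x] eq2[of "1 / x" for x] l(1) in \<open>simp add: m1 p1 q1 p2 q2 p20 k0 field_simps\<close>)+
  then have "f c x = vec2 (case c of Chart0 \<Rightarrow> k0 | ChartInf \<Rightarrow> k0 / l) 0" for c x
    by (cases c) (auto intro!: vec2_eqI simp: p1 p2 q1 q2 p20 k0)
  then have "f = (\<lambda>c x. vec2 (case c of Chart0 \<Rightarrow> k0 | ChartInf \<Rightarrow> k0 / l) 0)" by (intro ext)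
  moreover have "(case c of Chart0 \<Rightarrow> k0 | ChartInf \<Rightarrow> k0 / l) \<noteq> 0" for c
    using k00 l(1) by (cases c) auto
  ultimately show "\<exists>k. (\<forall>c. k c \<noteq> 0) \<and> f = (\<lambda>c x. vec2 (k c) 0)"
    by (intro exI[of _ "\<lambda>c. case c of Chart0 \<Rightarrow> k0 | ChartInf \<Rightarrow> k0 / l"]) simp
  show "n = 1" using m m1 by simp
qed

definition linear_zero :: "complex \<Rightarrow> complex \<Rightarrow> p1" where
  "linear_zero a b = (if b = 0 then Infty else Fin (- a / b))"

lemma off_diagonal_zero_iff:
  assumes "off_diagonal t X a b" "(a, b) \<noteq> (0, 0)"
  shows "conn X c x $ 2 $ 1 = 0 \<longleftrightarrow> pt c x = linear_zero a b"
proof (cases c)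
  case Chart0
  have "a + b * x = 0 \<longleftrightarrow> Fin x = linear_zero a b"
    using assms(2) by (auto simp: linear_zero_def field_simps add_eq_0_iff)
  then show ?thesis using assms(1) Chart0 by (simp add: off_diagonal_def)
next
  case ChartInf
  have "a * x + b = 0 \<longleftrightarrow> pt ChartInf x = linear_zero a b"
  proof (cases "x = 0")
    case True
    then show ?thesis by (simp add: linear_zero_def)
  next
    case False
    have "1 / x = - a / b \<longleftrightarrow> a * x + b = 0" if "b \<noteq> 0"
      using that False by (auto simp: field_simps add_eq_0_iff)
    then show ?thesis using assms(2) False by (auto simp: linear_zero_def)
  qed
  moreover have "conn X ChartInf x $ 2 $ 1 = - (a * x + b) / log_ratio t"
    using assms(1) unfolding off_diagonal_def by blast
  ultimately show ?thesis
    using log_ratio_nonzero[of t] by (simp only: ChartInf divide_eq_0_iff neg_equal_0_iff_equal simp_thms)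
qed

lemma pt_surj: obtains c x where "pt c x = p"
proof (cases p)
  case (Fin z)
  then show ?thesis using that[of Chart0 z] by simp
next
  case Infty
  then show ?thesis using that[of ChartInf 0] by simp
qed

lemma off_diagonal_nonzero:
  assumes "off_diagonal t X a b" "(a, b) \<noteq> (0, 0)"
  obtains x where "conn X c x $ 2 $ 1 \<noteq> 0"
proof -
  \<comment> \<open>The section has a single zero, so one of any two distinct points, here those
    with coordinates 1 and 2, is not a zero.\<close>
  have "pt c 1 \<noteq> pt c 2" using inj_pt by (auto simp: inj_eq)
  then have "conn X c 1 $ 2 $ 1 \<noteq> 0 \<or> conn X c 2 $ 2 $ 1 \<noteq> 0"
    unfolding off_diagonal_zero_iff[OF assms] by auto
  then show ?thesis using that by blast
qed

lemma mem_dpt: "(y, \<tau>) \<in> dpt t \<sigma> x \<longleftrightarrow> y = x \<and> (\<sigma> = \<tau> \<or> x \<notin> range t)"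
  by (auto simp: dpt_def glue_def)

lemma dpt_eq_iff: "dpt t \<sigma> x = dpt t \<tau> y \<longleftrightarrow> x = y \<and> (\<sigma> = \<tau> \<or> x \<notin> range t)"
proof
  assume eq: "dpt t \<sigma> x = dpt t \<tau> y"
  have "(x, \<sigma>) \<in> dpt t \<sigma> x" by (simp add: mem_dpt)
  then show "x = y \<and> (\<sigma> = \<tau> \<or> x \<notin> range t)" unfolding eq by (auto simp: mem_dpt)
next
  assume "x = y \<and> (\<sigma> = \<tau> \<or> x \<notin> range t)"
  then show "dpt t \<sigma> x = dpt t \<tau> y" by (auto simp: dpt_def glue_def)
qed

lemma fibre_line1:
  assumes "\<And>c. k c \<noteq> 0" "\<And>c x. f c x = vec2 (k c) 0"
  shows "fibre_at t f i = line1"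
  using assms span_vec2_1[of "k (fst (loc t i))"] by (simp add: fibre_at_def case_prod_beta)

text \<open>Every witness in the definition of \<open>Upsilon\<close> is a constant multiple of L on
  each chart, so its zero is that of a + b z. The value of \<open>lam\<close> is arbitrary, so this
  covers connections and Higgs bundles alike; off D both signs name the same point.\<close>

lemma Upsilon_standard:
  assumes X: "standard X" "off_diagonal t X a b" "(a, b) \<noteq> (0, 0)"
    and \<sigma>: "\<And>i. t i = linear_zero a b \<Longrightarrow> \<sigma> = Minus \<longleftrightarrow> par X i = line1"
  shows "Upsilon t X = dpt t \<sigma> (linear_zero a b)"
  unfolding Upsilon_def
proof (rule the_equality)
  let ?f = "\<lambda>(c :: chart) (x :: complex). vec2 1 0"
  have "line_subbundle X ?f 1"
    using constant_subbundle[of X 1] X(1) by (simp add: standard_def)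
  moreover obtain c x where "pt c x = linear_zero a b" using pt_surj .
  then have "apparent_zero t X ?f (linear_zero a b)"
    unfolding apparent_zero_def using off_diagonal_zero_iff[OF X(2,3)] by (auto simp: nabla_constant)
  moreover have "fibre_at t ?f i = line1" for i
    by (rule fibre_line1[of "\<lambda>_. 1"]) simp_all
  then have "\<forall>i. t i = linear_zero a b \<longrightarrow> (\<sigma> = Minus \<longleftrightarrow> fibre_at t ?f i = par X i)"
    using \<sigma> by auto
  ultimately show "\<exists>f p \<tau>. line_subbundle X f 1 \<and> apparent_zero t X f p \<and> dpt t \<sigma> (linear_zero a b) = dpt t \<tau> p \<and>
      (\<forall>i. t i = p \<longrightarrow> (\<tau> = Minus) = (fibre_at t f i = par X i))"
    by (intro exI[of _ ?f] exI[of _ "linear_zero a b"] exI[of _ \<sigma>] conjI refl)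
next
  fix q assume "\<exists>f p \<tau>. line_subbundle X f 1 \<and> apparent_zero t X f p \<and> q = dpt t \<tau> p \<and>
      (\<forall>i. t i = p \<longrightarrow> (\<tau> = Minus) = (fibre_at t f i = par X i))"
  then obtain f p \<tau> where f: "line_subbundle X f 1" "apparent_zero t X f p" "q = dpt t \<tau> p"
    "\<forall>i. t i = p \<longrightarrow> (\<tau> = Minus) = (fibre_at t f i = par X i)"
    by (elim exE conjE) (rule that)
  obtain k where k: "\<forall>c. k c \<noteq> 0" and fk: "f = (\<lambda>c x. vec2 (k c) 0)"
    using standard_subbundle(2)[OF X(1) f(1) order_refl] by (elim exE conjE) (rule that)
  obtain c x where cx: "pt c x = p" "nabla t X c (f c) x \<in> vec.span {f c x}"
    using f(2) by (auto simp: apparent_zero_def)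
  then have "conn X c x $ 2 $ 1 = 0" unfolding fk using k by (simp add: nabla_constant)
  then have p: "p = linear_zero a b" using off_diagonal_zero_iff[OF X(2,3)] cx by simp
  have fib: "fibre_at t f i = line1" for i using k by (intro fibre_line1[of k]) (simp_all add: fk)
  have "\<tau> = \<sigma>" if i: "t i = linear_zero a b" for i
  proof -
    have "\<tau> = Minus \<longleftrightarrow> \<sigma> = Minus" using f(4)[rule_format, of i] \<sigma>[of i] i p fib by auto
    then show ?thesis by (cases \<tau>; cases \<sigma>) auto
  qed
  then show "q = dpt t \<sigma> (linear_zero a b)"
    unfolding f(3) p dpt_eq_iff by (metis rangeE)
qed

text \<open>At most one index lies over \<open>p\<close> because \<open>t\<close> is injective, so
  its condition can be stored in a single sign.\<close>

lemma sign_exists: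
  assumes "inj (t :: 4 \<Rightarrow> p1)"
  obtains \<sigma> where "\<And>i. t i = p \<Longrightarrow> \<sigma> = Minus \<longleftrightarrow> P i"
proof (rule that)
  fix i assume "t i = p"
  then have "{i. t i = p} = {i}" using assms by (auto dest: injD)
  then have "(\<exists>i. t i = p \<and> P i) \<longleftrightarrow> P i" by (metis (mono_tags, lifting) mem_Collect_eq singletonD \<open>t i = p\<close>)
  then show "(if \<exists>i. t i = p \<and> P i then Minus else Plus) = Minus \<longleftrightarrow> P i" by simp
qed

lemma standard_not_invariant:
  assumes "standard X" "off_diagonal t X a b" "(a, b) \<noteq> (0, 0)" "line_subbundle X f n" "invariant t X f"
  shows "n \<le> 0"
proof (rule ccontr)
  assume "\<not> n \<le> 0"
  then have "n \<ge> 1" by simp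
  obtain k where k: "\<forall>c. k c \<noteq> 0" and fk: "f = (\<lambda>c x. vec2 (k c) 0)"
    using standard_subbundle(2)[OF assms(1,4) \<open>n \<ge> 1\<close>] by (elim exE conjE) (rule that)
  obtain x where "conn X Chart0 x $ 2 $ 1 \<noteq> 0" using off_diagonal_nonzero[OF assms(2,3)] .
  moreover have "conn X Chart0 x $ 2 $ 1 = 0"
    using assms(5) k unfolding invariant_def fk by (simp add: nabla_constant)
  ultimately show False by contradiction
qed

lemma standard_stable_nonzero:
  assumes "standard X" "off_diagonal t X a b" "\<And>f n. line_subbundle X f n \<Longrightarrow> invariant t X f \<Longrightarrow> n \<le> 0"
  shows "(a, b) \<noteq> (0, 0)"
proof
  assume "(a, b) = (0, 0)"
  then have "conn X c x $ 2 $ 1 = 0" for c x using assms(2) by (cases c) (auto simp: off_diagonal_def)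
  then have "invariant t X (\<lambda>c x. vec2 1 0)" by (simp add: invariant_def nabla_constant)
  moreover have "line_subbundle X (\<lambda>c x. vec2 1 0) 1"
    using constant_subbundle[of X 1] assms(1) by (simp add: standard_def)
  ultimately show False using assms(3) by force
qed

text \<open>A residue preserving the fibre of L has zero lower left entry. Hence a parabolic line
  can lie on L only at the apparent singularity.\<close>

lemma residue_line1:
  assumes "parabolic t X" "off_diagonal t X a b" "(a, b) \<noteq> (0, 0)" "par X i = line1"
  shows "t i = linear_zero a b"
proof -
  obtain k where k: "k \<noteq> 0" "residue_at t X i = cscale k (at_point t i (conn X))"
    using residue_at_eq by blast
  have "vec2 1 0 \<in> par X i" by (simp add: assms(4) line1_iff)
  then have "residue_at t X i *v vec2 1 0 \<in> par X i" using assms(1) unfolding parabolic_def by blast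
  then have "residue_at t X i *v vec2 1 0 \<in> line1" unfolding assms(4) .
  then have "at_point t i (conn X) $ 2 $ 1 = 0"
    using k by (simp add: line1_iff matrix_vec_nth)
  then show ?thesis
    using off_diagonal_zero_iff[OF assms(2,3)] pt_loc by (metis prod.collapse)
qed

section \<open>Morphisms between bundles in standard form\<close>

text \<open>The entries are sections of the Hom bundles between the summands: constants on the
  diagonal, nothing in O(-1) from L to M, and a section \<open>s\<close> of O(1) from M to
  L.\<close>

lemma standard_morphism:
  assumes "morphism t X Y \<phi>" "standard X" "standard Y"
  shows "\<exists>p q s. (\<forall>c x. \<phi> c x = mat2 p (s c x) 0 q) \<and> (\<forall>c. poly_fun (s c)) \<and>
    (\<forall>z. z \<noteq> 0 \<longrightarrow> s Chart0 z = z * s ChartInf (1 / z))"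
proof -
  have pm: "poly_fun (\<lambda>x. \<phi> c x $ i $ j)" for c i j
    using poly_mat_nth[OF morphismD(2)[OF assms(1)]] .
  have eq: "\<phi> Chart0 z $ 1 $ 1 = \<phi> ChartInf (1 / z) $ 1 $ 1"
    "\<phi> Chart0 z $ 1 $ 2 = z * \<phi> ChartInf (1 / z) $ 1 $ 2"
    "\<phi> Chart0 z $ 2 $ 1 * z = \<phi> ChartInf (1 / z) $ 2 $ 1"
    "\<phi> Chart0 z $ 2 $ 2 = \<phi> ChartInf (1 / z) $ 2 $ 2" if "z \<noteq> 0" for z
  proof -
    have "trans Y z = mat2 (1 / z) 0 0 1" "trans X z = mat2 (1 / z) 0 0 1"
      using assms that by (auto simp: standard_def)
    then have "mat2 (1 / z) 0 0 1 ** \<phi> Chart0 z = \<phi> ChartInf (1 / z) ** mat2 (1 / z) 0 0 1"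
      using morphismD(3)[OF assms(1) that] by simp
    then have "(mat2 (1 / z) 0 0 1 ** \<phi> Chart0 z) $ i $ j = (\<phi> ChartInf (1 / z) ** mat2 (1 / z) 0 0 1) $ i $ j" for i j
      by simp
    from this[of 1 1] this[of 1 2] this[of 2 1] this[of 2 2] show
      "\<phi> Chart0 z $ 1 $ 1 = \<phi> ChartInf (1 / z) $ 1 $ 1"
      "\<phi> Chart0 z $ 1 $ 2 = z * \<phi> ChartInf (1 / z) $ 1 $ 2"
      "\<phi> Chart0 z $ 2 $ 1 * z = \<phi> ChartInf (1 / z) $ 2 $ 1"
      "\<phi> Chart0 z $ 2 $ 2 = \<phi> ChartInf (1 / z) $ 2 $ 2"
      using that by (simp_all add: matrix_mult_nth field_simps)
  qed
  have const: "\<exists>k. (\<forall>x. f x = k) \<and> (\<forall>x. g x = k)"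
    if f: "poly_fun f" "poly_fun g" and fg: "\<And>z. z \<noteq> 0 \<Longrightarrow> f z = g (1 / z)" for f g
  proof -
    obtain p where p: "f = poly p" using f(1) by (auto simp: poly_fun_def)
    obtain q where q: "g = poly q" using f(2) by (auto simp: poly_fun_def)
    have "p = 0 \<or> degree p + 0 \<le> 0"
      by (rule poly_reciprocal_degree[of "{}" _ _ _ q]) (use fg p q in auto)
    then obtain k where k: "p = [:k:]" using degree_eq_zeroE[of p] by auto
    have "q = [:k:]"
    proof (rule poly_eqI_cofinite[of "{0}"])
      fix w :: complex assume "w \<notin> {0}"
      then show "poly q w = poly [:k:] w" using fg[of "1 / w"] p q k by simp
    qed simp
    then show ?thesis using p q k by auto
  qed
  obtain p where p: "\<And>x. \<phi> Chart0 x $ 1 $ 1 = p" "\<And>x. \<phi> ChartInf x $ 1 $ 1 = p"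
    using const[OF pm pm eq(1)] by blast
  obtain q where q: "\<And>x. \<phi> Chart0 x $ 2 $ 2 = q" "\<And>x. \<phi> ChartInf x $ 2 $ 2 = q"
    using const[OF pm pm eq(4)] by blast
  \<comment> \<open>Multiplied by x, the entry in O(-1) extends to a constant; evaluation at x = 0
    shows that this constant is 0.\<close>
  obtain c where c: "\<And>x. \<phi> Chart0 x $ 2 $ 1 * x = c" "\<And>x. \<phi> ChartInf x $ 2 $ 1 = c"
    using const[OF poly_fun_mult[OF pm poly_fun_id] pm eq(3)] by blast
  have c0: "c = 0" using c(1)[of 0] by simp
  have "(\<lambda>x. \<phi> Chart0 x $ 2 $ 1) = (\<lambda>x. 0)"
    by (rule poly_fun_eqI_cofinite[of _ _ "{0}"]) (use c(1) c0 pm in \<open>auto intro: poly_fun_const\<close>)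
  then have c00: "\<phi> Chart0 x $ 2 $ 1 = 0" for x by meson
  have "\<phi> c x = mat2 p (\<phi> c x $ 1 $ 2) 0 q" for c x
  proof (rule mat2_eqI)
    show "\<phi> c x $ 1 $ 1 = mat2 p (\<phi> c x $ 1 $ 2) 0 q $ 1 $ 1" by (cases c) (simp_all add: p)
    show "\<phi> c x $ 2 $ 1 = mat2 p (\<phi> c x $ 1 $ 2) 0 q $ 2 $ 1" by (cases c) (simp_all add: c(2) c0 c00)
    show "\<phi> c x $ 2 $ 2 = mat2 p (\<phi> c x $ 1 $ 2) 0 q $ 2 $ 2" by (cases c) (simp_all add: q)
  qed simp
  then show ?thesis
    by (intro exI[of _ p] exI[of _ q] exI[of _ "\<lambda>c x. \<phi> c x $ 1 $ 2"] conjI allI impI pm eq(2))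
qed

text \<open>Schur's lemma for stable Higgs bundles, in coordinates.\<close>

lemma standard_higgs_morphism_det:
  assumes m: "morphism t X Y \<phi>" and st: "standard X" "standard Y" and lam: "lam X = 0"
    and X: "off_diagonal t X a b" "(a, b) \<noteq> (0, 0)" and Y: "off_diagonal t Y a' b'" "(a', b') \<noteq> (0, 0)"
    and nz: "\<phi> c0 x0 \<noteq> 0"
  shows "det (\<phi> c x) \<noteq> 0"
proof -
  obtain p q s where \<phi>': "\<forall>c x. \<phi> c x = mat2 p (s c x) 0 q" "\<forall>c. poly_fun (s c)"
    using standard_morphism[OF m st] by (elim exE conjE) (rule that)
  note \<phi> = \<phi>'[rule_format]
  have e: "conn Y c x ** \<phi> c x = \<phi> c x ** conn X c x" for c x
    using morphismD(4)[OF m, of c x] by (simp add: lam cscale_0)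
  have e21: "conn Y c x $ 2 $ 1 * p = q * conn X c x $ 2 $ 1"
    and e22: "conn Y c x $ 2 $ 1 * s c x + conn Y c x $ 2 $ 2 * q = q * conn X c x $ 2 $ 2" for c x
    using arg_cong[OF e[of c x], of "\<lambda>A. A $ 2 $ 1"] arg_cong[OF e[of c x], of "\<lambda>A. A $ 2 $ 2"]
    by (simp_all add: matrix_mult_nth \<phi>(1))
  \<comment> \<open>If \<open>p\<close> vanishes, the lower left entries force \<open>q\<close> = 0,
    and then the lower right entries force \<open>s c0\<close> to vanish off one point, hence
    identically, against \<open>nz\<close>.\<close>
  have "p \<noteq> 0"
  proof
    assume p: "p = 0"
    obtain x where "conn X Chart0 x $ 2 $ 1 \<noteq> 0" using off_diagonal_nonzero[OF X] .
    then have q: "q = 0" using e21[of Chart0 x] p by simp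
    have "s c0 = (\<lambda>_. 0)"
    proof (rule poly_fun_eqI_cofinite)
      show "finite {x. pt c0 x = linear_zero a' b'}"
        using finite_vimageI[OF _ inj_pt, of "{linear_zero a' b'}" c0] by (simp add: vimage_def)
      show "s c0 x = 0" if "x \<notin> {x. pt c0 x = linear_zero a' b'}" for x
        using that e22[of c0 x] q off_diagonal_zero_iff[OF Y, of c0 x] by simp
    qed (auto intro: \<phi> poly_fun_const)
    then have "\<phi> c0 x0 = 0" unfolding \<phi>(1) p q by (intro mat2_eqI) auto
    then show False using nz by contradiction
  qed
  moreover have "q \<noteq> 0"
  proof
    assume q: "q = 0"
    obtain x where "conn Y Chart0 x $ 2 $ 1 \<noteq> 0" using off_diagonal_nonzero[OF Y] .
    then show False using e21[of Chart0 x] q \<open>p \<noteq> 0\<close> by simp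
  qed
  ultimately show ?thesis by (simp add: \<phi>(1) det_mat2)
qed

section \<open>The fixed Higgs bundles\<close>

text \<open>The sum L + M with a Higgs field that maps L to M and kills M. The lines
  \<open>Q\<close> are left free because the special fibre of a degeneration is first obtained with
  lines not yet expressed through a sign.\<close>

definition model :: "(4 \<Rightarrow> p1) \<Rightarrow> complex \<Rightarrow> complex \<Rightarrow> (4 \<Rightarrow> (complex^2) set) \<Rightarrow> lconn" where
  "model t a b Q = \<lparr>lam = 0, trans = (\<lambda>z. mat2 (1 / z) 0 0 1),
     conn = (\<lambda>c x. mat2 0 0 (case c of Chart0 \<Rightarrow> a + b * x | ChartInf \<Rightarrow> - (a * x + b) / log_ratio t) 0),
     par = Q\<rparr>"

definition model_lines :: "(4 \<Rightarrow> p1) \<Rightarrow> psign \<Rightarrow> p1 \<Rightarrow> 4 \<Rightarrow> (complex^2) set" where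
  "model_lines t \<sigma> p i = (if t i = p \<and> \<sigma> = Minus then line1 else line2)"

text \<open>The section with prescribed zero is normalised: z - s for a finite point s, and the
  constant 1, which as a section of O(1) vanishes at infinity.\<close>

definition fixed_model :: "(4 \<Rightarrow> p1) \<Rightarrow> psign \<Rightarrow> p1 \<Rightarrow> lconn" where
  "fixed_model t \<sigma> p = (case p of Fin s \<Rightarrow> model t (- s) 1 (model_lines t \<sigma> p)
     | Infty \<Rightarrow> model t 1 0 (model_lines t \<sigma> p))"

lemma standard_model: "standard (model t a b Q)"
  by (simp add: standard_def model_def)

lemma off_diagonal_model: "off_diagonal t (model t a b Q) a b"
  by (simp add: off_diagonal_def model_def)

lemma fixed_model_cases:
  obtains a b where "fixed_model t \<sigma> p = model t a b (model_lines t \<sigma> p)" "(a, b) \<noteq> (0, 0)" "linear_zero a b = p"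
proof (cases p)
  case (Fin s)
  then show ?thesis using that[of "- s" 1] by (simp add: fixed_model_def linear_zero_def)
next
  case Infty
  then show ?thesis using that[of 1 0] by (simp add: fixed_model_def linear_zero_def)
qed

text \<open>Off D no index satisfies \<open>t i = p\<close>, so the sign does not influence the
  lines and the model descends to the glued space.\<close>

lemma fixed_model_cong: "dpt t \<sigma> p = dpt t \<tau> q \<Longrightarrow> fixed_model t \<sigma> p = fixed_model t \<tau> q"
proof -
  assume "dpt t \<sigma> p = dpt t \<tau> q"
  then have "p = q" "\<sigma> = \<tau> \<or> p \<notin> range t" by (auto simp: dpt_eq_iff)
  then have "model_lines t \<sigma> p i = model_lines t \<tau> q i" for i
    by (cases "t i = p") (auto simp: model_lines_def)
  then have M: "model_lines t \<sigma> p = model_lines t \<tau> q" by (rule ext)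
  show ?thesis unfolding fixed_model_def M unfolding \<open>p = q\<close> ..
qed

text \<open>Residues are strictly lower triangular, so they map everything into M and kill M, as
  needed for the line M; where the line is L the residue is zero, since the section vanishes
  there.\<close>

lemma model_qp_connection:
  assumes "inj t" "(a, b) \<noteq> (0, 0)" "\<And>i. Q i = line2 \<or> Q i = line1 \<and> t i = linear_zero a b"
  shows "qp_connection t 1 (model t a b Q)" "has_residues t (\<lambda>_ _. 0) (model t a b Q)"
proof -
  let ?X = "model t a b Q"
  let ?s = "\<lambda>c x. case c of Chart0 \<Rightarrow> a + b * x | ChartInf \<Rightarrow> - (a * x + b) / log_ratio t"
  have C: "conn ?X c x = mat2 0 0 (?s c x) 0" for c x by (simp add: model_def)
  have "laurent_fun (\<lambda>z. 1 / z)" using laurent_fun_reciprocal[OF poly_fun_id] by simp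
  then have "laurent_fun (\<lambda>z. trans ?X z $ i $ j)" for i j
  proof -
    have "\<forall>i j. laurent_fun (\<lambda>z. trans ?X z $ i $ j)" unfolding forall_2
      using \<open>laurent_fun (\<lambda>z. 1 / z)\<close> laurent_poly[OF poly_fun_const] by (simp add: model_def)
    then show ?thesis by blast
  qed
  moreover have "\<forall>z. z \<noteq> 0 \<longrightarrow> det (trans ?X z) = 1 * z powi (- 1)"
    by (simp add: model_def det_mat2 power_int_minus divide_inverse)
  ultimately have r: "rank2_bundle 1 ?X" unfolding rank2_bundle_def
    by (intro conjI allI exI[of _ 1]) simp_all
  have "poly_fun (?s c)" for c by (cases c) (auto intro!: poly_fun_intros)
  then have "poly_mat (conn ?X c)" for c
    by (intro poly_matI) (simp_all only: C mat2_nth poly_fun_const)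
  moreover have "trans ?X z ** cscale (1 / log_den t Chart0 z) (conn ?X Chart0 z) =
        cscale (lam ?X) (mderiv (trans ?X) z) +
        cscale (- 1 / (z\<^sup>2 * log_den t ChartInf (1 / z))) (conn ?X ChartInf (1 / z)) ** trans ?X z"
    if z: "z \<noteq> 0" "Fin z \<notin> range t" for z
  proof -
    have h0: "log_den t Chart0 z = log_den t ChartInf (1 / z) * (log_ratio t * z ^ 4)"
      using log_den_charts[OF assms(1) z(1)] by simp
    have "(a + b * z) / log_den t Chart0 z =
      - 1 / (z\<^sup>2 * log_den t ChartInf (1 / z)) * (- (a * (1 / z) + b) / log_ratio t) * (1 / z)"
    proof -
      have "s / (H * (L * z ^ 4)) = - 1 / (z\<^sup>2 * H) * (- (s / z) / L) * (1 / z)" for s H L :: complex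
        by (simp add: power2_eq_square power4_eq_xxxx mult.commute mult.left_commute)
      moreover have "a * (1 / z) + b = (a + b * z) / z" using z(1) by (simp add: add_divide_distrib)
      ultimately show ?thesis unfolding h0 by metis
    qed
    then show ?thesis
      by (intro mat2_eqI) (simp_all add: matrix_mult_nth model_def)
  qed
  ultimately have c: "connection t ?X" unfolding connection_def poly_mat_def by blast
  have par: "par ?X = Q" by (simp add: model_def)
  have R: "(\<forall>v\<in>Q i. residue_at t ?X i *v v = 0) \<and> (\<forall>v. residue_at t ?X i *v v \<in> Q i)" for i
  proof -
    obtain k where k: "residue_at t ?X i = cscale k (at_point t i (conn ?X))"
      using residue_at_eq by metis
    consider "Q i = line2" | "Q i = line1" "t i = linear_zero a b" using assms(3) by blast
    then show ?thesis
    proof cases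
      case 1
      then show ?thesis
        by (auto simp: k C line2_iff matrix_vec_nth intro!: vec2_eqI)
    next
      case 2
      have "at_point t i (conn ?X) $ 2 $ 1 = 0"
        using off_diagonal_zero_iff[OF off_diagonal_model assms(2)] pt_loc 2(2) by (metis prod.collapse)
      then have "residue_at t ?X i = 0" unfolding k by (intro mat2_eqI) (simp_all add: C)
      then show ?thesis using 2(1) by (simp add: line1_iff)
    qed
  qed
  have Q: "vec.subspace (Q i) \<and> vec.dim (Q i) = 1" for i
    using assms(3)[of i] line_span[OF vec2_nonzero(1)[of 1 0]] line_span[OF vec2_nonzero(2)[of 1 0]] by auto
  then have "parabolic t ?X" using R unfolding parabolic_def par by blast
  then show "qp_connection t 1 ?X" using r c by (simp add: qp_connection_def)
  show "has_residues t (\<lambda>_ _. 0) ?X" using R unfolding has_residues_def par by simp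
qed

text \<open>Conjugation by diag(1, k) multiplies the lower left entry by \<open>k\<close> and fixes
  both coordinate axes. This normalises the section and also shows that models are fixed by the
  action.\<close>

lemma isomorphic_scaling:
  assumes "standard X" "standard Y" "lam X = 0" "lam Y = 0" "k \<noteq> 0"
    and "\<And>c x. conn X c x $ 1 $ 1 = 0" "\<And>c x. conn X c x $ 1 $ 2 = 0" "\<And>c x. conn X c x $ 2 $ 2 = 0"
    and "\<And>c x. conn Y c x = mat2 0 0 (k * conn X c x $ 2 $ 1) 0"
    and "\<And>i. par Y i = par X i" "\<And>i. par X i = line1 \<or> par X i = line2"
  shows "isomorphic t X Y"
proof -
  have "isomorphism t X Y (\<lambda>c x. mat2 1 0 0 k)"
  proof (rule isomorphismI)
    show "lam Y = lam X" by (simp add: assms(3,4))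
    show "poly_mat (\<lambda>x. mat2 1 0 0 k)" by (rule poly_matI) (simp_all add: poly_fun_const)
    show "det (mat2 1 0 0 k) \<noteq> 0" using assms(5) by (simp add: det_mat2)
    show "trans Y z ** mat2 1 0 0 k = mat2 1 0 0 k ** trans X z" if "z \<noteq> 0" for z
      using assms(1,2) that by (intro mat2_eqI) (simp_all add: standard_def matrix_mult_nth)
    show "cscale (lam X * log_den t c x) (mderiv (\<lambda>x. mat2 1 0 0 k) x) + conn Y c x ** mat2 1 0 0 k =
      mat2 1 0 0 k ** conn X c x" for c x
      by (intro mat2_eqI) (simp_all add: matrix_mult_nth assms)
    show "par Y i = (\<lambda>v. mat2 1 0 0 k *v v) ` par X i" for i
    proof -
      have "(\<lambda>v. mat2 1 0 0 k *v v) ` par X i = par X i"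
        using assms(11)[of i]
      proof
        assume "par X i = line1"
        then show ?thesis using diag_image_line1[of 1 k] by simp
      next
        assume "par X i = line2"
        then show ?thesis using diag_image_line2[OF assms(5), of 1] by simp
      qed
      then show ?thesis using assms(10)[of i] by simp
    qed
  qed
  then show ?thesis by (auto simp: isomorphic_def)
qed

lemma isomorphic_model:
  assumes "inj t" "standard Y" "lam Y = 0" "off_diagonal t Y a b" "(a, b) \<noteq> (0, 0)"
    and zero: "\<And>c x. conn Y c x $ 1 $ 1 = 0" "\<And>c x. conn Y c x $ 1 $ 2 = 0" "\<And>c x. conn Y c x $ 2 $ 2 = 0"
    and par: "\<And>i. par Y i = line1 \<or> par Y i = line2" "\<And>i. par Y i = line1 \<Longrightarrow> t i = linear_zero a b"
  obtains \<sigma> where "isomorphic t Y (fixed_model t \<sigma> (linear_zero a b))"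
proof -
  let ?p = "linear_zero a b"
  obtain \<sigma> where \<sigma>: "\<And>i. t i = ?p \<Longrightarrow> \<sigma> = Minus \<longleftrightarrow> par Y i = line1"
    using sign_exists[OF assms(1), of ?p "\<lambda>i. par Y i = line1"] by blast
  have lines: "par Y i = model_lines t \<sigma> ?p i" for i
    unfolding model_lines_def using par[of i] \<sigma>[of i] line1_neq_line2 by auto
  obtain a' b' where m: "fixed_model t \<sigma> ?p = model t a' b' (model_lines t \<sigma> ?p)" "(a', b') \<noteq> (0, 0)"
    "linear_zero a' b' = ?p"
    using fixed_model_cases by blast
  \<comment> \<open>Two nonzero sections of O(1) with the same zero are proportional; the zero at
    infinity is treated apart.\<close>
  obtain k where k: "k \<noteq> 0" "a' = k * a" "b' = k * b"
  proof (cases "b = 0")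
    case True
    then have "b' = 0" "a \<noteq> 0" "a' \<noteq> 0" using m assms(5) by (auto simp: linear_zero_def split: if_splits)
    then show ?thesis using that[of "a' / a"] True by simp
  next
    case False
    then have "b' \<noteq> 0" "a' / b' = a / b" using m by (auto simp: linear_zero_def split: if_splits)
    then show ?thesis using that[of "b' / b"] False by (simp add: field_simps)
  qed
  let ?M = "model t a' b' (model_lines t \<sigma> ?p)"
  have c21: "conn ?M c x $ 2 $ 1 = k * conn Y c x $ 2 $ 1" for c x
    using assms(4) k by (cases c) (simp_all add: model_def off_diagonal_def algebra_simps)
  have "isomorphic t Y ?M"
  proof (rule isomorphic_scaling[OF assms(2) standard_model assms(3) _ k(1) zero])
    show "conn ?M c x = mat2 0 0 (k * conn Y c x $ 2 $ 1) 0" for c x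
      using c21[of c x] by (intro mat2_eqI) (simp_all, simp_all add: model_def)
  qed (simp_all add: model_def lines[symmetric] par(1))
  then show ?thesis using that[of \<sigma>] m(1) by simp
qed

text \<open>The sign in \<open>model_lines\<close> is set up so that \<open>Upsilon\<close> returns
  the point a model came from; models at different points are therefore not isomorphic.\<close>

lemma Upsilon_fixed_model: "Upsilon t (fixed_model t \<sigma> p) = dpt t \<sigma> p"
proof -
  obtain a b where m: "fixed_model t \<sigma> p = model t a b (model_lines t \<sigma> p)" "(a, b) \<noteq> (0, 0)" "linear_zero a b = p"
    using fixed_model_cases by blast
  have "\<sigma> = Minus \<longleftrightarrow> par (model t a b (model_lines t \<sigma> p)) i = line1" if "t i = linear_zero a b" for i
    using that line1_neq_line2 by (auto simp: model_def model_lines_def m(3))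
  note * = this
  have "Upsilon t (model t a b (model_lines t \<sigma> p)) = dpt t \<sigma> (linear_zero a b)"
    by (rule Upsilon_standard[OF standard_model off_diagonal_model m(2) *])
  then show ?thesis by (simp add: m)
qed

section \<open>The action of the multiplicative group on objects and isomorphisms\<close>

lemma isomorphism_act:
  assumes "isomorphism t X Y \<phi>"
  shows "isomorphism t (act u X) (act u Y) \<phi>"
proof (rule isomorphismI)
  show "cscale (lam (act u X) * log_den t c x) (mderiv (\<phi> c) x) + conn (act u Y) c x ** \<phi> c x =
    \<phi> c x ** conn (act u X) c x" for c x
    using arg_cong[OF isomorphism_conn[OF assms, of c x], of "cscale u"]
    by (simp add: act_def mat_algebra mult.assoc)
qed (simp_all add: act_def isomorphism_lam[OF assms] isomorphism_poly[OF assms] isomorphism_det[OF assms]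
    isomorphism_trans[OF assms] isomorphism_par[OF assms])

lemma act_objects:
  assumes "X \<in> objects t d \<alpha> l \<rho>" "u \<noteq> 0"
  shows "act u X \<in> objects t d \<alpha> (u * l) (\<lambda>i \<sigma>. u * \<rho> i \<sigma>)"
proof -
  have X: "rank2_bundle d X" "connection t X" "parabolic t X" "lam X = l" "has_residues t \<rho> X" "semistable t d \<alpha> X"
    using assms(1) by (auto simp: objects_def qp_connection_def)
  have f: "lam (act u X) = u * l" "trans (act u X) = trans X" "par (act u X) = par X"
    "conn (act u X) c x = cscale u (conn X c x)" for c x
    using X(4) by (simp_all add: act_def)
  have 1: "rank2_bundle d (act u X)" using X(1) unfolding rank2_bundle_def f .
  have 2: "connection t (act u X)"
    unfolding connection_def f
  proof (intro conjI allI impI)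
    show "poly_fun (\<lambda>x. cscale u (conn X c x) $ i $ j)" for c i j
      using X(2) by (auto simp: connection_def intro!: poly_fun_intros)
    fix z assume "z \<noteq> 0 \<and> Fin z \<notin> range t"
    then have e: "trans X z ** cscale (1 / log_den t Chart0 z) (conn X Chart0 z) =
        cscale (lam X) (mderiv (trans X) z) +
        cscale (- 1 / (z\<^sup>2 * log_den t ChartInf (1 / z))) (conn X ChartInf (1 / z)) ** trans X z"
      using X(2) unfolding connection_def by blast
    show "trans X z ** cscale (1 / log_den t Chart0 z) (cscale u (conn X Chart0 z)) =
        cscale (u * l) (mderiv (trans X) z) +
        cscale (- 1 / (z\<^sup>2 * log_den t ChartInf (1 / z))) (cscale u (conn X ChartInf (1 / z))) ** trans X z"
      using arg_cong[OF e, of "cscale u"] by (simp add: mat_algebra X(4) mult.commute)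
  qed
  have R: "residue_at t (act u X) i *v v = u *s (residue_at t X i *v v)" for i v
  proof -
    obtain k where k: "\<And>X. residue_at t X i = cscale k (at_point t i (conn X))"
      using residue_at_eq by metis
    show ?thesis by (simp add: k f cscale_vec vector_smult_assoc mult.commute)
  qed
  have sub: "vec.subspace (par X i)" for i using X(3) by (simp add: parabolic_def)
  have 3: "parabolic t (act u X)"
    using X(3) vec.subspace_scale[OF sub] unfolding parabolic_def f R by blast
  have "u *s (residue_at t X i *v v) - (u * \<rho> i Plus) *s v \<in> par X i" for i v
  proof -
    have "u *s (residue_at t X i *v v - \<rho> i Plus *s v) \<in> par X i"
      using X(5) unfolding has_residues_def by (intro vec.subspace_scale[OF sub]) blast
    then show ?thesis by (simp add: vec.scale_right_diff_distrib vector_smult_assoc)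
  qed
  then have 4: "has_residues t (\<lambda>i \<sigma>. u * \<rho> i \<sigma>) (act u X)"
    using X(5) unfolding has_residues_def f R by (simp add: vector_smult_assoc)
  have "nabla t (act u X) c g x = u *s nabla t X c g x" for c g x
    unfolding nabla_def f by (simp add: cscale_vec vec.scale_right_distrib vector_smult_assoc X(4) mult.assoc)
  moreover have "u *s w \<in> vec.span {y} \<longleftrightarrow> w \<in> vec.span {y}" for w y :: "complex^2"
  proof
    assume "u *s w \<in> vec.span {y}"
    then have "(1 / u) *s (u *s w) \<in> vec.span {y}" by (rule vec.span_scale)
    then show "w \<in> vec.span {y}" using assms(2) by (simp add: vector_smult_assoc)
  qed (rule vec.span_scale)
  ultimately have "invariant t (act u X) g \<longleftrightarrow> invariant t X g" for g
    by (simp add: invariant_def)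
  then have 5: "semistable t d \<alpha> (act u X)"
    using X(6) unfolding semistable_def pardeg_sub_def line_subbundle_def f by simp
  show ?thesis using 1 2 3 4 5 f by (simp add: objects_def qp_connection_def)
qed

section \<open>The map from the points of \<open>\<P>\<close> to the fixed points\<close>

text \<open>All representatives of \<open>q\<close> give the same model, so the existential is
  harmless; the restriction to \<open>higgs_bundles\<close> makes the value an equivalence class in
  the sense of \<open>higgs_points\<close>.\<close>

definition fixed_class :: "(4 \<Rightarrow> p1) \<Rightarrow> (4 \<Rightarrow> psign \<Rightarrow> real) \<Rightarrow> dpoint \<Rightarrow> lconn set" where
  "fixed_class t \<alpha> q = {X \<in> higgs_bundles t 1 \<alpha>. \<exists>\<sigma> p. q = dpt t \<sigma> p \<and> isomorphic t (fixed_model t \<sigma> p) X}"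

lemma fixed_class_dpt:
  "fixed_class t \<alpha> (dpt t \<sigma> p) = {X \<in> higgs_bundles t 1 \<alpha>. isomorphic t (fixed_model t \<sigma> p) X}"
proof -
  have "isomorphic t (fixed_model t \<sigma> p) X" if "dpt t \<sigma> p = dpt t \<tau> q" "isomorphic t (fixed_model t \<tau> q) X" for \<tau> q X
    using fixed_model_cong[OF that(1)] that(2) by simp
  then show ?thesis unfolding fixed_class_def by blast
qed

lemma dpoints_eq: "dpoints t = {dpt t \<sigma> p | \<sigma> p. True}"
proof -
  have "dpoints t = {glue t `` {(p, \<sigma>)} | \<sigma> p. True}" unfolding dpoints_def quotient_def by auto
  then show ?thesis unfolding dpt_def .
qed

lemma standard_act: "standard (act u X) \<longleftrightarrow> standard X"
  by (simp add: standard_def act_def)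

lemma isomorphic_act: "isomorphic t X Y \<Longrightarrow> isomorphic t (act u X) (act u Y)"
  unfolding isomorphic_def using isomorphism_act by blast

lemma act_fixed_model:
  assumes "u \<noteq> 0"
  shows "isomorphic t (fixed_model t \<sigma> p) (act u (fixed_model t \<sigma> p))"
proof -
  obtain a b where m: "fixed_model t \<sigma> p = model t a b (model_lines t \<sigma> p)"
    using fixed_model_cases by blast
  show ?thesis unfolding m
    by (rule isomorphic_scaling[OF standard_model standard_model[THEN standard_act[THEN iffD2]] _ _ assms])
      (auto simp: act_def model_def model_lines_def intro!: mat2_eqI)
qed

lemma act_higgs:
  assumes "X \<in> higgs_bundles t d \<alpha>" "u \<noteq> 0"
  shows "act u X \<in> higgs_bundles t d \<alpha>"
  using act_objects[of X t d \<alpha> 0 "\<lambda>_ _. 0" u] assms by (simp add: higgs_bundles_def)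

lemma objectsD:
  assumes "X \<in> objects t d \<alpha> l \<rho>"
  shows "rank2_bundle d X" "connection t X" "parabolic t X" "quasiparabolic X" "lam X = l" "has_residues t \<rho> X"
    "semistable t d \<alpha> X"
  using assms parabolic_quasiparabolic by (auto simp: objects_def qp_connection_def)

lemma standard_higgs_class:
  assumes "inj t" "X \<in> higgs_bundles t d \<alpha>" "standard X" "off_diagonal t X a b" "(a, b) \<noteq> (0, 0)"
    and "\<And>c x. conn X c x $ 1 $ 1 = 0" "\<And>c x. conn X c x $ 1 $ 2 = 0" "\<And>c x. conn X c x $ 2 $ 2 = 0"
    and "\<And>i. par X i = line1 \<or> par X i = line2"
  shows "\<exists>\<sigma>. isomorphic t (fixed_model t \<sigma> (linear_zero a b)) X"
proof -
  note X = objectsD[OF assms(2)[unfolded higgs_bundles_def]]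
  obtain \<sigma> where "isomorphic t X (fixed_model t \<sigma> (linear_zero a b))"
    using isomorphic_model[OF assms(1,3) X(5) assms(4-9) residue_line1[OF X(3) assms(4,5)]] by blast
  then show ?thesis using isomorphic_sym by blast
qed

text \<open>The action does not change parabolic lines, so each is preserved by a diagonal matrix
  with distinct eigenvalues 2q and q, and is thus a coordinate axis.\<close>

lemma isomorphism_2_eigenlines:
  assumes "quasiparabolic X" "isomorphism t (act 2 X) X (\<lambda>c x. mat2 (2 * q) 0 0 q)" "q \<noteq> 0"
  shows "par X i = line1 \<or> par X i = line2"
proof -
  obtain v where v: "v \<noteq> 0" "par X i = vec.span {v}" using quasiparabolic_line[OF assms(1)] by blast
  have "par X i = (\<lambda>v. mat2 (2 * q) 0 0 q *v v) ` par X i"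
    using isomorphism_par[OF assms(2), of i] by (simp add: act_def)
  moreover have "v \<in> par X i" unfolding v(2) by (simp add: vec.span_base)
  ultimately have "mat2 (2 * q) 0 0 q *v v \<in> vec.span {v}" unfolding v(2)[symmetric] by blast
  then have "v $ 1 * v $ 2 = 0" using v(1) assms(3) by (simp add: span_singleton_iff matrix_vec_nth)
  then consider "v $ 2 = 0" | "v $ 1 = 0" by auto
  then show ?thesis
  proof cases
    case 1
    then have "v \<in> line1" by (simp add: line1_iff)
    then show ?thesis using span_singleton_eq[of v "vec2 1 0"] v by simp
  next
    case 2
    then have "v \<in> line2" by (simp add: line2_iff)
    then show ?thesis using span_singleton_eq[of v "vec2 0 1"] v by simp
  qed
qed

text \<open>An isomorphism \<open>u \<cdot> X \<cong> X\<close> for \<open>u = 2\<close> has eigenvalues \<open>2q\<close> and \<open>q\<close>; the change of frame \<open>\<psi>\<close> diagonalises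
  it and exhibits \<open>X\<close> as a system of Hodge bundles.\<close>

lemma standard_fixed_diagonal:
  assumes X: "standard X" "lam X = 0" "off_diagonal t X a b" "(a, b) \<noteq> (0, 0)"
    and iso: "isomorphism t (act 2 X) X \<phi>"
  shows "\<exists>Y \<psi> q. isomorphism t X Y \<psi> \<and> standard Y \<and> q \<noteq> 0 \<and> isomorphism t (act 2 Y) Y (\<lambda>c x. mat2 (2 * q) 0 0 q)"
proof -
  have sX: "standard (act 2 X)" using X(1) by (simp add: standard_act)
  obtain p q s where \<phi>': "\<forall>c x. \<phi> c x = mat2 p (s c x) 0 q" "\<forall>c. poly_fun (s c)"
    "\<forall>z. z \<noteq> 0 \<longrightarrow> s Chart0 z = z * s ChartInf (1 / z)"
    using standard_morphism[OF isomorphism_imp_morphism[OF iso] sX X(1)] by (elim exE conjE) (rule that)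
  note \<phi> = \<phi>'[rule_format]
  have "p * q \<noteq> 0" using isomorphism_det[OF iso, of Chart0 0] by (simp add: \<phi>(1) det_mat2)
  then have q: "q \<noteq> 0" by simp
  obtain x where x: "conn X Chart0 x $ 2 $ 1 \<noteq> 0" using off_diagonal_nonzero[OF X(3,4)] .
  have "conn X Chart0 x ** \<phi> Chart0 x = \<phi> Chart0 x ** conn (act 2 X) Chart0 x"
    using isomorphism_conn[OF iso, of Chart0 x] X(2) by (simp add: act_def cscale_0)
  then have "(conn X Chart0 x ** \<phi> Chart0 x) $ 2 $ 1 = (\<phi> Chart0 x ** conn (act 2 X) Chart0 x) $ 2 $ 1" by simp
  \<comment> \<open>The action doubles the nonzero lower left entry, which fixes the ratio of the
    eigenvalues.\<close>
  then have p: "p = 2 * q" using x by (simp add: matrix_mult_nth \<phi>(1) act_def)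
  \<comment> \<open>A unipotent matrix with upper right entry s / (p - q) = s / q conjugates
    \<open>\<phi>\<close> to its diagonal. As \<open>s\<close> is a section of O(1), this change of
    frame keeps the standard transition matrix.\<close>
  define \<psi> where "\<psi> c x = mat2 1 (s c x / q) 0 1" for c x
  have det\<psi>: "det (\<psi> c x) \<noteq> 0" for c x by (simp add: \<psi>_def det_mat2)
  have inv\<psi>: "inv2 (\<psi> c x) = mat2 1 (- s c x / q) 0 1" for c x
    by (rule mat2_eqI) (simp_all add: inv2_def \<psi>_def det_mat2)
  have "poly_mat (\<psi> c)" for c
    by (rule poly_matI) (simp_all add: \<psi>_def poly_fun_const poly_fun_divide_const \<phi>(2))
  note iso\<psi> = isomorphism_gauge[of \<psi> t X, OF this det\<psi>]
  define Y where "Y = gauge t \<psi> X"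
  have "trans Y z = mat2 (1 / z) 0 0 1" if "z \<noteq> 0" for z
  proof -
    have "trans X z = mat2 (1 / z) 0 0 1" using X(1) that by (simp add: standard_def)
    then have "trans Y z = \<psi> ChartInf (1 / z) ** mat2 (1 / z) 0 0 1 ** inv2 (\<psi> Chart0 z)"
      by (simp add: Y_def gauge_def)
    also have "\<dots> = mat2 (1 / z) 0 0 1"
      using that \<phi>(3)[OF that] unfolding inv\<psi> by (intro mat2_eqI) (simp_all add: matrix_mult_nth \<psi>_def)
    finally show ?thesis .
  qed
  then have "standard Y" by (simp add: standard_def)
  moreover have "isomorphism t (act 2 Y) Y (\<lambda>c x. mat2 (2 * q) 0 0 q)"
  proof -
    have "isomorphism t (act 2 Y) Y (\<lambda>c x. \<psi> c x ** (\<phi> c x ** inv2 (\<psi> c x)))"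
      unfolding Y_def
      by (rule isomorphism_comp[OF isomorphism_comp[OF isomorphism_sym[OF isomorphism_act[OF iso\<psi>]] iso] iso\<psi>])
    moreover have "\<psi> c x ** (\<phi> c x ** inv2 (\<psi> c x)) = mat2 (2 * q) 0 0 q" for c x
      using q unfolding inv\<psi> \<phi>(1) p by (intro mat2_eqI) (simp_all add: matrix_mult_nth \<psi>_def field_simps)
    ultimately show ?thesis by simp
  qed
  ultimately show ?thesis using iso\<psi> q unfolding Y_def by blast
qed

context
  fixes t :: "4 \<Rightarrow> p1" and \<alpha> :: "4 \<Rightarrow> psign \<Rightarrow> real"
  assumes inj: "inj t" and weights: "weights \<alpha>"
    and unstable_zone: "(\<Sum>i\<in>UNIV. (\<alpha> i Plus - \<alpha> i Minus) / 2) < 1 / 2"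
begin

lemma object_standard_form:
  assumes "X \<in> objects t 1 \<alpha> l \<rho>"
  shows "\<exists>Y \<phi> a b. isomorphism t X Y \<phi> \<and> Y \<in> objects t 1 \<alpha> l \<rho> \<and> standard Y \<and> off_diagonal t Y a b \<and> (a, b) \<noteq> (0, 0)"
proof -
  note X = objectsD[OF assms]
  have "\<And>f n. line_subbundle X f n \<Longrightarrow> invariant t X f \<Longrightarrow> n \<le> 0"
    using X(7) semistable_iff[OF weights unstable_zone] by blast
  then obtain Y \<phi> a b where Y: "isomorphism t X Y \<phi>" "standard Y" "off_diagonal t Y a b" "(a, b) \<noteq> (0, 0)"
    by (rule standard_form[OF inj X(1,2)])
  then show ?thesis using objects_isomorphism[OF Y(1) assms] by blast
qed

lemma standard_object_nonzero:
  assumes "X \<in> objects t 1 \<alpha> l \<rho>" "standard X" "off_diagonal t X a b"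
  shows "(a, b) \<noteq> (0, 0)"
  using standard_stable_nonzero[OF assms(2,3)] objectsD(7)[OF assms(1)]
    semistable_iff[OF weights unstable_zone] by blast

lemma model_higgs:
  assumes "(a, b) \<noteq> (0, 0)" "\<And>i. Q i = line2 \<or> Q i = line1 \<and> t i = linear_zero a b"
  shows "model t a b Q \<in> higgs_bundles t 1 \<alpha>"
proof -
  have "semistable t 1 \<alpha> (model t a b Q)"
    unfolding semistable_iff[OF weights unstable_zone]
    using standard_not_invariant[OF standard_model off_diagonal_model assms(1)] by blast
  moreover have "lam (model t a b Q) = 0" by (simp add: model_def)
  ultimately show ?thesis
    using model_qp_connection[OF inj assms] by (simp add: higgs_bundles_def objects_def)
qed

lemma fixed_model_higgs: "fixed_model t \<sigma> p \<in> higgs_bundles t 1 \<alpha>"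
proof -
  obtain a b where m: "fixed_model t \<sigma> p = model t a b (model_lines t \<sigma> p)" "(a, b) \<noteq> (0, 0)" "linear_zero a b = p"
    using fixed_model_cases by blast
  show ?thesis unfolding m(1) by (rule model_higgs[OF m(2)]) (auto simp: model_lines_def m(3))
qed

lemma fixed_model_in_class: "fixed_model t \<sigma> p \<in> fixed_class t \<alpha> (dpt t \<sigma> p)"
  by (simp add: fixed_class_dpt fixed_model_higgs isomorphic_refl)

lemma fixed_higgs:
  assumes "X \<in> higgs_bundles t 1 \<alpha>" "isomorphic t (act 2 X) X"
  shows "\<exists>\<sigma> p. isomorphic t (fixed_model t \<sigma> p) X"
proof -
  obtain Y \<phi> a b where Y: "isomorphism t X Y \<phi>" "Y \<in> higgs_bundles t 1 \<alpha>" "standard Y" "off_diagonal t Y a b"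
      "(a, b) \<noteq> (0, 0)"
    using object_standard_form[OF assms(1)[unfolded higgs_bundles_def], folded higgs_bundles_def]
    by (elim exE conjE) (rule that)
  have XY: "isomorphic t X Y" using Y(1) by (auto simp: isomorphic_def)
  have "isomorphic t (act 2 Y) Y"
    using isomorphic_trans[OF isomorphic_act[OF isomorphic_sym[OF XY]] isomorphic_trans[OF assms(2) XY]] .
  then obtain \<omega> where \<omega>: "isomorphism t (act 2 Y) Y \<omega>" by (auto simp: isomorphic_def)
  have lY: "lam Y = 0" using Y(2) by (simp add: higgs_bundles_def objects_def)
  obtain Z \<psi> q where Z: "isomorphism t Y Z \<psi>" "standard Z" "q \<noteq> 0"
      "isomorphism t (act 2 Z) Z (\<lambda>c x. mat2 (2 * q) 0 0 q)"
    using standard_fixed_diagonal[OF Y(3) lY Y(4,5) \<omega>] by (elim exE conjE) (rule that)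
  have Zh: "Z \<in> objects t 1 \<alpha> 0 (\<lambda>_ _. 0)"
    using objects_isomorphism[OF Z(1)] Y(2) by (simp add: higgs_bundles_def)
  note Zo = objectsD[OF Zh]
  obtain a' b' where ab: "off_diagonal t Z a' b'" using standard_off_diagonal[OF inj Zo(2) Z(2)] .
  have ab0: "(a', b') \<noteq> (0, 0)" using standard_object_nonzero[OF Zh Z(2) ab] .
  \<comment> \<open>In \<open>B ** D = D ** (2 B)\<close> with D = diag(2q, q), the entries 11, 12,
    22 of B are multiplied by 2q, q, q on the left but by 4q, 4q, 2q on the right; only the lower
    left entry, with 2q on both sides, can survive.\<close>
  have zero: "conn Z c x $ 1 $ 1 = 0 \<and> conn Z c x $ 1 $ 2 = 0 \<and> conn Z c x $ 2 $ 2 = 0" for c x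
  proof -
    have "conn Z c x ** mat2 (2 * q) 0 0 q = mat2 (2 * q) 0 0 q ** conn (act 2 Z) c x"
      using isomorphism_conn[OF Z(4), of c x] Zo(5) by (simp add: act_def cscale_0)
    then have "(conn Z c x ** mat2 (2 * q) 0 0 q) $ i $ j = (mat2 (2 * q) 0 0 q ** conn (act 2 Z) c x) $ i $ j" for i j
      by simp
    from this[of 1 1] this[of 1 2] this[of 2 2] show ?thesis
      using Z(3) by (simp add: matrix_mult_nth act_def)
  qed
  obtain \<sigma> where "isomorphic t (fixed_model t \<sigma> (linear_zero a' b')) Z"
    using standard_higgs_class[OF inj Zh[folded higgs_bundles_def] Z(2) ab ab0 _ _ _
      isomorphism_2_eigenlines[OF Zo(4) Z(4,3)]] zero by blast
  moreover have "isomorphic t Z X"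
    using isomorphic_sym[OF isomorphic_trans[OF XY]] Z(1) by (auto simp: isomorphic_def)
  ultimately show ?thesis using isomorphic_trans by blast
qed

lemma higgs_class_eq:
  "X \<in> higgs_bundles t 1 \<alpha> \<Longrightarrow>
    {(X, Y). X \<in> higgs_bundles t 1 \<alpha> \<and> Y \<in> higgs_bundles t 1 \<alpha> \<and> isomorphic t X Y} `` {X} =
    {Y \<in> higgs_bundles t 1 \<alpha>. isomorphic t X Y}"
  by auto

lemma fixed_class_fixed: "fixed_class t \<alpha> (dpt t \<sigma> p) \<in> fixed_points t 1 \<alpha>"
proof -
  let ?R = "{(X, Y). X \<in> higgs_bundles t 1 \<alpha> \<and> Y \<in> higgs_bundles t 1 \<alpha> \<and> isomorphic t X Y}"
  let ?H = "fixed_model t \<sigma> p"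
  have "fixed_class t \<alpha> (dpt t \<sigma> p) = ?R `` {?H}"
    unfolding higgs_class_eq[OF fixed_model_higgs] fixed_class_dpt ..
  then have "fixed_class t \<alpha> (dpt t \<sigma> p) \<in> higgs_points t 1 \<alpha>"
    unfolding higgs_points_def using quotientI[OF fixed_model_higgs, of ?R \<sigma> p] by simp
  moreover have "act u X \<in> fixed_class t \<alpha> (dpt t \<sigma> p)" if "X \<in> fixed_class t \<alpha> (dpt t \<sigma> p)" "u \<noteq> 0" for X u
  proof -
    have X: "X \<in> higgs_bundles t 1 \<alpha>" "isomorphic t ?H X" using that(1) by (auto simp: fixed_class_dpt)
    have "isomorphic t ?H (act u X)"
      using isomorphic_trans[OF act_fixed_model[OF that(2)] isomorphic_act[OF X(2)]] .
    then show ?thesis using act_higgs[OF X(1) that(2)] by (simp add: fixed_class_dpt)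
  qed
  ultimately show ?thesis unfolding fixed_points_def by blast
qed

lemma fixed_class_surj:
  assumes "C \<in> fixed_points t 1 \<alpha>"
  shows "\<exists>\<sigma> p. C = fixed_class t \<alpha> (dpt t \<sigma> p)"
proof -
  let ?R = "{(X, Y). X \<in> higgs_bundles t 1 \<alpha> \<and> Y \<in> higgs_bundles t 1 \<alpha> \<and> isomorphic t X Y}"
  have "C \<in> higgs_bundles t 1 \<alpha> // ?R" using assms by (simp add: fixed_points_def higgs_points_def)
  then obtain X where X: "X \<in> higgs_bundles t 1 \<alpha>" "C = ?R `` {X}" by (rule quotientE)
  then have C: "C = {Y \<in> higgs_bundles t 1 \<alpha>. isomorphic t X Y}" using higgs_class_eq by simp
  then have "X \<in> C" using X(1) isomorphic_refl by blast
  moreover have "(2 :: complex) \<noteq> 0" by simp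
  ultimately have "act 2 X \<in> C" using assms unfolding fixed_points_def by blast
  then have "isomorphic t (act 2 X) X" using C isomorphic_sym by blast
  then obtain \<sigma> p where h: "isomorphic t (fixed_model t \<sigma> p) X" using fixed_higgs[OF X(1)] by blast
  have "isomorphic t (fixed_model t \<sigma> p) Y \<longleftrightarrow> isomorphic t X Y" for Y
    using isomorphic_trans[OF h] isomorphic_trans[OF isomorphic_sym[OF h]] by blast
  then have "C = fixed_class t \<alpha> (dpt t \<sigma> p)" unfolding C fixed_class_dpt by simp
  then show ?thesis by blast
qed

text \<open>\<open>Upsilon\<close> recovers the point from any bundle in its class, which gives
  injectivity; the diagonalisation of an isomorphism from \<open>act 2 X\<close> to \<open>X\<close>
  gives surjectivity.\<close>

lemma fixed_class_bij: "bij_betw (fixed_class t \<alpha>) (dpoints t) (fixed_points t 1 \<alpha>)"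
proof (rule bij_betw_imageI)
  show "inj_on (fixed_class t \<alpha>) (dpoints t)"
  proof (rule inj_onI)
    fix q q' assume "q \<in> dpoints t" "q' \<in> dpoints t" and eq: "fixed_class t \<alpha> q = fixed_class t \<alpha> q'"
    then obtain \<sigma> p \<tau> p' where q: "q = dpt t \<sigma> p" "q' = dpt t \<tau> p'" unfolding dpoints_eq by blast
    have "fixed_model t \<sigma> p \<in> fixed_class t \<alpha> (dpt t \<tau> p')"
      using fixed_model_in_class[of \<sigma> p] eq q by simp
    then have "isomorphic t (fixed_model t \<tau> p') (fixed_model t \<sigma> p)" by (simp add: fixed_class_dpt)
    then show "q = q'" using Upsilon_isomorphic q by (metis Upsilon_fixed_model)
  qed
  show "fixed_class t \<alpha> ` dpoints t = fixed_points t 1 \<alpha>"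
  proof (intro equalityI subsetI)
    fix C assume "C \<in> fixed_class t \<alpha> ` dpoints t"
    then show "C \<in> fixed_points t 1 \<alpha>" using fixed_class_fixed unfolding dpoints_eq by blast
  next
    fix C assume "C \<in> fixed_points t 1 \<alpha>"
    then show "C \<in> fixed_class t \<alpha> ` dpoints t" using fixed_class_surj[of C] unfolding dpoints_eq by blast
  qed
qed

end

section \<open>Regular functions in families\<close>

text \<open>A polynomial in \<open>s\<close> and \<open>x\<close> is written as an element of \<open>\<complex>[s][x]\<close>.\<close>

definition eval2 :: "complex poly poly \<Rightarrow> complex \<Rightarrow> complex \<Rightarrow> complex" where
  "eval2 p s x = poly (poly p [:x:]) s"

lemma eval2_map: "eval2 p s x = poly (map_poly (\<lambda>c. poly c s) p) x"
  unfolding eval2_def by (induction p) (simp_all add: map_poly_pCons)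

lemma eval2_lift: "eval2 (map_poly (\<lambda>c. [:c:]) p) s x = poly p x"
  unfolding eval2_def by (induction p) (simp_all add: map_poly_pCons)

lemma eval2_mult: "eval2 (p * q) s x = eval2 p s x * eval2 q s x"
  and eval2_add: "eval2 (p + q) s x = eval2 p s x + eval2 q s x"
  and eval2_smult: "eval2 (smult c p) s x = poly c s * eval2 p s x"
  and eval2_const: "eval2 [:c:] s x = poly c s"
  by (simp_all add: eval2_def)

lemma eval2_has_derivative:
  "((\<lambda>y. eval2 p s y) has_field_derivative eval2 (pderiv p) s x) (at x)"
proof (induction p)
  case 0
  then show ?case by (simp add: eval2_def)
next
  case (pCons a p)
  have "((\<lambda>y. poly a s + y * eval2 p s y) has_field_derivative eval2 p s x + x * eval2 (pderiv p) s x) (at x)"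
    by (rule derivative_eq_intros pCons refl | simp)+
  then show ?case by (simp add: eval2_def pderiv_pCons)
qed

lemma eval2_continuous: "isCont (\<lambda>s. eval2 p s x) s0" "isCont (eval2 p s) x0"
  unfolding eval2_def[abs_def] using poly_isCont apply blast
  using eval2_has_derivative DERIV_isCont unfolding eval2_def by blast

lemma regular_line_eval2:
  "regular_line S f \<longleftrightarrow> (\<exists>p q. \<forall>s\<in>S. poly q s \<noteq> 0 \<and> (\<forall>x. f s x = eval2 p s x / poly q s))"
  by (simp add: regular_line_def eval2_def)

lemma regular_line_poly:
  assumes "poly_fun g" shows "regular_line S (\<lambda>s x. g x)"
proof -
  obtain p where p: "g = poly p" using assms by (auto simp: poly_fun_def)
  show ?thesis unfolding regular_line_eval2
    by (intro exI[of _ "map_poly (\<lambda>c. [:c:]) p"] exI[of _ 1]) (simp add: eval2_lift p)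
qed

lemma regular_line_param: "regular_line S (\<lambda>s x. s)"
  unfolding regular_line_eval2 by (intro exI[of _ "[:[:0, 1:]:]"] exI[of _ 1]) (simp add: eval2_const)

lemma regular_line_inverse_param: "regular_line (- {0}) (\<lambda>s x. 1 / s)"
  unfolding regular_line_eval2 by (intro exI[of _ 1] exI[of _ "[:0, 1:]"]) (simp add: eval2_def)

lemma regular_line_add:
  assumes "regular_line S f" "regular_line S g" shows "regular_line S (\<lambda>s x. f s x + g s x)"
proof -
  obtain p q where f: "\<And>s. s \<in> S \<Longrightarrow> poly q s \<noteq> 0 \<and> (\<forall>x. f s x = eval2 p s x / poly q s)"
    using assms(1) unfolding regular_line_eval2 by blast
  obtain p' q' where g: "\<And>s. s \<in> S \<Longrightarrow> poly q' s \<noteq> 0 \<and> (\<forall>x. g s x = eval2 p' s x / poly q' s)"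
    using assms(2) unfolding regular_line_eval2 by blast
  show ?thesis unfolding regular_line_eval2
    by (intro exI[of _ "smult q' p + smult q p'"] exI[of _ "q * q'"])
      (simp add: f g eval2_add eval2_smult add_divide_distrib)
qed

lemma regular_line_mult:
  assumes "regular_line S f" "regular_line S g" shows "regular_line S (\<lambda>s x. f s x * g s x)"
proof -
  obtain p q where f: "\<And>s. s \<in> S \<Longrightarrow> poly q s \<noteq> 0 \<and> (\<forall>x. f s x = eval2 p s x / poly q s)"
    using assms(1) unfolding regular_line_eval2 by blast
  obtain p' q' where g: "\<And>s. s \<in> S \<Longrightarrow> poly q' s \<noteq> 0 \<and> (\<forall>x. g s x = eval2 p' s x / poly q' s)"
    using assms(2) unfolding regular_line_eval2 by blast
  show ?thesis unfolding regular_line_eval2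
    by (intro exI[of _ "p * p'"] exI[of _ "q * q'"]) (simp add: f g eval2_mult)
qed

lemma regular_line_matrix_mult:
  fixes A B :: "complex \<Rightarrow> complex \<Rightarrow> complex^2^2"
  assumes "\<And>i j. regular_line S (\<lambda>s x. A s x $ i $ j)" "\<And>i j. regular_line S (\<lambda>s x. B s x $ i $ j)"
  shows "regular_line S (\<lambda>s x. (A s x ** B s x) $ i $ j)"
  unfolding matrix_mult_nth by (intro regular_line_add regular_line_mult assms)

lemma regular_base_const: "regular_base S (\<lambda>s. c)"
  unfolding regular_base_def by (intro exI[of _ "[:c:]"] exI[of _ 1]) simp

lemma regular_base_linear: "regular_base S (\<lambda>s. s * c)"
  unfolding regular_base_def by (intro exI[of _ "[:0, c:]"] exI[of _ 1]) (simp add: mult.commute)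

lemma regular_punctured_const:
  assumes "laurent_fun g" shows "regular_punctured S (\<lambda>s. g)"
proof -
  obtain p n where p: "\<forall>x. x \<noteq> 0 \<longrightarrow> g x = poly p x / x ^ n" using assms unfolding laurent_fun_def by blast
  have "poly (poly (map_poly (\<lambda>c. [:c:]) p) [:z:]) s = poly p z" for s z
    using eval2_lift by (simp add: eval2_def)
  then show ?thesis unfolding regular_punctured_def
    by (intro exI[of _ "map_poly (\<lambda>c. [:c:]) p"] exI[of _ 1] exI[of _ n]) (simp add: p)
qed

lemma regular_punctured_standard:
  "regular_punctured S (\<lambda>s z. mat2 (1 / z) 0 0 1 $ i $ j)"
proof -
  have "laurent_fun (\<lambda>z. 1 / z)" using laurent_fun_reciprocal[OF poly_fun_id] by simp
  then have "\<forall>i j. regular_punctured S (\<lambda>s z. mat2 (1 / z) 0 0 1 $ i $ j)"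
    unfolding forall_2 by (simp add: regular_punctured_const laurent_poly poly_fun_const)
  then show ?thesis by blast
qed

lemma isCont_poly_quotient:
  fixes q :: "complex poly"
  assumes "\<And>s. poly q s \<noteq> 0" "isCont p s0"
  shows "isCont (\<lambda>s. p s / poly q s) s0"
  using assms by (intro continuous_intros) auto

lemma regular_base_continuous:
  assumes "regular_base UNIV f" shows "isCont f s"
proof -
  obtain p q where "\<And>s. poly q s \<noteq> 0 \<and> f s = poly p s / poly q s"
    using assms unfolding regular_base_def by blast
  then have "f = (\<lambda>s. poly p s / poly q s)" "\<And>s. poly q s \<noteq> 0" by auto
  then show ?thesis by (simp add: isCont_poly_quotient)
qed

lemma regular_line_continuous:
  assumes "regular_line UNIV f" shows "isCont (\<lambda>s. f s x) s0"
proof -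
  obtain p q where "\<And>s. poly q s \<noteq> 0 \<and> (\<forall>x. f s x = eval2 p s x / poly q s)"
    using assms unfolding regular_line_eval2 by blast
  then have "(\<lambda>s. f s x) = (\<lambda>s. eval2 p s x / poly q s)" "\<And>s. poly q s \<noteq> 0" by auto
  then show ?thesis by (simp add: isCont_poly_quotient eval2_continuous)
qed

lemma regular_punctured_continuous:
  assumes "regular_punctured UNIV f" "z \<noteq> 0" shows "isCont (\<lambda>s. f s z) s0"
proof -
  obtain p q n where "\<And>s. poly q s \<noteq> 0 \<and> (\<forall>z. z \<noteq> 0 \<longrightarrow> f s z = eval2 p s z / (poly q s * z ^ n))"
    using assms unfolding regular_punctured_def eval2_def by blast
  then have "(\<lambda>s. f s z) = (\<lambda>s. (eval2 p s z / z ^ n) / poly q s)" "\<And>s. poly q s \<noteq> 0"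
    using assms(2) by (auto simp: mult.commute)
  then show ?thesis
    using isCont_poly_quotient[of q s0 "\<lambda>s. eval2 p s z / z ^ n"] eval2_continuous(1)[where p = p and x = z] assms(2)
    by (simp add: continuous_divide)
qed

text \<open>The means of passing to special fibres: an identity between continuous entries that
  holds off one parameter value holds there too.\<close>

lemma isCont_eq_limit:
  fixes f g :: "complex \<Rightarrow> complex"
  assumes "isCont f a" "isCont g a" "\<And>s. s \<noteq> a \<Longrightarrow> f s = g s"
  shows "f a = g a"
proof -
  have "f \<midarrow>a\<rightarrow> f a" "g \<midarrow>a\<rightarrow> g a" using assms(1,2) by (simp_all add: isCont_def)
  moreover have "f \<midarrow>a\<rightarrow> g a \<longleftrightarrow> g \<midarrow>a\<rightarrow> g a" by (rule LIM_equal) (use assms(3) in auto)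
  ultimately show ?thesis using LIM_unique by blast
qed

section \<open>Constructibility\<close>

lemma algebraic_family_model:
  assumes "regular_line S (\<lambda>s x. f s)" "regular_line S (\<lambda>s x. g s)" "\<And>i. Q i = line1 \<or> Q i = line2"
  shows "algebraic_family S (\<lambda>s. model t (f s) (g s) Q)"
proof -
  have 1: "regular_base S (\<lambda>s. lam (model t (f s) (g s) Q))" by (simp add: model_def regular_base_const)
  have 2: "regular_punctured S (\<lambda>s z. trans (model t (f s) (g s) Q) z $ i $ j)" for i j
    using regular_punctured_standard by (simp add: model_def)
  have "regular_line S (\<lambda>s x. f s + g s * x)"
    by (intro regular_line_add regular_line_mult assms regular_line_poly poly_fun_id)
  moreover have "regular_line S (\<lambda>s x. (f s * x + g s) * (- 1 / log_ratio t))"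
    by (intro regular_line_add regular_line_mult assms regular_line_poly poly_fun_id poly_fun_const)
  moreover have "(\<lambda>s x. (f s * x + g s) * (- 1 / log_ratio t)) = (\<lambda>s x. (- (f s * x) - g s) / log_ratio t)"
    by (intro ext) (simp add: diff_divide_distrib add_divide_distrib)
  ultimately have "regular_line S (\<lambda>s x. f s + g s * x)" "regular_line S (\<lambda>s x. (- (f s * x) - g s) / log_ratio t)"
    by simp_all
  moreover have "regular_line S (\<lambda>s x. 0)" by (intro regular_line_poly poly_fun_const)
  ultimately have "\<forall>i j. regular_line S (\<lambda>s x. conn (model t (f s) (g s) Q) c x $ i $ j)" for c
    unfolding forall_2 by (cases c) (simp_all add: model_def)
  then have 3: "regular_line S (\<lambda>s x. conn (model t (f s) (g s) Q) c x $ i $ j)" for c i j by blast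
  have 4: "\<exists>v. (\<forall>j. regular_base S (\<lambda>s. v s $ j)) \<and>
        (\<forall>s\<in>S. v s \<noteq> 0 \<and> par (model t (f s) (g s) Q) i = vec.span {v s})" for i
    using assms(3)[of i]
  proof
    assume "Q i = line1"
    then show ?thesis
      by (intro exI[of _ "\<lambda>_. vec2 1 0"]) (simp add: model_def vec2_nonzero regular_base_const)
  next
    assume "Q i = line2"
    then show ?thesis
      by (intro exI[of _ "\<lambda>_. vec2 0 1"]) (simp add: model_def vec2_nonzero regular_base_const)
  qed
  show ?thesis unfolding algebraic_family_def by (intro conjI allI 1 2 3 4)
qed

lemma model_lines_cases: "model_lines t \<sigma> p i = line1 \<or> model_lines t \<sigma> p i = line2"
  by (simp add: model_lines_def)

lemma algebraic_family_constant: "algebraic_family S (\<lambda>s. fixed_model t \<sigma> p)"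
proof -
  obtain a b where "fixed_model t \<sigma> p = model t a b (model_lines t \<sigma> p)" using fixed_model_cases by blast
  then show ?thesis
    using algebraic_family_model[of S "\<lambda>_. a" "\<lambda>_. b" "model_lines t \<sigma> p" t, OF _ _ model_lines_cases]
      regular_line_poly[OF poly_fun_const] by simp
qed

text \<open>With sign \<open>Plus\<close> all lines are constantly M, so only the section z - s
  varies.\<close>

lemma algebraic_family_open: "algebraic_family S (\<lambda>s. fixed_model t Plus (Fin s))"
proof -
  have "regular_line S (\<lambda>s x. s * (- 1))"
    by (intro regular_line_mult regular_line_param regular_line_poly poly_fun_const)
  then have "regular_line S (\<lambda>s x. - s)" by simp
  moreover have "fixed_model t Plus (Fin s) = model t (- s) 1 (\<lambda>_. line2)" for s
  proof -
    have "model_lines t Plus (Fin s) = (\<lambda>_. line2)" by (simp add: model_lines_def fun_eq_iff)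
    then show ?thesis by (simp add: fixed_model_def)
  qed
  ultimately show ?thesis
    using algebraic_family_model[of S "\<lambda>s. - s" "\<lambda>_. 1" "\<lambda>_. line2" t] regular_line_poly[OF poly_fun_const] by simp
qed

lemma dchart_loc: "dchart t (\<sigma>, fst (loc t i)) (snd (loc t i)) = dpt t \<sigma> (t i)"
  using pt_loc[of t i] by simp

text \<open>The pieces are the finite part of U, each of the eight points over D by itself, and
  infinity if it lies in U. On a single point any model is an algebraic family, so the jump of a
  parabolic line does no harm.\<close>

lemma fixed_class_constructible:
  assumes "inj t" "weights \<alpha>" "(\<Sum>i\<in>UNIV. (\<alpha> i Plus - \<alpha> i Minus) / 2) < 1 / 2"
  shows "constructibly_algebraic t (fixed_class t \<alpha>)"
proof -
  note cls = fixed_model_in_class[OF assms]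
  define S where "S = {z. Fin z \<notin> range t}"
  define Z1 where "Z1 = ((\<lambda>(\<sigma>, i). ((\<sigma>, fst (loc t i)), {snd (loc t i)})) ` UNIV :: ((psign \<times> chart) \<times> complex set) set)"
  \<comment> \<open>If infinity belongs to D, it already occurs in \<open>Z1\<close>, with both
    signs.\<close>
  define Z2 where "Z2 = (if Infty \<in> range t then {} else {((Plus, ChartInf), {0 :: complex})})"
  define Z where "Z = insert ((Plus, Chart0), S) (Z1 \<union> Z2)"
  have "- S = div_in t Chart0" by (auto simp: S_def div_in_def)
  then have finS: "finite (- S)" using finite_div_in by simp
  have "finite (UNIV :: psign set)"
  proof -
    have "(UNIV :: psign set) = {Plus, Minus}" using psign.exhaust by auto
    then show ?thesis by (metis finite.emptyI finite.insertI)
  qed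
  then have "finite Z" unfolding Z_def Z1_def Z2_def by (simp add: finite_prod)
  let ?im = "\<lambda>(a, S). dchart t a ` S"
  have imS: "?im ((Plus, Chart0), S) = {dpt t Plus (Fin z) | z. Fin z \<notin> range t}" by (auto simp: S_def)
  have im1: "?im ` Z1 = {{dpt t \<sigma> (t i)} | \<sigma> i. True}"
  proof -
    have "?im ` Z1 = range (\<lambda>x. {dpt t (fst x) (t (snd x))})"
      unfolding Z1_def by (simp add: image_image case_prod_beta dchart_loc del: dchart.simps)
    also have "\<dots> = {{dpt t \<sigma> (t i)} | \<sigma> i. True}"
    proof (intro equalityI subsetI)
      fix A assume "A \<in> {{dpt t \<sigma> (t i)} | \<sigma> i. True}"
      then obtain \<sigma> i where "A = {dpt t \<sigma> (t i)}" by blast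
      then show "A \<in> range (\<lambda>x. {dpt t (fst x) (t (snd x))})"
        using rangeI[of "\<lambda>x. {dpt t (fst x) (t (snd x))}" "(\<sigma>, i)"] by simp
    qed auto
    finally show ?thesis .
  qed
  have im2: "?im ` Z2 = (if Infty \<in> range t then {} else {{dpt t Plus Infty}})"
    unfolding Z2_def by simp
  have im: "?im ` Z = insert {dpt t Plus (Fin z) | z. Fin z \<notin> range t}
      ({{dpt t \<sigma> (t i)} | \<sigma> i. True} \<union> (if Infty \<in> range t then {} else {{dpt t Plus Infty}}))"
    unfolding Z_def image_insert image_Un imS im1 im2 ..
  have "partition_on (dpoints t) (?im ` Z)"
  proof (rule partition_onI)
    show union: "\<Union> (?im ` Z) = dpoints t"
    proof (intro equalityI subsetI)
      fix q assume "q \<in> \<Union> (?im ` Z)"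
      then show "q \<in> dpoints t" unfolding im dpoints_eq by (auto split: if_splits)
    next
      fix q assume "q \<in> dpoints t"
      then obtain \<sigma> p where q: "q = dpt t \<sigma> p" unfolding dpoints_eq by blast
      show "q \<in> \<Union> (?im ` Z)"
      proof (cases "p \<in> range t")
        case True
        then obtain i where "p = t i" by blast
        then have "{q} \<in> ?im ` Z" unfolding im q
          by (intro insertI2 UnI1 CollectI exI[of _ \<sigma>] exI[of _ i]) simp
        then show ?thesis by (rule UnionI) simp
      next
        case False
        then have "q = dpt t Plus p" unfolding q by (simp add: dpt_eq_iff)
        show ?thesis
        proof (cases p)
          case (Fin z)
          then have "q \<in> {dpt t Plus (Fin z) | z. Fin z \<notin> range t}" using False \<open>q = dpt t Plus p\<close> by blast
          then show ?thesis unfolding im by (rule UnionI[OF insertI1])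
        next
          case Infty
          then have "{q} \<in> ?im ` Z" unfolding im using False \<open>q = dpt t Plus p\<close> by (intro insertI2 UnI2) simp
          then show ?thesis by (rule UnionI) simp
        qed
      qed
    qed
    show "{} \<notin> ?im ` Z"
    proof -
      have "S \<noteq> {}" using finS infinite_UNIV_char_0[where 'a = complex] by auto
      then obtain z where "Fin z \<notin> range t" by (auto simp: S_def)
      then show ?thesis unfolding im by (auto split: if_splits)
    qed
    \<comment> \<open>\<open>?G \<sigma> p\<close> is the block through the given point; every
      member of the family containing the point equals it, which yields disjointness.\<close>
    let ?G = "\<lambda>\<sigma> p. if p \<in> range t then {dpt t \<sigma> p} else if p = Infty then {dpt t Plus Infty}
        else {dpt t Plus (Fin z) | z. Fin z \<notin> range t}"
    have G: "A = ?G \<sigma> p" if A: "A \<in> ?im ` Z" and p: "dpt t \<sigma> p \<in> A" for A \<sigma> p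
    proof -
      consider "A = {dpt t Plus (Fin z) | z. Fin z \<notin> range t}" | \<tau> i where "A = {dpt t \<tau> (t i)}"
        | "A = {dpt t Plus Infty}" "Infty \<notin> range t"
        using A unfolding im by (auto split: if_splits)
      then show ?thesis
      proof cases
        case 1
        then obtain z where "p = Fin z" "Fin z \<notin> range t" using p by (auto simp: dpt_eq_iff)
        then show ?thesis using 1 by simp
      next
        case 2
        then have "p \<in> range t" "A = {dpt t \<sigma> p}" using p by (auto simp: dpt_eq_iff)
        then show ?thesis by simp
      next
        case 3
        then have "p = Infty" using p by (simp add: dpt_eq_iff)
        then show ?thesis using 3 by simp
      qed
    qed
    show "disjnt A B" if AB: "A \<in> ?im ` Z" "B \<in> ?im ` Z" "A \<noteq> B" for A B
    proof (rule ccontr)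
      assume "\<not> disjnt A B"
      then obtain q where q: "q \<in> A" "q \<in> B" by (auto simp: disjnt_def)
      have "q \<in> dpoints t" using q(1) AB(1) union by blast
      then obtain \<sigma> p where "q = dpt t \<sigma> p" unfolding dpoints_eq by blast
      then show False using G[OF AB(1), of \<sigma> p] G[OF AB(2), of \<sigma> p] q AB(3) by simp
    qed
  qed
  moreover have "loc_closed T \<and> (\<exists>F. algebraic_family T F \<and> (\<forall>s\<in>T. F s \<in> fixed_class t \<alpha> (dchart t a s)))"
    if aT: "(a, T) \<in> Z" for a T
  proof -
    have "(a, T) \<in> Z1 \<Longrightarrow> \<exists>\<sigma> i. a = (\<sigma>, fst (loc t i)) \<and> T = {snd (loc t i)}"
      unfolding Z1_def by auto
    then consider "a = (Plus, Chart0)" "T = S"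
      | "\<exists>\<sigma> i. a = (\<sigma>, fst (loc t i)) \<and> T = {snd (loc t i)}" | "a = (Plus, ChartInf)" "T = {0}"
      using aT unfolding Z_def Z2_def by (auto split: if_splits)
    then show ?thesis
    proof cases
      case 1
      have "\<forall>s\<in>T. fixed_model t Plus (Fin s) \<in> fixed_class t \<alpha> (dchart t a s)" using cls 1 by simp
      moreover have "loc_closed T" using finS 1 by (simp add: loc_closed_def)
      ultimately show ?thesis by (intro conjI exI[of _ "\<lambda>s. fixed_model t Plus (Fin s)"] algebraic_family_open)
    next
      case 2
      then obtain \<sigma> i where 2: "a = (\<sigma>, fst (loc t i))" "T = {snd (loc t i)}" by blast
      have "\<forall>s\<in>T. fixed_model t \<sigma> (t i) \<in> fixed_class t \<alpha> (dchart t a s)"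
        using cls 2 dchart_loc[of t \<sigma> i] by simp
      moreover have "loc_closed T" using 2 by (simp add: loc_closed_def)
      ultimately show ?thesis
        by (intro conjI exI[of _ "\<lambda>_. fixed_model t \<sigma> (t i)"] algebraic_family_constant)
    next
      case 3
      have "\<forall>s\<in>T. fixed_model t Plus Infty \<in> fixed_class t \<alpha> (dchart t a s)" using cls 3 by simp
      moreover have "loc_closed T" using 3 by (simp add: loc_closed_def)
      ultimately show ?thesis
        by (intro conjI exI[of _ "\<lambda>_. fixed_model t Plus Infty"] algebraic_family_constant)
    qed
  qed
  then have "\<forall>(a, T)\<in>Z. loc_closed T \<and> (\<exists>F. algebraic_family T F \<and> (\<forall>s\<in>T. F s \<in> fixed_class t \<alpha> (dchart t a s)))"
    by (intro ballI case_prodI2) simp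
  ultimately show ?thesis unfolding constructibly_algebraic_def using \<open>finite Z\<close>
    by (intro exI[of _ Z] conjI)
qed

section \<open>Failure of algebraicity\<close>

text \<open>The factor theorem over the ring of polynomials in s, applied to the root x = s, written
  \<open>[:0, 1:]\<close>. The denominator depends on s alone, so the quotient stays continuous in
  each variable.\<close>

lemma regular_line_diagonal:
  assumes "regular_line UNIV f" "\<And>s. f s s = 0"
  shows "\<exists>g. (\<forall>s x. f s x = (x - s) * g s x) \<and> (\<forall>s x. isCont (\<lambda>s. g s x) s \<and> isCont (g s) x)"
proof -
  obtain p q where pq: "\<And>s. poly q s \<noteq> 0 \<and> (\<forall>x. f s x = eval2 p s x / poly q s)"
    using assms(1) unfolding regular_line_eval2 by blast
  have "poly (poly p [:0, 1:]) s = poly (poly p [:s:]) s" for s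
    by (induction p) simp_all
  then have "poly (poly p [:0, 1:]) s = 0" for s
    using assms(2)[of s] pq[of s] by (simp add: eval2_def)
  then have "poly p [:0, 1:] = 0" using poly_all_0_iff_0 by blast
  then obtain k where k: "p = [:- [:0, 1:], 1:] * k" unfolding poly_eq_0_iff_dvd by (elim dvdE)
  have pk: "eval2 p s x = (x - s) * eval2 k s x" for s x
    unfolding k eval2_mult by (simp add: eval2_def)
  have "isCont (\<lambda>s. eval2 k s x / poly q s) s" "isCont (\<lambda>x. eval2 k s x / poly q s) x" for s x
    using pq eval2_continuous by (auto intro!: isCont_poly_quotient continuous_intros)
  then show ?thesis using pq by (intro exI[of _ "\<lambda>s x. eval2 k s x / poly q s"]) (simp add: pk)
qed

text \<open>Near \<open>t\<^sub>i\<close> on the chart of \<open>\<P>\<^sup>-\<close>, the Higgs field vanishes at the point \<open>x = s\<close>; dividing it by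
  \<open>x - s\<close>, the parabolic line is the kernel at \<open>t\<^sub>i\<close> for \<open>s \<noteq> t\<^sub>i\<close>, hence also in the limit, where it should be \<open>L\<close>.\<close>

lemma fixed_class_not_family:
  assumes ti: "t i = Fin a" and F: "algebraic_family UNIV F"
    and mem: "\<And>s. F s \<in> fixed_class t \<alpha> (dchart t (Minus, Chart0) s)"
  shows False
proof -
  have hig: "F s \<in> objects t 1 \<alpha> 0 (\<lambda>_ _. 0)" and iso: "isomorphic t (fixed_model t Minus (Fin s)) (F s)" for s
    using mem[of s] by (simp_all add: fixed_class_dpt higgs_bundles_def)
  have E: "\<exists>\<phi>. isomorphism t (fixed_model t Minus (Fin s)) (F s) \<phi> \<and>
    (\<forall>x. conn (F s) Chart0 x ** \<phi> Chart0 x = \<phi> Chart0 x ** mat2 0 0 (x - s) 0)" for s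
  proof -
    obtain \<phi> where \<phi>: "isomorphism t (fixed_model t Minus (Fin s)) (F s) \<phi>" using iso by (auto simp: isomorphic_def)
    have "conn (F s) Chart0 x ** \<phi> Chart0 x = \<phi> Chart0 x ** mat2 0 0 (x - s) 0" for x
      using isomorphism_conn[OF \<phi>, of Chart0 x] by (simp add: fixed_model_def model_def cscale_0)
    then show ?thesis using \<phi> by blast
  qed
  have "conn (F s) Chart0 s = 0" for s
  proof -
    obtain \<phi> where \<phi>: "isomorphism t (fixed_model t Minus (Fin s)) (F s) \<phi>"
      "\<forall>x. conn (F s) Chart0 x ** \<phi> Chart0 x = \<phi> Chart0 x ** mat2 0 0 (x - s) 0" using E by blast
    have "mat2 0 0 0 0 = (0 :: complex^2^2)" by (rule mat2_eqI) simp_all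
    then have "conn (F s) Chart0 s ** \<phi> Chart0 s = 0 ** \<phi> Chart0 s"
      using \<phi>(2)[rule_format, of s] by simp
    then show ?thesis using mat2_cancel_right isomorphism_det[OF \<phi>(1)] by blast
  qed
  then have "\<exists>g. (\<forall>s x. conn (F s) Chart0 x $ j $ l = (x - s) * g s x) \<and>
      (\<forall>s x. isCont (\<lambda>s. g s x) s \<and> isCont (g s) x)" for j l
    using F by (intro regular_line_diagonal) (auto simp: algebraic_family_def)
  then have "\<forall>jl. \<exists>g. (\<forall>s x. conn (F s) Chart0 x $ fst jl $ snd jl = (x - s) * g s x) \<and>
      (\<forall>s x. isCont (\<lambda>s. g s x) s \<and> isCont (g s) x)" by blast
  from choice[OF this] obtain g where g: "\<forall>jl. (\<forall>s x. conn (F s) Chart0 x $ fst jl $ snd jl = (x - s) * g jl s x) \<and>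
      (\<forall>s x. isCont (\<lambda>s. g jl s x) s \<and> isCont (g jl s) x)" ..
  \<comment> \<open>The Higgs field divided by x - s, which no longer vanishes at the moving zero x
    = s and depends continuously on s and on x separately.\<close>
  define M where "M s x = (\<chi> j l. g (j, l) s x)" for s x
  have M: "conn (F s) Chart0 x = cscale (x - s) (M s x)" for s x
    using g[rule_format, of "(j, l)" for j l] by (intro mat2_eqI) (simp_all add: M_def)
  have M1: "isCont (\<lambda>s. M s x $ j $ l) s" and M2: "isCont (\<lambda>x. M s x $ j $ l) x" for s x j l
    using g[rule_format, of "(j, l)"] by (simp_all add: M_def)
  obtain v where v: "\<And>j. regular_base UNIV (\<lambda>s. v s $ j)" "\<And>s. v s \<noteq> 0 \<and> par (F s) i = vec.span {v s}"
    using F unfolding algebraic_family_def by blast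
  have Mv: "(M s a *v v s) $ j = 0" if "s \<noteq> a" for s j
  proof -
    obtain k where k: "k \<noteq> 0" "residue_at t (F s) i = cscale k (conn (F s) (fst (loc t i)) (snd (loc t i)))"
      using residue_at_eq by metis
    have "v s \<in> par (F s) i" using v(2)[of s] by (simp add: vec.span_base)
    then have "residue_at t (F s) i *v v s = 0"
      using objectsD(6)[OF hig[of s]] by (simp add: has_residues_def)
    then have "(cscale k (cscale (a - s) (M s a)) *v v s) $ j = 0"
      using k(2) ti by (simp add: M loc_def)
    then show ?thesis using k(1) that by (simp add: cscale_vec)
  qed
  have Mva: "M a a *v v a = 0"
  proof -
    have "(M a a *v v a) $ j = 0" for j
    proof (rule isCont_eq_limit[where f = "\<lambda>s. (M s a *v v s) $ j" and g = "\<lambda>_. 0"])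
      show "isCont (\<lambda>s. (M s a *v v s) $ j) a"
        unfolding matrix_vec_nth by (intro isCont_add isCont_mult M1 regular_base_continuous v(1))
    qed (use Mv in auto)
    then show ?thesis by (simp add: vec_eq_iff)
  qed
  obtain \<phi> where \<phi>: "isomorphism t (fixed_model t Minus (Fin a)) (F a) \<phi>"
      "\<forall>x. conn (F a) Chart0 x ** \<phi> Chart0 x = \<phi> Chart0 x ** mat2 0 0 (x - a) 0" using E by blast
  \<comment> \<open>At s = a the factor x - a is cancelled by a limit in x instead of s:
    \<open>M a a\<close> is conjugate to a nilpotent matrix whose kernel is the summand M, not
    L.\<close>
  have "(M a a ** \<phi> Chart0 a) $ j $ l = (\<phi> Chart0 a ** mat2 0 0 1 0) $ j $ l" for j l
  proof (rule isCont_eq_limit[where f = "\<lambda>x. (M a x ** \<phi> Chart0 x) $ j $ l"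
        and g = "\<lambda>x. (\<phi> Chart0 x ** mat2 0 0 1 0) $ j $ l"])
    have c: "isCont (\<lambda>x. \<phi> Chart0 x $ j $ l) a" for j l
      using poly_fun_differentiable[OF poly_mat_nth[OF isomorphism_poly[OF \<phi>(1)]]]
        field_differentiable_imp_continuous_at by blast
    show "isCont (\<lambda>x. (M a x ** \<phi> Chart0 x) $ j $ l) a" "isCont (\<lambda>x. (\<phi> Chart0 x ** mat2 0 0 1 0) $ j $ l) a"
      unfolding matrix_mult_nth by (intro isCont_add isCont_mult M2 c continuous_const)+
    fix x assume x: "x \<noteq> a"
    have "mat2 0 0 (x - a) 0 = cscale (x - a) (mat2 0 0 1 0)" by (rule mat2_eqI) simp_all
    then have "cscale (x - a) (M a x ** \<phi> Chart0 x) = cscale (x - a) (\<phi> Chart0 x ** mat2 0 0 1 0)"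
      using \<phi>(2)[rule_format, of x] by (simp add: M mat_algebra)
    then have "cscale (x - a) (M a x ** \<phi> Chart0 x) $ j $ l = cscale (x - a) (\<phi> Chart0 x ** mat2 0 0 1 0) $ j $ l"
      by simp
    then show "(M a x ** \<phi> Chart0 x) $ j $ l = (\<phi> Chart0 x ** mat2 0 0 1 0) $ j $ l" using x by simp
  qed
  then have Ma: "M a a ** \<phi> Chart0 a = \<phi> Chart0 a ** mat2 0 0 1 0" by (simp add: vec_eq_iff)
  have "par (F a) i = (\<lambda>v. \<phi> Chart0 a *v v) ` line1"
    using isomorphism_par[OF \<phi>(1), of i] ti by (simp add: loc_def fixed_model_def model_def model_lines_def)
  moreover have "v a \<in> par (F a) i" using v(2)[of a] by (simp add: vec.span_base)
  ultimately obtain u where u: "u \<in> line1" "v a = \<phi> Chart0 a *v u" by blast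
  have "\<phi> Chart0 a *v (mat2 0 0 1 0 *v u) = M a a *v v a"
    unfolding u(2) by (simp add: matrix_vector_mul_assoc Ma)
  \<comment> \<open>Pulled back to the model, the vector spanning the parabolic line lies in L by
    the sign \<open>Minus\<close> and in the kernel \<open>line2\<close> by continuity in s, so it
    is 0.\<close>
  then have "mat2 0 0 1 0 *v u = 0" using Mva mat2_vec_eq_0[OF isomorphism_det[OF \<phi>(1)]] by simp
  then have "(mat2 0 0 1 0 *v u) $ 2 = 0" by simp
  then have "u $ 1 = 0" by (simp add: matrix_vec_nth)
  then have "u = 0" using u(1) by (intro vec2_eqI) (simp_all add: line1_iff)
  then show False using u(2) v(2)[of a] by simp
qed

lemma fixed_class_not_morphism:
  assumes "inj t"
  shows "\<not> stack_morphism t (fixed_class t \<alpha>)"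
proof
  assume "stack_morphism t (fixed_class t \<alpha>)"
  then have "\<exists>F. \<forall>a. algebraic_family UNIV (F a) \<and> (\<forall>s. F a s \<in> fixed_class t \<alpha> (dchart t a s))"
    unfolding stack_morphism_def by (elim exE conjE) (rule exI)
  then obtain F where "\<forall>a. algebraic_family UNIV (F a) \<and> (\<forall>s. F a s \<in> fixed_class t \<alpha> (dchart t a s))" ..
  then have F: "algebraic_family UNIV (F (Minus, Chart0))"
    "\<And>s. F (Minus, Chart0) s \<in> fixed_class t \<alpha> (dchart t (Minus, Chart0) s)" by blast+
  \<comment> \<open>At most one of the distinct points is infinite, so one of the first two looked
    at is finite and lies in \<open>Chart0\<close>.\<close>
  obtain i where "t i \<noteq> Infty"
    using injD[OF assms, of 0 1] by (metis zero_neq_one)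
  then obtain a where "t i = Fin a" by (cases "t i") auto
  then show False using fixed_class_not_family[OF _ F] by blast
qed

section \<open>Existence of the limit\<close>

text \<open>The \<open>\<complex>\<^sup>*\<close>-orbit of \<open>Y\<close>, conjugated by \<open>diag(1, s)\<close>: this keeps the map \<open>L \<rightarrow> (E/L) \<otimes> \<Omega>(log D)\<close> fixed and
  degenerates the other entries and the parabolic lines.\<close>

definition limit_vector :: "complex^2 \<Rightarrow> complex \<Rightarrow> complex^2" where
  "limit_vector v s = (if v $ 2 = 0 then v else vec2 (s * v $ 1) (v $ 2))"

definition limit_family :: "lconn \<Rightarrow> (4 \<Rightarrow> complex^2) \<Rightarrow> complex \<Rightarrow> lconn" where
  "limit_family Y v s = \<lparr>lam = s, trans = (\<lambda>z. mat2 (1 / z) 0 0 1),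
     conn = (\<lambda>c x. mat2 (s * conn Y c x $ 1 $ 1) (s * (s * conn Y c x $ 1 $ 2)) (conn Y c x $ 2 $ 1) (s * conn Y c x $ 2 $ 2)),
     par = (\<lambda>i. vec.span {limit_vector (v i) s})\<rparr>"

lemma limit_vector_nonzero: "v \<noteq> 0 \<Longrightarrow> limit_vector v s \<noteq> 0"
  by (auto simp: limit_vector_def vec2_nonzero)

lemma limit_family_algebraic:
  assumes "connection t Y" "\<And>i. v i \<noteq> 0"
  shows "algebraic_family S (limit_family Y v)"
proof -
  have 1: "regular_base S (\<lambda>s. lam (limit_family Y v s))"
    using regular_base_linear[of S 1] by (simp add: limit_family_def)
  have 2: "regular_punctured S (\<lambda>s z. trans (limit_family Y v s) z $ i $ j)" for i j
    using regular_punctured_standard by (simp add: limit_family_def)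
  have Y: "regular_line S (\<lambda>s x. conn Y c x $ i $ j)" for c i j
    using assms(1) by (intro regular_line_poly) (simp add: connection_def)
  have "\<forall>i j. regular_line S (\<lambda>s x. conn (limit_family Y v s) c x $ i $ j)" for c
    unfolding forall_2 limit_family_def lconn.select_convs mat2_nth
    by (intro conjI regular_line_mult regular_line_param Y)
  then have 3: "regular_line S (\<lambda>s x. conn (limit_family Y v s) c x $ i $ j)" for c i j by blast
  have 4: "\<exists>w. (\<forall>j. regular_base S (\<lambda>s. w s $ j)) \<and>
        (\<forall>s\<in>S. w s \<noteq> 0 \<and> par (limit_family Y v s) i = vec.span {w s})" for i
  proof (intro exI conjI ballI)
    show "\<forall>j. regular_base S (\<lambda>s. limit_vector (v i) s $ j)"
      unfolding forall_2 limit_vector_def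
      by (cases "v i $ 2 = 0") (simp_all add: regular_base_const regular_base_linear)
    show "limit_vector (v i) s \<noteq> 0" for s using limit_vector_nonzero assms(2) .
    show "par (limit_family Y v s) i = vec.span {limit_vector (v i) s}" for s by (simp add: limit_family_def)
  qed
  show ?thesis unfolding algebraic_family_def by (intro conjI allI 1 2 3 4)
qed

text \<open>Undoing diag(1, s) on s times the connection matrix multiplies the upper right entry by
  s once more and divides the lower left one by s. This is the origin of the powers s, s^2, 1, s in
  \<open>limit_family\<close>.\<close>

lemma limit_family_isomorphism:
  assumes "standard Y" "lam Y = 1" "\<And>i. par Y i = vec.span {v i}" "\<And>i. v i \<noteq> 0" "s \<noteq> 0"
  shows "isomorphism t (limit_family Y v s) (act s Y) (\<lambda>c x. mat2 1 0 0 s)"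
proof (rule isomorphismI)
  let ?G = "limit_family Y v s"
  show "lam (act s Y) = lam ?G" by (simp add: act_def limit_family_def assms(2))
  show "poly_mat (\<lambda>x. mat2 1 0 0 s)" by (rule poly_matI) (simp_all add: poly_fun_const)
  show "det (mat2 1 0 0 s) \<noteq> 0" using assms(5) by (simp add: det_mat2)
  show "trans (act s Y) z ** mat2 1 0 0 s = mat2 1 0 0 s ** trans ?G z" if "z \<noteq> 0" for z
    using assms(1) that by (intro mat2_eqI) (simp_all add: standard_def act_def limit_family_def matrix_mult_nth)
  show "cscale (lam ?G * log_den t c x) (mderiv (\<lambda>x. mat2 1 0 0 s) x) + conn (act s Y) c x ** mat2 1 0 0 s =
      mat2 1 0 0 s ** conn ?G c x" for c x
    by (intro mat2_eqI) (simp_all add: act_def limit_family_def matrix_mult_nth)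
  show "par (act s Y) i = (\<lambda>v. mat2 1 0 0 s *v v) ` par ?G i" for i
  proof -
    have "mat2 1 0 0 s *v limit_vector (v i) s \<in> vec.span {v i}"
      using assms(4) by (auto simp: span_singleton_iff matrix_vec_nth limit_vector_def)
    moreover have "mat2 1 0 0 s *v limit_vector (v i) s \<noteq> 0"
      using mat2_vec_eq_0[OF \<open>det (mat2 1 0 0 s) \<noteq> 0\<close>] limit_vector_nonzero[OF assms(4)] by blast
    ultimately have "vec.span {mat2 1 0 0 s *v limit_vector (v i) s} = vec.span {v i}"
      by (rule span_singleton_eq)
    then show ?thesis by (simp add: limit_family_def act_def assms(3) span_image)
  qed
qed

lemma limit_family_0:
  assumes "off_diagonal t Y a b"
  shows "limit_family Y v 0 = model t a b (\<lambda>i. vec.span {limit_vector (v i) 0})"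
proof -
  have "conn Y c x $ 2 $ 1 = (case c of Chart0 \<Rightarrow> a + b * x | ChartInf \<Rightarrow> - (a * x + b) / log_ratio t)" for c x
    using assms unfolding off_diagonal_def by (cases c) simp_all
  then show ?thesis by (simp add: limit_family_def model_def)
qed

text \<open>The inverse of diag(1, s) sends (v1, v2) to a multiple of (s v1, v2), whose direction
  tends to M. Only for v2 = 0 would this vector vanish at s = 0; there the line stays L, hence the
  case distinction in \<open>limit_vector\<close>.\<close>

lemma span_limit_vector_0:
  assumes "v \<noteq> 0"
  shows "vec.span {limit_vector v 0} = (if vec.span {v} = line1 then line1 else line2)"
proof (cases "v $ 2 = 0")
  case True
  then have "vec.span {v} = line1" using assms by (intro span_singleton_eq) (simp_all add: line1_iff)
  then show ?thesis using True by (simp add: limit_vector_def)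
next
  case False
  then have "v \<notin> line1" by (simp add: line1_iff)
  then have "vec.span {v} \<noteq> line1" using vec.span_base[of v "{v}"] by auto
  then show ?thesis using False span_vec2_2[of "v $ 2"] by (simp add: limit_vector_def)
qed

section \<open>Uniqueness of the limit\<close>

text \<open>Clearing one denominator in s makes all entries polynomial in s and x, so that they also
  have values at s = 0.\<close>

lemma common_denominator:
  assumes "finite I" "\<And>e. e \<in> I \<Longrightarrow> regular_line S (f e)"
  shows "\<exists>p Q. \<forall>s\<in>S. poly Q s \<noteq> 0 \<and> (\<forall>e\<in>I. \<forall>x. f e s x * poly Q s = eval2 (p e) s x)"
  using assms
proof (induction I)
  case empty
  show ?case by (intro exI[of _ "\<lambda>_. 0"] exI[of _ 1]) simp
next
  case (insert e I)
  then obtain p Q where pQ: "\<forall>s\<in>S. poly Q s \<noteq> 0 \<and> (\<forall>e\<in>I. \<forall>x. f e s x * poly Q s = eval2 (p e) s x)"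
    by (metis (no_types, lifting) insertCI)
  obtain g q where gq: "\<forall>s\<in>S. poly q s \<noteq> 0 \<and> (\<forall>x. f e s x = eval2 g s x / poly q s)"
    using insert.prems[of e] unfolding regular_line_eval2 by blast
  show ?case
  proof (intro exI ballI conjI allI)
    let ?p = "\<lambda>e'. if e' = e then smult Q g else smult q (p e')"
    fix s assume s: "s \<in> S"
    show "poly (Q * q) s \<noteq> 0" using pQ gq s by simp
    fix e' x assume "e' \<in> insert e I"
    show "f e' s x * poly (Q * q) s = eval2 (?p e') s x"
    proof (cases "e' = e")
      case True
      then show ?thesis using gq s by (simp add: eval2_smult)
    next
      case False
      then have "f e' s x * poly Q s = eval2 (p e') s x" using pQ s \<open>e' \<in> insert e I\<close> by blast
      then have "f e' s x * poly Q s * poly q s = eval2 (p e') s x * poly q s" by simp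
      then show ?thesis using False by (simp add: eval2_smult mult.commute mult.left_commute)
    qed
  qed
qed

lemma eval2_zero_at_0:
  assumes "\<And>x. eval2 p 0 x = 0"
  shows "\<exists>q. p = smult [:0, 1:] q"
proof -
  have "map_poly (\<lambda>c. poly c 0) p = 0"
    using assms unfolding eval2_map by (intro poly_all_0_iff_0[THEN iffD1]) blast
  then have "coeff (map_poly (\<lambda>c. poly c 0) p) n = 0" for n by simp
  then have "poly (coeff p n) 0 = 0" for n by (simp add: coeff_map_poly)
  then have "[:0, 1:] dvd coeff p n" for n using poly_eq_0_iff_dvd[of "coeff p n" 0] by simp
  then have "[:[:0, 1:]:] dvd p" by (simp add: const_poly_dvd_iff)
  then show ?thesis by (elim dvdE) (auto intro!: exI)
qed

text \<open>A factor s is divided out as long as all entries vanish at s = 0. Each division lowers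
  the degree in s of the nonzero polynomial obtained from \<open>p e0\<close> at x = x0, so the
  process ends with a nonzero entry.\<close>

lemma saturate:
  fixes p :: "'e \<Rightarrow> complex poly poly"
  assumes "e0 \<in> I" "poly (p e0) [:x0:] \<noteq> 0"
  shows "\<exists>p' m. (\<forall>e\<in>I. \<forall>s x. eval2 (p e) s x = s ^ m * eval2 (p' e) s x) \<and> (\<exists>e\<in>I. \<exists>x. eval2 (p' e) 0 x \<noteq> 0)"
  using assms(2)
proof (induction "degree (poly (p e0) [:x0:])" arbitrary: p rule: less_induct)
  case less
  show ?case
  proof (cases "\<exists>e\<in>I. \<exists>x. eval2 (p e) 0 x \<noteq> 0")
    case True
    then show ?thesis by (intro exI[of _ p] exI[of _ 0]) simp
  next
    case False
    then have "\<forall>e. \<exists>q. e \<in> I \<longrightarrow> p e = smult [:0, 1:] q" using eval2_zero_at_0 by blast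
    from choice[OF this] obtain q where q: "\<forall>e. e \<in> I \<longrightarrow> p e = smult [:0, 1:] (q e)" ..
    have pq: "poly (p e0) [:x0:] = [:0, 1:] * poly (q e0) [:x0:]" using q assms(1) by simp
    then have nz: "poly (q e0) [:x0:] \<noteq> 0" using less.prems by auto
    then have "degree (poly (q e0) [:x0:]) < degree (poly (p e0) [:x0:])"
      unfolding pq by (subst degree_mult_eq) auto
    from less.hyps[of q, OF this nz] obtain p' m where
      p': "\<forall>e\<in>I. \<forall>s x. eval2 (q e) s x = s ^ m * eval2 (p' e) s x" "\<exists>e\<in>I. \<exists>x. eval2 (p' e) 0 x \<noteq> 0"
      by blast
    have "\<forall>e\<in>I. \<forall>s x. eval2 (p e) s x = s ^ Suc m * eval2 (p' e) s x"
      using q p'(1) by (simp add: eval2_smult mult.assoc)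
    then show ?thesis using p'(2) by blast
  qed
qed

lemma mderiv_cscale: "poly_mat A \<Longrightarrow> mderiv (\<lambda>x. cscale k (A x)) x = cscale k (mderiv A x)"
  using poly_mat_diff_mat[of A x] unfolding diff_mat_def
  by (intro mat2_eqI) (simp_all add: mderiv_def deriv_cmult)

lemma morphism_cscale:
  assumes "isomorphism t X Y \<phi>" "\<And>i. vec.subspace (par Y i)"
  shows "morphism t X Y (\<lambda>c x. cscale k (\<phi> c x))"
proof -
  note p = isomorphism_poly[OF assms(1)]
  have 1: "poly_mat (\<lambda>x. cscale k (\<phi> c x))" for c
    by (intro poly_mat_cscale p poly_fun_const)
  have 2: "trans Y z ** cscale k (\<phi> Chart0 z) = cscale k (\<phi> ChartInf (1 / z)) ** trans X z" if "z \<noteq> 0" for z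
    using isomorphism_trans[OF assms(1) that] by (simp add: cscale_mult_left cscale_mult_right)
  have 3: "cscale (lam X * log_den t c x) (mderiv (\<lambda>x. cscale k (\<phi> c x)) x) + conn Y c x ** cscale k (\<phi> c x) =
            cscale k (\<phi> c x) ** conn X c x" for c x
    unfolding mderiv_cscale[OF p]
    using arg_cong[OF isomorphism_conn[OF assms(1), of c x], of "cscale k"]
    by (simp add: mat_algebra mult.commute)
  have 4: "(\<lambda>v. cscale k (at_point t i \<phi>) *v v) ` par X i \<subseteq> par Y i" for i
  proof (rule image_subsetI)
    fix v assume "v \<in> par X i"
    then have "at_point t i \<phi> *v v \<in> par Y i"
      unfolding isomorphism_par[OF assms(1)] by (rule imageI)
    then show "cscale k (at_point t i \<phi>) *v v \<in> par Y i"
      unfolding cscale_vec by (rule vec.subspace_scale[OF assms(2)])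
  qed
  show ?thesis unfolding morphism_def
    by (intro conjI allI impI 1 2 3 4 isomorphism_lam[OF assms(1), symmetric])
qed

text \<open>The Langton-type argument: an isomorphism of families over \<open>s \<noteq> 0\<close>, scaled by a power of \<open>s\<close>, extends to
  a morphism which is nonzero at \<open>s = 0\<close>.\<close>

lemma limit_morphism:
  assumes F: "algebraic_family UNIV F" and G: "algebraic_family UNIV G"
    and iso: "\<And>s. s \<noteq> 0 \<Longrightarrow> isomorphism t (F s) (G s) (\<phi> s)"
    and reg: "\<And>c i j. regular_line (- {0}) (\<lambda>s x. \<phi> s c x $ i $ j)"
    and lam: "\<And>s. lam (G s) = lam (F s)"
  shows "\<exists>\<psi> c x. morphism t (F 0) (G 0) \<psi> \<and> \<psi> c x \<noteq> 0"
proof -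
  define f where "f e s x = \<phi> s (fst e) x $ fst (snd e) $ snd (snd e)" for e :: "chart \<times> 2 \<times> 2" and s x
  let ?I = "{Chart0, ChartInf} \<times> (UNIV :: 2 set) \<times> (UNIV :: 2 set)"
  have I: "(c, i, j) \<in> ?I" for c i j by (cases c) auto
  have "finite ?I" by simp
  moreover have "regular_line (- {0}) (f e)" for e using reg by (simp add: f_def[abs_def])
  ultimately obtain p Q where
    pQ: "\<forall>s\<in>-{0}. poly Q s \<noteq> 0 \<and> (\<forall>e\<in>?I. \<forall>x. f e s x * poly Q s = eval2 (p e) s x)"
    using common_denominator[of ?I "- {0}" f] by blast
  \<comment> \<open>Invertibility at one sample parameter, s = 1, supplies an entry that is not
    identically zero and starts the saturation.\<close>
  have "\<phi> 1 Chart0 0 \<noteq> 0"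
    using isomorphism_det[OF iso[of 1], of Chart0 0] by (auto simp: det_mat2)
  then obtain i0 j0 where "\<phi> 1 Chart0 0 $ i0 $ j0 \<noteq> 0" by (auto simp: vec_eq_iff)
  moreover define e0 where "e0 = (Chart0, i0, j0)"
  ultimately have "f e0 1 0 \<noteq> 0" by (simp add: f_def)
  have "f e0 1 0 * poly Q 1 = eval2 (p e0) 1 0" "poly Q 1 \<noteq> 0"
    using pQ I[of Chart0 i0 j0] unfolding e0_def by (auto simp del: mem_Times_iff)
  then have "poly (poly (p e0) [:0:]) 1 \<noteq> 0" using \<open>f e0 1 0 \<noteq> 0\<close> unfolding eval2_def by auto
  then have "poly (p e0) [:0:] \<noteq> 0" by auto
  then obtain p' m where p': "\<forall>e\<in>?I. \<forall>s x. eval2 (p e) s x = s ^ m * eval2 (p' e) s x"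
    "\<exists>e\<in>?I. \<exists>x. eval2 (p' e) 0 x \<noteq> 0"
    using saturate[of e0 ?I p 0] I[of Chart0 i0 j0] unfolding e0_def by blast
  define \<psi> where "\<psi> s c x = (\<chi> i j. eval2 (p' (c, i, j)) s x)" for s c x
  \<comment> \<open>The rescaling depends on s only, so for fixed s nonzero the multiple
    \<open>\<psi> s\<close> of the isomorphism is still a morphism.\<close>
  define k where "k s = poly Q s / s ^ m" for s
  have \<psi>: "\<psi> s c x = cscale (k s) (\<phi> s c x)" if "s \<noteq> 0" for s c x
  proof -
    have "eval2 (p' (c, i, j)) s x = k s * \<phi> s c x $ i $ j" for i j
    proof -
      have "f (c, i, j) s x * poly Q s = s ^ m * eval2 (p' (c, i, j)) s x"
        using pQ p'(1) I that by (metis ComplI singletonD)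
      then show ?thesis using that by (simp add: k_def f_def field_simps)
    qed
    then show ?thesis unfolding \<psi>_def by (intro mat2_eqI) simp_all
  qed
  have sub: "vec.subspace (par (G s) i)" for s i
  proof -
    obtain v where "\<forall>s\<in>UNIV. v s \<noteq> 0 \<and> par (G s) i = vec.span {v s}"
      using G unfolding algebraic_family_def by blast
    then show ?thesis by simp
  qed
  have mor: "morphism t (F s) (G s) (\<psi> s)" if "s \<noteq> 0" for s
  proof -
    have "\<psi> s = (\<lambda>c x. cscale (k s) (\<phi> s c x))" using \<psi>[OF that] by (intro ext)
    then show ?thesis using morphism_cscale[OF iso[OF that] sub] by simp
  qed
  have D: "mderiv (\<psi> s c) x $ i $ j = eval2 (pderiv (p' (c, i, j))) s x" for s c x i j
    unfolding mderiv_def \<psi>_def using DERIV_imp_deriv[OF eval2_has_derivative] by simp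
  have poly: "poly_mat (\<psi> s c)" for s c
    unfolding poly_mat_def \<psi>_def eval2_map by (simp add: poly_fun_poly)
  have c\<psi>: "isCont (\<lambda>s. \<psi> s c x $ i $ j) 0" for c x i j
    unfolding \<psi>_def using eval2_continuous by simp
  have cD: "isCont (\<lambda>s. mderiv (\<psi> s c) x $ i $ j) 0" for c x i j
    unfolding D by (rule eval2_continuous)
  have cl: "isCont (\<lambda>s. lam (F s)) 0"
    using F unfolding algebraic_family_def by (intro regular_base_continuous) blast
  have cF: "isCont (\<lambda>s. conn (H s) c x $ i $ j) 0" if "algebraic_family UNIV H" for H c x i j
  proof -
    have "regular_line UNIV (\<lambda>s x. conn (H s) c x $ i $ j)" using that unfolding algebraic_family_def by blast
    then show ?thesis by (rule regular_line_continuous)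
  qed
  have cT: "isCont (\<lambda>s. trans (H s) z $ i $ j) 0" if "algebraic_family UNIV H" "z \<noteq> 0" for H z i j
  proof -
    have "regular_punctured UNIV (\<lambda>s z. trans (H s) z $ i $ j)" using that(1) unfolding algebraic_family_def by blast
    then show ?thesis using that(2) by (rule regular_punctured_continuous)
  qed
  have T: "trans (G 0) z ** \<psi> 0 Chart0 z = \<psi> 0 ChartInf (1 / z) ** trans (F 0) z" if z: "z \<noteq> 0" for z
  proof -
    have "(trans (G 0) z ** \<psi> 0 Chart0 z) $ i $ j = (\<psi> 0 ChartInf (1 / z) ** trans (F 0) z) $ i $ j" for i j
    proof (rule isCont_eq_limit[where f = "\<lambda>s. (trans (G s) z ** \<psi> s Chart0 z) $ i $ j"
          and g = "\<lambda>s. (\<psi> s ChartInf (1 / z) ** trans (F s) z) $ i $ j"])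
      show "isCont (\<lambda>s. (trans (G s) z ** \<psi> s Chart0 z) $ i $ j) 0"
        "isCont (\<lambda>s. (\<psi> s ChartInf (1 / z) ** trans (F s) z) $ i $ j) 0"
        unfolding matrix_mult_nth by (intro isCont_add isCont_mult c\<psi> cT[OF F z] cT[OF G z])+
    qed (simp add: morphismD(3)[OF mor z])
    then show ?thesis by (simp add: vec_eq_iff)
  qed
  have C: "cscale (lam (F 0) * log_den t c x) (mderiv (\<psi> 0 c) x) + conn (G 0) c x ** \<psi> 0 c x = \<psi> 0 c x ** conn (F 0) c x"
    for c x
  proof -
    have "(cscale (lam (F 0) * log_den t c x) (mderiv (\<psi> 0 c) x) + conn (G 0) c x ** \<psi> 0 c x) $ i $ j
      = (\<psi> 0 c x ** conn (F 0) c x) $ i $ j" for i j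
    proof (rule isCont_eq_limit[where
          f = "\<lambda>s. (cscale (lam (F s) * log_den t c x) (mderiv (\<psi> s c) x) + conn (G s) c x ** \<psi> s c x) $ i $ j"
          and g = "\<lambda>s. (\<psi> s c x ** conn (F s) c x) $ i $ j"])
      show "isCont (\<lambda>s. (cscale (lam (F s) * log_den t c x) (mderiv (\<psi> s c) x) + conn (G s) c x ** \<psi> s c x) $ i $ j) 0"
        "isCont (\<lambda>s. (\<psi> s c x ** conn (F s) c x) $ i $ j) 0"
        unfolding matrix_mult_nth vector_add_component cscale_nth
        by (intro isCont_add isCont_mult c\<psi> cF[OF F] cF[OF G] cD cl continuous_const)+
      fix s :: complex assume "s \<noteq> 0"
      then show "(cscale (lam (F s) * log_den t c x) (mderiv (\<psi> s c) x) + conn (G s) c x ** \<psi> s c x) $ i $ j =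
        (\<psi> s c x ** conn (F s) c x) $ i $ j"
        by (rule arg_cong[OF morphismD(4)[OF mor], where f = "\<lambda>A. A $ i $ j"])
    qed
    then show ?thesis by (simp add: vec_eq_iff)
  qed
  have P: "(\<lambda>v. \<psi> 0 (fst (loc t i)) (snd (loc t i)) *v v) ` par (F 0) i \<subseteq> par (G 0) i" for i
  proof -
    let ?A = "\<lambda>s. \<psi> s (fst (loc t i)) (snd (loc t i))"
    obtain v where v: "\<forall>j. regular_base UNIV (\<lambda>s. v s $ j)" "\<forall>s\<in>UNIV. v s \<noteq> 0 \<and> par (F s) i = vec.span {v s}"
      using F unfolding algebraic_family_def by blast
    obtain w where w: "\<forall>j. regular_base UNIV (\<lambda>s. w s $ j)" "\<forall>s\<in>UNIV. w s \<noteq> 0 \<and> par (G s) i = vec.span {w s}"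
      using G unfolding algebraic_family_def by blast
    \<comment> \<open>Compatibility with parabolic lines is put in determinant form, which is
      continuous in s and so holds at s = 0.\<close>
    have eq: "(?A s *v v s) $ 1 * w s $ 2 = (?A s *v v s) $ 2 * w s $ 1" if "s \<noteq> 0" for s
    proof -
      have "v s \<in> par (F s) i" using v(2) by (simp add: vec.span_base)
      then have "?A s *v v s \<in> par (G s) i" using morphismD(5)[OF mor[OF that], of i] by blast
      then show ?thesis using w(2) span_singleton_iff by simp
    qed
    have "(?A 0 *v v 0) $ 1 * w 0 $ 2 = (?A 0 *v v 0) $ 2 * w 0 $ 1"
    proof (rule isCont_eq_limit[where f = "\<lambda>s. (?A s *v v s) $ 1 * w s $ 2" and g = "\<lambda>s. (?A s *v v s) $ 2 * w s $ 1"])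
      show "isCont (\<lambda>s. (?A s *v v s) $ 1 * w s $ 2) 0" "isCont (\<lambda>s. (?A s *v v s) $ 2 * w s $ 1) 0"
        unfolding matrix_vec_nth
        by (intro isCont_add isCont_mult c\<psi> regular_base_continuous v(1)[rule_format] w(1)[rule_format])+
    qed (rule eq)
    then have "?A 0 *v v 0 \<in> par (G 0) i" using w(2) span_singleton_iff by simp
    then show ?thesis
      using v(2) vec.subspace_scale[OF sub] by (auto simp: vec.span_singleton mat2_vscale)
  qed
  have "morphism t (F 0) (G 0) (\<psi> 0)" unfolding morphism_def
    by (intro conjI allI impI T C P poly lam[symmetric])
  moreover obtain c i j x where "eval2 (p' (c, i, j)) 0 x \<noteq> 0" using p'(2) by auto
  then have "\<psi> 0 c x \<noteq> 0" by (auto simp: \<psi>_def vec_eq_iff)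
  ultimately show ?thesis by blast
qed

section \<open>Identification of the limit with the fixed Higgs bundle at the apparent
  singularity\<close>

context
  fixes t :: "4 \<Rightarrow> p1" and \<alpha> :: "4 \<Rightarrow> psign \<Rightarrow> real"
  assumes inj: "inj t" and weights: "weights \<alpha>"
    and unstable_zone: "(\<Sum>i\<in>UNIV. (\<alpha> i Plus - \<alpha> i Minus) / 2) < 1 / 2"
begin

text \<open>Both bundles are brought to standard form, where a nonzero morphism has two nonzero
  diagonal constants.\<close>

lemma higgs_morphism_isomorphic:
  assumes X: "X \<in> objects t 1 \<alpha> 0 (\<lambda>_ _. 0)" and Y: "Y \<in> objects t 1 \<alpha> 0 (\<lambda>_ _. 0)"
    and m: "morphism t X Y \<psi>" "\<psi> c0 x0 \<noteq> 0"
  shows "isomorphic t X Y"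
proof -
  obtain X' \<phi> a b where X': "isomorphism t X X' \<phi>" "X' \<in> objects t 1 \<alpha> 0 (\<lambda>_ _. 0)" "standard X'"
      "off_diagonal t X' a b" "(a, b) \<noteq> (0, 0)"
    using object_standard_form[OF inj weights unstable_zone X] by (elim exE conjE) (rule that)
  obtain Y' \<xi> a' b' where Y': "isomorphism t Y Y' \<xi>" "Y' \<in> objects t 1 \<alpha> 0 (\<lambda>_ _. 0)" "standard Y'"
      "off_diagonal t Y' a' b'" "(a', b') \<noteq> (0, 0)"
    using object_standard_form[OF inj weights unstable_zone Y] by (elim exE conjE) (rule that)
  define \<omega> where "\<omega> c x = \<xi> c x ** (\<psi> c x ** inv2 (\<phi> c x))" for c x
  have \<omega>: "morphism t X' Y' \<omega>"
    unfolding \<omega>_def[abs_def]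
    by (rule morphism_comp[OF morphism_comp[OF isomorphism_imp_morphism[OF isomorphism_sym[OF X'(1)]] m(1)]
          isomorphism_imp_morphism[OF Y'(1)]])
  have "\<omega> c0 x0 \<noteq> 0"
  proof
    assume "\<omega> c0 x0 = 0"
    then have "\<xi> c0 x0 ** (\<psi> c0 x0 ** inv2 (\<phi> c0 x0)) = \<xi> c0 x0 ** 0" by (simp add: \<omega>_def)
    then have "\<psi> c0 x0 ** inv2 (\<phi> c0 x0) = 0 ** inv2 (\<phi> c0 x0)"
      using mat2_cancel_left[OF isomorphism_det[OF Y'(1)]] by fastforce
    then have "\<psi> c0 x0 = 0"
      using mat2_cancel_right[OF isomorphism_det[OF isomorphism_sym[OF X'(1)]]] by blast
    then show False using m(2) by contradiction
  qed
  then have det: "det (\<omega> c x) \<noteq> 0" for c x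
    using standard_higgs_morphism_det[OF \<omega> X'(3) Y'(3) objectsD(5)[OF X'(2)] X'(4,5) Y'(4,5)] by blast
  have "isomorphism t X' Y' \<omega>"
    using morphism_imp_isomorphism[OF \<omega> det objectsD(4)[OF X'(2)] objectsD(4)[OF Y'(2)]] .
  then have "isomorphic t X' Y'" by (auto simp: isomorphic_def)
  moreover have "isomorphic t X X'" "isomorphic t Y Y'" using X'(1) Y'(1) by (auto simp: isomorphic_def)
  ultimately show ?thesis using isomorphic_trans isomorphic_sym by blast
qed

text \<open>For s nonzero \<open>F\<close> and the limit family are both isomorphic to the orbit,
  hence to each other, by matrices regular in s with possible poles at 0. Rescaling leaves a nonzero
  morphism of special fibres, which is invertible by Schur's lemma.\<close>

lemma limit_unique:
  assumes X: "isomorphism t Y X \<psi>" "standard Y" "lam Y = 1"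
    and v: "\<And>i. par Y i = vec.span {v i}" "\<And>i. v i \<noteq> 0" and Y: "connection t Y"
    and F: "orbit_extension t 1 \<alpha> r X F" and G0: "limit_family Y v 0 \<in> higgs_bundles t 1 \<alpha>"
  shows "isomorphic t (F 0) (limit_family Y v 0)"
proof -
  let ?G = "limit_family Y v"
  obtain \<phi> where \<phi>: "family_iso t (- {0}) F (\<lambda>u. act u X) \<phi>"
    using F by (auto simp: orbit_extension_def)
  have FF: "algebraic_family UNIV F" "\<And>s. F s \<in> hodge_fibre t 1 \<alpha> r s" using F by (auto simp: orbit_extension_def)
  define \<xi> where "\<xi> s c x = mat2 1 0 0 (1 / s) ** (inv2 (\<psi> c x) ** \<phi> s c x)" for s c x
  have iso: "isomorphism t (F s) (?G s) (\<xi> s)" if s: "s \<noteq> 0" for s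
  proof -
    have 1: "isomorphism t (F s) (act s X) (\<phi> s)" using \<phi> s by (simp add: family_iso_def)
    note 2 = isomorphism_sym[OF isomorphism_act[OF X(1), of s]]
    note 3 = isomorphism_sym[OF limit_family_isomorphism[OF X(2,3) v s]]
    have "inv2 (mat2 1 0 0 s) = mat2 1 0 0 (1 / s)"
      using s by (intro mat2_eqI) (simp_all add: inv2_def det_mat2)
    then have "\<xi> s = (\<lambda>c x. inv2 (mat2 1 0 0 s) ** (inv2 (\<psi> c x) ** \<phi> s c x))"
      by (intro ext) (simp add: \<xi>_def)
    then show ?thesis using isomorphism_comp[OF isomorphism_comp[OF 1 2] 3] by simp
  qed
  have reg: "regular_line (- {0}) (\<lambda>s x. \<xi> s c x $ i $ j)" for c i j
    unfolding \<xi>_def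
  proof (intro regular_line_matrix_mult)
    have "regular_line (- {0}) (\<lambda>s x. k)" for k :: complex by (intro regular_line_poly poly_fun_const)
    then have "\<forall>i j. regular_line (- {0}) (\<lambda>s x. mat2 1 0 0 (1 / s) $ i $ j)"
      unfolding forall_2 mat2_nth using regular_line_inverse_param by blast
    then show "regular_line (- {0}) (\<lambda>s x. mat2 1 0 0 (1 / s) $ i $ j)" for i j by blast
    show "regular_line (- {0}) (\<lambda>s x. inv2 (\<psi> c x) $ i $ j)" for i j
      by (intro regular_line_poly poly_mat_nth[OF isomorphism_poly[OF isomorphism_sym[OF X(1)]]])
    show "regular_line (- {0}) (\<lambda>s x. \<phi> s c x $ i $ j)" for i j using \<phi> by (simp add: family_iso_def)
  qed
  have lam: "lam (?G s) = lam (F s)" for s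
    using objectsD(5)[of "F s"] FF(2)[of s] by (simp add: limit_family_def hodge_fibre_def)
  have "algebraic_family UNIV ?G" by (rule limit_family_algebraic[OF Y v(2)])
  then have "\<exists>\<omega> c x. morphism t (F 0) (?G 0) \<omega> \<and> \<omega> c x \<noteq> 0"
    by (rule limit_morphism[OF FF(1) _ iso reg lam])
  then obtain \<omega> c x where "morphism t (F 0) (?G 0) \<omega>" "\<omega> c x \<noteq> 0" by (elim exE conjE) (rule that)
  moreover have "F 0 \<in> objects t 1 \<alpha> 0 (\<lambda>_ _. 0)" using FF(2)[of 0] by (simp add: hodge_fibre_def)
  ultimately show ?thesis
    using higgs_morphism_isomorphic G0 unfolding higgs_bundles_def by blast
qed

text \<open>The limit family is one extension of the orbit, and uniqueness makes its special fibre
  represent all limits; that fibre is then recognised as a model through its value of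
  \<open>Upsilon\<close>.\<close>

lemma limit_class_eq:
  assumes "X \<in> connections t 1 \<alpha> r"
  shows "limit_class t 1 \<alpha> r X = fixed_class t \<alpha> (Upsilon t X)"
proof -
  have Xo: "X \<in> objects t 1 \<alpha> 1 r" using assms by (simp add: connections_def)
  obtain Y \<phi> a b where Y: "isomorphism t X Y \<phi>" "Y \<in> objects t 1 \<alpha> 1 r" "standard Y"
      "off_diagonal t Y a b" "(a, b) \<noteq> (0, 0)"
    using object_standard_form[OF inj weights unstable_zone Xo] by (elim exE conjE) (rule that)
  note Yo = objectsD[OF Y(2)]
  define \<psi> where "\<psi> c x = inv2 (\<phi> c x)" for c x
  have \<psi>: "isomorphism t Y X \<psi>" unfolding \<psi>_def[abs_def] by (rule isomorphism_sym[OF Y(1)])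
  have "\<forall>i. \<exists>v. v \<noteq> 0 \<and> par Y i = vec.span {v}" using quasiparabolic_line[OF Yo(4)] by metis
  from choice[OF this] obtain v where v: "\<And>i. par Y i = vec.span {v i}" "\<And>i. v i \<noteq> 0" by blast
  let ?G = "limit_family Y v"
  define Q where "Q i = (if par Y i = line1 then line1 else line2)" for i
  have G0: "?G 0 = model t a b Q"
    unfolding limit_family_0[OF Y(4)] Q_def using span_limit_vector_0[OF v(2)] v(1) by simp
  have Q: "Q i = line2 \<or> Q i = line1 \<and> t i = linear_zero a b" for i
    using residue_line1[OF Yo(3) Y(4,5), of i] by (simp add: Q_def)
  have G0h: "?G 0 \<in> higgs_bundles t 1 \<alpha>"
    unfolding G0 by (rule model_higgs[OF inj weights unstable_zone Y(5) Q])
  have alg: "algebraic_family UNIV ?G" by (rule limit_family_algebraic[OF Yo(2) v(2)])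
  have fib: "?G s \<in> hodge_fibre t 1 \<alpha> r s" for s
  proof (cases "s = 0")
    case True
    then show ?thesis using G0h by (simp add: hodge_fibre_def higgs_bundles_def)
  next
    case False
    have "act s Y \<in> objects t 1 \<alpha> (s * 1) (\<lambda>i \<sigma>. s * r i \<sigma>)" by (rule act_objects[OF Y(2) False])
    then show ?thesis
      using objects_isomorphism[OF isomorphism_sym[OF limit_family_isomorphism[OF Y(3) Yo(5) v False]]]
      by (simp add: hodge_fibre_def)
  qed
  have "family_iso t (- {0}) ?G (\<lambda>u. act u X) (\<lambda>s c x. \<psi> c x ** mat2 1 0 0 s)"
    unfolding family_iso_def
  proof (intro conjI allI ballI regular_line_matrix_mult)
    show "regular_line (- {0}) (\<lambda>s x. \<psi> c x $ i $ j)" for c i j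
      by (intro regular_line_poly poly_mat_nth[OF isomorphism_poly[OF \<psi>]])
    have "regular_line (- {0}) (\<lambda>s x. k)" for k :: complex by (intro regular_line_poly poly_fun_const)
    then have "\<forall>i j. regular_line (- {0}) (\<lambda>s x. mat2 1 0 0 s $ i $ j)"
      unfolding forall_2 mat2_nth using regular_line_param by blast
    then show "regular_line (- {0}) (\<lambda>s x. mat2 1 0 0 s $ i $ j)" for i j by blast
    fix s :: complex assume "s \<in> - {0}"
    then have "s \<noteq> 0" by simp
    then show "isomorphism t (?G s) (act s X) (\<lambda>c x. \<psi> c x ** mat2 1 0 0 s)"
      by (rule isomorphism_comp[OF limit_family_isomorphism[OF Y(3) Yo(5) v] isomorphism_act[OF \<psi>]])
  qed
  then have ext: "orbit_extension t 1 \<alpha> r X ?G"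
    unfolding orbit_extension_def using alg fib by blast
  have lim: "limit_class t 1 \<alpha> r X = {H \<in> higgs_bundles t 1 \<alpha>. isomorphic t (?G 0) H}"
  proof (intro equalityI subsetI)
    fix H assume "H \<in> limit_class t 1 \<alpha> r X"
    then obtain F where F: "H \<in> higgs_bundles t 1 \<alpha>" "orbit_extension t 1 \<alpha> r X F" "isomorphic t (F 0) H"
      by (auto simp: limit_class_def)
    have "isomorphic t (F 0) (?G 0)" by (rule limit_unique[OF \<psi> Y(3) Yo(5) v Yo(2) F(2) G0h])
    then show "H \<in> {H \<in> higgs_bundles t 1 \<alpha>. isomorphic t (?G 0) H}"
      using F isomorphic_trans isomorphic_sym by blast
  next
    fix H assume "H \<in> {H \<in> higgs_bundles t 1 \<alpha>. isomorphic t (?G 0) H}"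
    then show "H \<in> limit_class t 1 \<alpha> r X" using ext unfolding limit_class_def by blast
  qed
  \<comment> \<open>\<open>Y\<close> and the special fibre have the same a, b and the same indices
    with P_i = L, so one sign computes \<open>Upsilon\<close> for both; the sign of the isomorphic
    model is then matched through \<open>Upsilon\<close>.\<close>
  obtain \<tau> where \<tau>: "\<And>i. t i = linear_zero a b \<Longrightarrow> \<tau> = Minus \<longleftrightarrow> par Y i = line1"
    using sign_exists[OF inj, of "linear_zero a b" "\<lambda>i. par Y i = line1"] by blast
  have UY: "Upsilon t Y = dpt t \<tau> (linear_zero a b)" by (rule Upsilon_standard[OF Y(3-5) \<tau>])
  have UG: "Upsilon t (?G 0) = dpt t \<tau> (linear_zero a b)"
    unfolding G0
    by (rule Upsilon_standard[OF standard_model off_diagonal_model Y(5)])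
      (use \<tau> line1_neq_line2 in \<open>auto simp: model_def Q_def\<close>)
  have UX: "Upsilon t X = Upsilon t Y" using Y(1) by (intro Upsilon_isomorphic) (auto simp: isomorphic_def)
  have "\<exists>\<sigma>. isomorphic t (fixed_model t \<sigma> (linear_zero a b)) (?G 0)"
    unfolding G0
    by (rule standard_higgs_class[OF inj G0h[unfolded G0] standard_model off_diagonal_model Y(5)])
      (use Q in \<open>auto simp: model_def\<close>)
  then obtain \<sigma> where \<sigma>: "isomorphic t (fixed_model t \<sigma> (linear_zero a b)) (?G 0)" ..
  have "Upsilon t X = dpt t \<sigma> (linear_zero a b)"
    using Upsilon_isomorphic[OF \<sigma>] Upsilon_fixed_model UX UY UG by simp
  moreover have "isomorphic t (fixed_model t \<sigma> (linear_zero a b)) H \<longleftrightarrow> isomorphic t (?G 0) H" for H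
    using isomorphic_trans[OF \<sigma>] isomorphic_trans[OF isomorphic_sym[OF \<sigma>]] by blast
  ultimately show ?thesis unfolding lim by (simp add: fixed_class_dpt)
qed

end

theorem theorem5p6:
  fixes t :: "4 \<Rightarrow> p1"
    and r :: "4 \<Rightarrow> psign \<Rightarrow> complex"
    and \<alpha> :: "4 \<Rightarrow> psign \<Rightarrow> real"
  assumes "inj t"
    and "r \<in> residue_data 1" and "nonspecial_residues r"
    and "weights \<alpha>" and "nonspecial_weights 1 \<alpha>"
    and "(\<Sum>i\<in>UNIV. (\<alpha> i Plus - \<alpha> i Minus) / 2) < 1 / 2"
  shows "\<exists>V. bij_betw V (dpoints t) (fixed_points t 1 \<alpha>) \<and>
             constructibly_algebraic t V \<and>
             \<not> stack_morphism t V \<and>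
             (\<forall>X \<in> connections t 1 \<alpha> r. limit_class t 1 \<alpha> r X = V (Upsilon t X))"
  by (intro exI[of _ "fixed_class t \<alpha>"] conjI ballI fixed_class_bij fixed_class_constructible
      fixed_class_not_morphism limit_class_eq assms)

end
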